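(* Let $\{G_n\}_{n\ge 1}$ be a sequence of finite, simple, connected graphs such that $G_n$ is $d(n)$-regular, where $d(n)\to\infty$. Let $\Gamma_n$ be a uniform spanning tree of $G_n$ and let $X$ be a uniformly chosen vertex of $G_n$ (independent of $\Gamma_n$). Then for any fixed finite rooted tree $T$ of height $r\ge 1$, $$\lim_{n\to\infty}\mathbb{P}\big(B_{\Gamma_n}(X,r)\cong T\big)=\frac{|T_r|\,e^{-|V(T)|+|T_r|}}{|\mathrm{Stab}_T|},$$ where $\cong$ means rooted graph isomorphism.
   Context: The uniform spanning tree (UST) of a finite connected graph $G$ is a uniformly random element of the finite set of spanning trees of $G$. The height of a finite rooted tree $T$ is the maximal graph distance between the root and a vertex of $T$. For $T$ of height $r$, $T_r$ is the set of vertices of $T$ at graph distance exactly $r$ from the root, $V(T)$ is the vertex set, and $\mathrm{Stab}_T$ is the set of graph automorphisms of $T$ that preserve the root. For a tree $\Gamma$, an integer $r\ge 0$ and a vertex $v$, $B_\Gamma(v,r)$ is the induced subtree of $\Gamma$, rooted at $v$, on the vertices at graph distance (in $\Gamma$) at most $r$ from $v$. *)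

theory Defs
  imports "HOL-Probability.Probability" "Graph_Theory.Graph_Theory"
begin

text \<open>
  A finite simple graph is a \<^locale>\<open>pair_graph\<close>: an undirected edge is the pair of its two arcs.
  The library predicates \<^const>\<open>tree\<close> and \<^const>\<open>spanning_tree\<close> count the walk \<open>u, v, u\<close> along an
  edge as a cycle, so no symmetric digraph with an edge satisfies them. In a symmetric loop-free
  digraph without parallel arcs, the cycles of length at least 3 are exactly the cycles of the
  undirected graph.
\<close>

definition undirected_tree :: "'a pair_pre_digraph \<Rightarrow> bool" where
  "undirected_tree T \<longleftrightarrow>
     pair_graph T \<and> Digraph_Component.connected (with_proj T) \<and>
     \<not> (\<exists>p. pre_digraph.cycle (with_proj T) p \<and> length p \<ge> 3)"

definition spanning_trees :: "'a pair_pre_digraph \<Rightarrow> 'a pair_pre_digraph set" where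
  "spanning_trees G = {\<Gamma>. undirected_tree \<Gamma> \<and> spanning (with_proj \<Gamma>) (with_proj G)}"

definition ust :: "'a pair_pre_digraph \<Rightarrow> 'a pair_pre_digraph pmf" where
  "ust G = pmf_of_set (spanning_trees G)"

definition regular_graph :: "'a pair_pre_digraph \<Rightarrow> nat \<Rightarrow> bool" where
  "regular_graph G k \<longleftrightarrow> (\<forall>v \<in> pverts G. out_degree (with_proj G) v = k)"

text \<open>The infimum of the lengths of the walks from \<open>u\<close> to \<open>v\<close>; it is infinite if there are none.\<close>

definition graph_dist :: "'a pair_pre_digraph \<Rightarrow> 'a \<Rightarrow> 'a \<Rightarrow> ereal" where
  "graph_dist G u v = wf_digraph.\<mu> (with_proj G) (\<lambda>_. 1) u v"

definition height :: "'a pair_pre_digraph \<Rightarrow> 'a \<Rightarrow> ereal" where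
  "height T \<rho> = Max (graph_dist T \<rho> ` pverts T)"

definition level :: "'a pair_pre_digraph \<Rightarrow> 'a \<Rightarrow> nat \<Rightarrow> 'a set" where
  "level T \<rho> r = {v \<in> pverts T. graph_dist T \<rho> v = ereal (real r)}"

definition tree_ball :: "'a pair_pre_digraph \<Rightarrow> 'a \<Rightarrow> nat \<Rightarrow> ('a, 'a \<times> 'a) pre_digraph" where
  "tree_ball \<Gamma> v r = with_proj \<Gamma> \<restriction> {u \<in> pverts \<Gamma>. graph_dist \<Gamma> v u \<le> ereal (real r)}"

text \<open>
  Isomorphisms are extensional functions (\<^const>\<open>undefined\<close> outside the vertex set), so that
  each isomorphism is counted once in the cardinality of \<open>rooted_isos\<close>.
\<close>

definition rooted_isos ::
    "('a, 'b) pre_digraph \<Rightarrow> 'a \<Rightarrow> ('c, 'd) pre_digraph \<Rightarrow> 'c \<Rightarrow> ('a \<Rightarrow> 'c) set" where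
  "rooted_isos G u H v =
     {f \<in> verts G \<rightarrow>\<^sub>E verts H. bij_betw f (verts G) (verts H) \<and> f u = v \<and>
        (\<forall>x \<in> verts G. \<forall>y \<in> verts G. x \<rightarrow>\<^bsub>G\<^esub> y \<longleftrightarrow> f x \<rightarrow>\<^bsub>H\<^esub> f y)}"

definition rooted_isomorphic ::
    "('a, 'b) pre_digraph \<Rightarrow> 'a \<Rightarrow> ('c, 'd) pre_digraph \<Rightarrow> 'c \<Rightarrow> bool" where
  "rooted_isomorphic G u H v \<longleftrightarrow> rooted_isos G u H v \<noteq> {}"

definition Stab :: "'a pair_pre_digraph \<Rightarrow> 'a \<Rightarrow> ('a \<Rightarrow> 'a) set" where
  "Stab T \<rho> = rooted_isos (with_proj T) \<rho> (with_proj T) \<rho>"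

end

theory Submission
  imports Defs
begin

text \<open>
  Spanning trees are counted as parent functions. The number of spanning trees that contain a fixed
  tree with vertex set \<open>S\<close> equals the number of spanning forests rooted at \<open>S\<close>, whatever the tree, and
  adding a vertex \<open>y\<close> to \<open>S\<close> multiplies this number by the effective resistance between \<open>y\<close> and \<open>S\<close>.
  In a \<open>d\<close>-regular graph the resistance between two vertices is at least \<open>2 / (d + 2)\<close>, while its average
  over all copies of a fixed tree is at most \<open>2 / d + O(1 / d\<^sup>2)\<close>; so all resistances in a typical
  copy are close to \<open>2 / d\<close>, and by the Dirichlet and Thomson principles a typical copy of a tree with
  \<open>l\<close> vertices lies in the uniform spanning tree with probability close to \<open>l / d ^ (l - 1)\<close>.

  Apply this to a tree with \<open>k\<close> vertices, \<open>m\<close> of them below the top level, with \<open>j\<close> new leaves attached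
  to the latter. Given that a copy of the tree is contained in the spanning tree, the number of further
  tree edges at these \<open>m\<close> vertices has factorial moments close to \<open>m ^ j * (k + j) / k\<close>. By the Bonferroni
  inequalities there is no further edge with probability close to \<open>(k - m) / k * exp (- m)\<close>. The copies
  that are not typical are controlled by cutting them at the first vertex where they fail to be typical.
\<close>

section \<open>Rooted spanning forests\<close>

text \<open>Resistances are bounded below pointwise but above only on average: a regular graph may
  contain bridges, whose resistance is 1. A pointwise lower bound that agrees with the mean to
  leading order leaves a nonnegative \<open>excess\<close> of mean order \<open>1 / d ^ 2\<close>,
  and Markov's inequality makes all but a proportion \<open>O(1 / sqrt d)\<close> of the copies
  typical. The few others could still lie in the spanning tree with large probability. Hence the
  moments admit only new leaves that are typical with respect to the original copy; an edge missed
  in this way ends a copy that is typical up to its last vertex, where the excess can be averaged.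

  The denominator comes from counting embeddings instead of subgraphs: if the ball around
  \<open>x\<close> in a spanning tree is isomorphic to \<open>T\<close>, exactly
  \<open>card (Stab T \<rho>)\<close> embeddings with root \<open>x\<close> have no further edge
  below the top level, and otherwise none has. Since \<open>k - m\<close> vertices lie on the top
  level, the limit is the sum \<open>(k - m) * exp (- m)\<close> of the series with terms
  \<open>(- m) ^ j * (k + j) / fact j\<close>, divided by this cardinality.\<close>

text \<open>
  A forest is encoded by its parent function, made the identity outside \<open>V - S\<close> so that iterating it
  from any vertex stops at the root of its component.
\<close>

definition rooted_forests :: "'a set \<Rightarrow> ('a \<Rightarrow> 'a set) \<Rightarrow> 'a set \<Rightarrow> ('a \<Rightarrow> 'a) set" where
  "rooted_forests V N S =
     {p. (\<forall>v. v \<notin> V - S \<longrightarrow> p v = v) \<and> (\<forall>v\<in>V - S. p v \<in> N v) \<and> (\<forall>v\<in>V. \<exists>i. (p ^^ i) v \<in> S)}"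

definition leads :: "('a \<Rightarrow> 'a) \<Rightarrow> 'a \<Rightarrow> 'a \<Rightarrow> bool" where
  "leads p v s \<longleftrightarrow> (\<exists>i. (p ^^ i) v = s)"

lemma leads_refl [simp]: "leads p v v"
  unfolding leads_def by (rule exI[of _ 0]) simp

lemma leads_step: "leads p (p v) s \<Longrightarrow> leads p v s"
  unfolding leads_def by (metis funpow_swap1 funpow_simps_right(2) o_apply)

lemma leads_unstep: "leads p v s \<Longrightarrow> v \<noteq> s \<Longrightarrow> leads p (p v) s"
  unfolding leads_def
proof (elim exE)
  fix i assume "(p ^^ i) v = s" "v \<noteq> s"
  then show "\<exists>i. (p ^^ i) (p v) = s"
    by (cases i) (auto simp: funpow_swap1)
qed

lemma leads_trans: "leads p u v \<Longrightarrow> leads p v w \<Longrightarrow> leads p u w"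
  unfolding leads_def by (metis funpow_add o_apply)

lemma funpow_fixed: "p s = s \<Longrightarrow> (p ^^ i) s = s"
  by (induction i) auto

lemma leads_fixed: "p s = s \<Longrightarrow> leads p s t \<longleftrightarrow> s = t"
  unfolding leads_def by (auto simp: funpow_fixed)

lemma leads_fixed_unique:
  assumes "leads p v s" "leads p v t" "p s = s" "p t = t"
  shows "s = t"
proof -
  obtain i j where "(p ^^ i) v = s" "(p ^^ j) v = t"
    using assms unfolding leads_def by auto
  then have "(p ^^ (i + j)) v = t" "(p ^^ (j + i)) v = s"
    using assms by (auto simp: funpow_add funpow_fixed)
  then show ?thesis by (simp add: add.commute)
qed

text \<open>The orbits of \<open>v\<close> under \<open>q\<close> and \<open>q(z := a)\<close> agree
  until their first visit to \<open>z\<close>, and only that visit is at issue.\<close>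

lemma leads_upd_to: "leads q v z \<Longrightarrow> leads (q(z := a)) v z"
proof -
  have "(q ^^ i) v = z \<Longrightarrow> leads (q(z := a)) v z" for i
  proof (induction i arbitrary: v)
    case (Suc i)
    show ?case
    proof (cases "v = z")
      case False
      have "(q ^^ i) (q v) = z" using Suc.prems by (simp add: funpow_swap1)
      then have "leads (q(z := a)) (q v) z" by (rule Suc.IH)
      then show ?thesis using False leads_step[of "q(z := a)" v z] by (metis fun_upd_other)
    qed simp
  qed simp
  then show "leads q v z \<Longrightarrow> ?thesis" by (auto simp: leads_def)
qed

lemma leads_upd_avoid:
  assumes "\<not> leads q v z"
  shows "leads (q(z := a)) v s \<longleftrightarrow> leads q v s"
proof -
  have "((q(z := a)) ^^ i) v = (q ^^ i) v" for i
  proof (induction i)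
    case (Suc i)
    have "(q ^^ i) v \<noteq> z" using assms by (auto simp: leads_def)
    then show ?case using Suc by simp
  qed simp
  then show ?thesis by (simp add: leads_def)
qed

lemma no_return:
  assumes "leads p (p z) z" "leads p z s" "p s = s"
  shows "z = s"
proof -
  obtain i where i: "(p ^^ Suc i) z = z"
    using assms(1) unfolding leads_def by (auto simp: funpow_swap1)
  obtain j where j: "(p ^^ j) z = s"
    using assms(2) unfolding leads_def by auto
  \<comment> \<open>Running \<open>j\<close> times round the supposed cycle returns to
    \<open>z\<close>, but after \<open>j\<close> steps the orbit already rests at the fixed point
    \<open>s\<close>.\<close>
  have "((p ^^ Suc i) ^^ j) z = z" using i by (rule funpow_fixed)
  then have "(p ^^ (Suc i * j)) z = z" by (simp only: funpow_mult)
  moreover have "(p ^^ (Suc i * j)) z = (p ^^ (i * j)) ((p ^^ j) z)"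
  proof -
    have "Suc i * j = i * j + j" by simp
    then show ?thesis by (simp only: funpow_add o_apply)
  qed
  ultimately show ?thesis using j assms(3) by (simp add: funpow_fixed)
qed

lemma rooted_forestsD:
  assumes "p \<in> rooted_forests V N S"
  shows "v \<notin> V - S \<Longrightarrow> p v = v" "v \<in> V \<Longrightarrow> v \<notin> S \<Longrightarrow> p v \<in> N v"
    "v \<in> V \<Longrightarrow> \<exists>s\<in>S. leads p v s"
  using assms unfolding rooted_forests_def leads_def by (auto, blast)

lemma rooted_forestsI:
  assumes "\<And>v. v \<notin> V - S \<Longrightarrow> p v = v" "\<And>v. v \<in> V \<Longrightarrow> v \<notin> S \<Longrightarrow> p v \<in> N v"
    "\<And>v. v \<in> V \<Longrightarrow> \<exists>s\<in>S. leads p v s"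
  shows "p \<in> rooted_forests V N S"
  using assms unfolding rooted_forests_def leads_def by (auto, blast)

lemma finite_rooted_forests:
  assumes "finite V" "\<And>v. v \<in> V \<Longrightarrow> N v \<subseteq> V"
  shows "finite (rooted_forests V N S)"
proof (rule inj_on_finite)
  show "inj_on (\<lambda>p. restrict p (V - S)) (rooted_forests V N S)"
  proof (rule inj_onI, rule ext)
    fix p q v
    assume p: "p \<in> rooted_forests V N S" and q: "q \<in> rooted_forests V N S"
      and eq: "restrict p (V - S) = restrict q (V - S)"
    show "p v = q v"
    proof (cases "v \<in> V - S")
      case True
      then show ?thesis using fun_cong[OF eq, of v] by simp
    next
      case False
      then show ?thesis using p q by (simp add: rooted_forestsD(1))
    qed
  qed
  show "(\<lambda>p. restrict p (V - S)) ` rooted_forests V N S \<subseteq> (V - S) \<rightarrow>\<^sub>E V"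
  proof (intro image_subsetI restrict_PiE_iff[THEN iffD2] ballI)
    fix p v assume p: "p \<in> rooted_forests V N S" "v \<in> V - S"
    then have "p v \<in> N v" by (auto intro: rooted_forestsD(2))
    then show "p v \<in> V" using assms(2) p by auto
  qed
  show "finite ((V - S) \<rightarrow>\<^sub>E V)" using assms(1) by (intro finite_PiE) auto
qed

locale fin_graph =
  fixes V :: "'a set" and N :: "'a \<Rightarrow> 'a set"
  assumes finite_V [simp]: "finite V"
    and N_subset: "v \<in> V \<Longrightarrow> N v \<subseteq> V"
    and N_sym: "v \<in> V \<Longrightarrow> w \<in> N v \<Longrightarrow> v \<in> N w"
    and N_irrefl: "v \<notin> N v"
begin

abbreviation F where "F \<equiv> rooted_forests V N"

definition num_forests :: "'a set \<Rightarrow> nat" where "num_forests S = card (F S)"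

lemma finite_F [simp]: "finite (F S)"
  by (rule finite_rooted_forests[OF finite_V N_subset])

lemma finite_N [simp]: "v \<in> V \<Longrightarrow> finite (N v)"
  using N_subset finite_V finite_subset by blast

lemma N_in_V: "v \<in> V \<Longrightarrow> w \<in> N v \<Longrightarrow> w \<in> V"
  using N_subset by blast

lemma F_fixed: "p \<in> F S \<Longrightarrow> s \<in> S \<Longrightarrow> p s = s"
  by (rule rooted_forestsD(1)) auto

text \<open>The root \<open>z\<close> is hung below a vertex \<open>w\<close> of another component,
  so no cycle arises and the whole component of \<open>z\<close> joins the root that
  \<open>w\<close> leads to.\<close>

lemma attach:
  assumes q: "q \<in> F (insert z S)" and z: "z \<in> V - S" and w: "w \<in> N z" and nl: "\<not> leads q w z"
  shows "q(z := w) \<in> F S"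
    and "\<And>v s. v \<in> V \<Longrightarrow> s \<in> S \<Longrightarrow>
      leads (q(z := w)) v s \<longleftrightarrow> leads q v s \<or> leads q v z \<and> leads q w s"
proof -
  let ?p = "q(z := w)"
  have wV: "w \<in> V" using w z N_subset by blast
  have to_s: "leads ?p v s" if "leads q v s" "s \<in> S" for v s
  proof -
    have "\<not> leads q v z"
      using that leads_fixed_unique[of q v s z] F_fixed[OF q] z by auto
    then show ?thesis using that leads_upd_avoid by metis
  qed
  have to_z: "leads ?p v s \<longleftrightarrow> leads q w s" if "leads q v z" "s \<in> S" for v s
  proof -
    have vz: "leads ?p v z" using that by (intro leads_upd_to)
    have "leads ?p v s" if "leads ?p z s" using vz that by (rule leads_trans)
    moreover have "leads ?p z s" if l: "leads ?p v s"
    proof -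
      obtain t where t: "t \<in> insert z S" "leads q w t" using rooted_forestsD(3)[OF q wV] by auto
      with nl have "t \<in> S" by auto
      have "leads ?p z t" using to_s[OF t(2) \<open>t \<in> S\<close>] leads_step[of ?p z t] by simp
      then have "leads ?p v t" using vz leads_trans by metis
      then have "t = s"
        using l leads_fixed_unique[of ?p v t s] F_fixed[OF q] z \<open>t \<in> S\<close> \<open>s \<in> S\<close>
        by (metis Diff_iff fun_upd_other insertI2)
      then show ?thesis using \<open>leads ?p z t\<close> by simp
    qed
    moreover have "leads ?p z s \<longleftrightarrow> leads ?p w s"
      using leads_step[of ?p z s] leads_unstep[of ?p z s] z \<open>s \<in> S\<close> by auto
    moreover have "leads ?p w s \<longleftrightarrow> leads q w s" using leads_upd_avoid[OF nl] .
    ultimately show ?thesis by blast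
  qed
  show leads_iff: "leads ?p v s \<longleftrightarrow> leads q v s \<or> leads q v z \<and> leads q w s"
    if "v \<in> V" "s \<in> S" for v s
    using that to_s to_z leads_upd_avoid[of q v z w s] by blast
  show "?p \<in> F S"
  proof (rule rooted_forestsI)
    fix v assume "v \<notin> V - S"
    then show "?p v = v" using z rooted_forestsD(1)[OF q, of v] by auto
  next
    fix v assume "v \<in> V" "v \<notin> S"
    then show "?p v \<in> N v" using w rooted_forestsD(2)[OF q, of v] by auto
  next
    fix v assume v: "v \<in> V"
    obtain t where t: "t \<in> insert z S" "leads q v t" using rooted_forestsD(3)[OF q v] by auto
    obtain u where u: "u \<in> insert z S" "leads q w u" using rooted_forestsD(3)[OF q wV] by auto
    have "u \<in> S" using u nl by auto
    show "\<exists>s\<in>S. leads ?p v s"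
    proof (cases "t = z")
      case True
      then show ?thesis using to_z[of v u] t u \<open>u \<in> S\<close> by auto
    next
      case False
      then show ?thesis using to_s[of v t] t by auto
    qed
  qed
qed

text \<open>Inverse to \<open>attach\<close>. Were \<open>p z\<close> still able to reach
  \<open>z\<close> after the cut, \<open>z\<close> would lie on a cycle of \<open>p\<close> and
  never reach \<open>S\<close>.\<close>

lemma detach:
  assumes p: "p \<in> F S" and z: "z \<in> V - S"
  shows "p(z := z) \<in> F (insert z S)" "\<not> leads (p(z := z)) (p z) z" "p z \<in> N z"
proof -
  show "p z \<in> N z" using rooted_forestsD(2)[OF p] z by auto
  obtain t where t: "t \<in> S" "leads p z t" using rooted_forestsD(3)[OF p] z by auto
  show "\<not> leads (p(z := z)) (p z) z"
  proof
    assume "leads (p(z := z)) (p z) z"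
    then have "leads ((p(z := z))(z := p z)) (p z) z" by (rule leads_upd_to)
    then have "leads p (p z) z" by simp
    then have "z = t" using t(2) F_fixed[OF p t(1)] by (rule no_return)
    then show False using t z by auto
  qed
  show "p(z := z) \<in> F (insert z S)"
  proof (rule rooted_forestsI)
    fix v assume "v \<notin> V - insert z S"
    then show "(p(z := z)) v = v" using rooted_forestsD(1)[OF p, of v] by auto
  next
    fix v assume "v \<in> V" "v \<notin> insert z S"
    then show "(p(z := z)) v \<in> N v" using rooted_forestsD(2)[OF p, of v] by auto
  next
    fix v assume v: "v \<in> V"
    obtain s where s: "s \<in> S" "leads p v s" using rooted_forestsD(3)[OF p v] by auto
    show "\<exists>s\<in>insert z S. leads (p(z := z)) v s"
    proof (cases "leads p v z")
      case True
      then show ?thesis using leads_upd_to by fastforce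
    next
      case False
      then show ?thesis using leads_upd_avoid[OF False] s by auto
    qed
  qed
qed

lemma F_decompose:
  assumes z: "z \<in> V - S"
  shows "bij_betw (\<lambda>(q, w). q(z := w))
    (SIGMA q:F (insert z S). {w \<in> N z. \<not> leads q w z}) (F S)"
proof (rule bij_betw_imageI)
  show "inj_on (\<lambda>(q, w). q(z := w)) (SIGMA q:F (insert z S). {w \<in> N z. \<not> leads q w z})"
  proof (rule inj_onI, clarify)
    fix q w q' w'
    assume q: "q \<in> F (insert z S)" "q' \<in> F (insert z S)" and eq: "q(z := w) = q'(z := w')"
    have "q z = z" "q' z = z" using F_fixed[OF q(1)] F_fixed[OF q(2)] by auto
    then have "q = (q(z := w))(z := z)" "q' = (q'(z := w'))(z := z)" by (simp_all add: fun_upd_idem)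
    then show "q = q' \<and> w = w'" using eq by (metis fun_upd_same)
  qed
  show "(\<lambda>(q, w). q(z := w)) ` (SIGMA q:F (insert z S). {w \<in> N z. \<not> leads q w z}) = F S"
  proof (intro subset_antisym subsetI)
    fix p assume "p \<in> F S"
    then have "(p(z := z), p z) \<in> (SIGMA q:F (insert z S). {w \<in> N z. \<not> leads q w z})"
      using detach z by auto
    then have "(\<lambda>(q, w). q(z := w)) (p(z := z), p z)
      \<in> (\<lambda>(q, w). q(z := w)) ` (SIGMA q:F (insert z S). {w \<in> N z. \<not> leads q w z})"
      by (rule imageI)
    then show "p \<in> (\<lambda>(q, w). q(z := w)) ` (SIGMA q:F (insert z S). {w \<in> N z. \<not> leads q w z})"
      by simp
  qed (use attach(1) z in auto)
qed

lemma sum_F_decompose: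
  assumes z: "z \<in> V - S"
  shows "(\<Sum>p\<in>F S. f p) = (\<Sum>q\<in>F (insert z S). \<Sum>w | w \<in> N z \<and> \<not> leads q w z. f (q(z := w)))"
proof -
  have "(\<Sum>p\<in>F S. f p)
    = (\<Sum>a\<in>(SIGMA q:F (insert z S). {w \<in> N z. \<not> leads q w z}). f ((\<lambda>(q, w). q(z := w)) a))"
    by (rule sum.reindex_bij_betw[OF F_decompose[OF z], symmetric])
  also have "\<dots> = (\<Sum>q\<in>F (insert z S). \<Sum>w | w \<in> N z \<and> \<not> leads q w z. f (q(z := w)))"
    using z by (subst sum.Sigma) (auto simp: split_def)
  finally show ?thesis .
qed

text \<open>An edge from \<open>y\<close> to a root can be contracted: it only records that
  \<open>y\<close> belongs to the root set, so the count is the same for every admissible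
  \<open>u\<close>. This is why the shape of a prescribed tree is irrelevant.\<close>

lemma F_with_value:
  assumes y: "y \<in> V - S" and u: "u \<in> S" "u \<in> N y"
  shows "bij_betw (\<lambda>q. q(y := u)) (F (insert y S)) {p \<in> F S. p y = u}"
proof (rule bij_betw_byWitness[where f' = "\<lambda>p. p(y := y)"])
  show "\<forall>q\<in>F (insert y S). (q(y := u))(y := y) = q"
    using F_fixed[of _ "insert y S" y] by (auto simp: fun_upd_idem)
  show "(\<lambda>q. q(y := u)) ` F (insert y S) \<subseteq> {p \<in> F S. p y = u}"
  proof safe
    fix q assume q: "q \<in> F (insert y S)"
    have "q u = u" using F_fixed[OF q] u by auto
    then have "\<not> leads q u y" using leads_fixed[of q u y] u y by auto
    then show "q(y := u) \<in> F S" using attach(1)[OF q y u(2)] by blast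
  qed simp
  show "(\<lambda>p. p(y := y)) ` {p \<in> F S. p y = u} \<subseteq> F (insert y S)"
    using detach(1)[OF _ y] by auto
qed auto

text \<open>Every path is cut at its first point of \<open>S'\<close>; this carries nonemptiness
  from a single root over to all larger root sets.\<close>

lemma F_override:
  assumes p: "p \<in> F S" and "S \<subseteq> S'"
  shows "(\<lambda>v. if v \<in> S' then v else p v) \<in> F S'"
proof (rule rooted_forestsI)
  let ?q = "\<lambda>v. if v \<in> S' then v else p v"
  fix v assume v: "v \<in> V"
  have "(p ^^ i) v \<in> S \<Longrightarrow> \<exists>s\<in>S'. leads ?q v s" for i
  proof (induction i arbitrary: v)
    case 0
    then show ?case using assms(2) by (intro bexI[of _ v]) auto
  next
    case (Suc i)
    show ?case
    proof (cases "v \<in> S'")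
      case True then show ?thesis by (intro bexI[of _ v]) auto
    next
      case False
      have "(p ^^ i) (p v) \<in> S" using Suc.prems by (simp add: funpow_swap1)
      then obtain s where "s \<in> S'" "leads ?q (p v) s" using Suc.IH by auto
      then show ?thesis using False leads_step[of ?q v s] by auto
    qed
  qed
  then show "\<exists>s\<in>S'. leads ?q v s" using rooted_forestsD(3)[OF p v] by (auto simp: leads_def)
next
  fix v assume "v \<notin> V - S'"
  then show "(if v \<in> S' then v else p v) = v" using rooted_forestsD(1)[OF p, of v] by auto
next
  fix v assume "v \<in> V" "v \<notin> S'"
  then show "(if v \<in> S' then v else p v) \<in> N v" using rooted_forestsD(2)[OF p, of v] assms(2) by auto
qed

end

section \<open>Harmonic functions and the Dirichlet and Thomson principles\<close>

context fin_graph
begin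

lemma num_forests_decompose:
  assumes "z \<in> V - S"
  shows "num_forests S = (\<Sum>q\<in>F (insert z S). card {w \<in> N z. \<not> leads q w z})"
  using sum_F_decompose[OF assms, of "\<lambda>_. 1 :: nat"] by (simp add: num_forests_def)

text \<open>
  A forest rooted at \<open>S\<close> arises from a unique forest rooted at \<open>insert z S\<close> by choosing the parent of
  \<open>z\<close> among its neighbours outside the component of \<open>z\<close>; both sides are counted over these choices.
\<close>

lemma leads_count_harmonic:
  assumes z: "z \<in> V - S" and s: "s \<in> S"
  shows "(\<Sum>w\<in>N z. card {p \<in> F S. leads p w s}) = card (N z) * card {p \<in> F S. leads p z s}"
proof -
  let ?G = "\<lambda>q. {w \<in> N z. \<not> leads q w z}"
  let ?A = "\<lambda>q. {w \<in> N z. leads q w s}"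
  let ?B = "\<lambda>q. {w \<in> N z. leads q w z}"
  have zs: "z \<noteq> s" using z s by auto
  have fN: "finite (N z)" using z by auto
  have count: "card {p \<in> F S. P p} = (\<Sum>p\<in>F S. of_bool (P p))" for P
    by (simp add: Int_def)
  have excl: "\<not> (leads q w s \<and> leads q w z)" if "q \<in> F (insert z S)" for q w
    using leads_fixed_unique[of q w s z] F_fixed[OF that] zs s by auto
  have AG: "?A q \<subseteq> ?G q" if "q \<in> F (insert z S)" for q
    using excl[OF that] by auto
  have "card {p \<in> F S. leads p z s} = (\<Sum>p\<in>F S. of_bool (leads p z s))"
    by (rule count)
  also have "\<dots> = (\<Sum>q\<in>F (insert z S). \<Sum>w\<in>?G q. of_bool (leads q w s))"
    unfolding sum_F_decompose[OF z]
  proof (intro sum.cong refl)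
    fix q w assume q: "q \<in> F (insert z S)" and w: "w \<in> ?G q"
    have "\<not> leads q z s" using excl[OF q, of z] by auto
    then show "of_bool (leads (q(z := w)) z s) = of_bool (leads q w s)"
      using attach(2)[OF q z _ _, of w z s] w z s by auto
  qed
  also have "\<dots> = (\<Sum>q\<in>F (insert z S). card (?A q))"
  proof (intro sum.cong refl)
    fix q assume q: "q \<in> F (insert z S)"
    have "?G q \<inter> {w. leads q w s} = ?A q" using AG[OF q] by auto
    then show "(\<Sum>w\<in>?G q. of_bool (leads q w s)) = card (?A q)" using fN by simp
  qed
  finally have H: "card {p \<in> F S. leads p z s} = (\<Sum>q\<in>F (insert z S). card (?A q))" .
  have "(\<Sum>w\<in>N z. card {p \<in> F S. leads p w s}) = (\<Sum>p\<in>F S. \<Sum>w\<in>N z. of_bool (leads p w s))"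
    unfolding count by (rule sum.swap)
  also have "\<dots> = (\<Sum>q\<in>F (insert z S). \<Sum>w'\<in>?G q. \<Sum>w\<in>N z. of_bool (leads (q(z := w')) w s))"
    by (rule sum_F_decompose[OF z])
  also have "\<dots> = (\<Sum>q\<in>F (insert z S). card (N z) * card (?A q))"
  proof (intro sum.cong refl)
    fix q assume q: "q \<in> F (insert z S)"
    \<comment> \<open>With the parent \<open>w'\<close> of \<open>z\<close> fixed, a neighbour
      \<open>w\<close> leads to \<open>s\<close> either already in \<open>q\<close>, or through
      \<open>z\<close> provided that \<open>w'\<close> leads to \<open>s\<close>; the two cases
      exclude each other.\<close>
    have "(\<Sum>w\<in>N z. of_bool (leads (q(z := w')) w s)) = card (?A q) + card (?B q) * of_bool (leads q w' s)"
      if w': "w' \<in> ?G q" for w'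
    proof -
      have "(\<Sum>w\<in>N z. of_bool (leads (q(z := w')) w s))
        = (\<Sum>w\<in>N z. of_bool (leads q w s) + of_bool (leads q w z) * of_bool (leads q w' s) :: nat)"
      proof (intro sum.cong refl)
        fix w assume w: "w \<in> N z"
        then have "leads (q(z := w')) w s \<longleftrightarrow> leads q w s \<or> leads q w z \<and> leads q w' s"
          using attach(2)[OF q z, of w' w s] w' z s N_subset by auto
        then show "of_bool (leads (q(z := w')) w s)
          = (of_bool (leads q w s) + of_bool (leads q w z) * of_bool (leads q w' s) :: nat)"
          using excl[OF q, of w] by auto
      qed
      also have "\<dots> = card (?A q) + card (?B q) * of_bool (leads q w' s)"
        using fN by (simp add: sum.distrib Int_def flip: sum_distrib_right)
      finally show ?thesis .
    qed
    then have "(\<Sum>w'\<in>?G q. \<Sum>w\<in>N z. of_bool (leads (q(z := w')) w s))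
      = (\<Sum>w'\<in>?G q. card (?A q) + card (?B q) * of_bool (leads q w' s))"
      by (intro sum.cong refl) auto
    also have "\<dots> = card (?G q) * card (?A q) + card (?B q) * card (?G q \<inter> {w. leads q w s})"
      using fN by (simp add: sum.distrib flip: sum_distrib_left)
    also have "?G q \<inter> {w. leads q w s} = ?A q" using AG[OF q] by auto
    \<comment> \<open>The neighbours outside (\<open>?G\<close>) and inside (\<open>?B\<close>) the
      component of \<open>z\<close> together make up \<open>N z\<close>, which produces the degree
      as a factor.\<close>
    also have "card (?G q) * card (?A q) + card (?B q) * card (?A q)
      = (card (?G q) + card (?B q)) * card (?A q)" by (simp add: algebra_simps)
    also have "card (?G q) + card (?B q) = card (N z)"
    proof -
      have "N z = ?G q \<union> ?B q" by auto
      then have "card (N z) = card (?G q \<union> ?B q)" by simp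
      also have "\<dots> = card (?G q) + card (?B q)" using fN by (intro card_Un_disjoint) auto
      finally show ?thesis by simp
    qed
    finally show "(\<Sum>w'\<in>?G q. \<Sum>w\<in>N z. of_bool (leads (q(z := w')) w s)) = card (N z) * card (?A q)" .
  qed
  finally show ?thesis unfolding H by (simp add: sum_distrib_left)
qed

section \<open>Laplacian and Dirichlet energy\<close>

definition laplacian :: "('a \<Rightarrow> real) \<Rightarrow> 'a \<Rightarrow> real" where
  "laplacian f v = (\<Sum>w\<in>N v. f v - f w)"

definition energy :: "('a \<Rightarrow> real) \<Rightarrow> ('a \<Rightarrow> real) \<Rightarrow> real" where
  "energy f g = (\<Sum>v\<in>V. f v * laplacian g v)"

lemma laplacian_diff: "laplacian (\<lambda>v. f v - g v) v = laplacian f v - laplacian g v"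
  unfolding laplacian_def sum_subtractf[symmetric] by (rule sum.cong) auto

lemma laplacian_scale: "laplacian (\<lambda>v. c * f v) v = c * laplacian f v"
  unfolding laplacian_def by (simp add: sum_distrib_left algebra_simps)

lemma laplacian_const: "laplacian (\<lambda>v. c) v = 0"
  unfolding laplacian_def by simp

lemma laplacian_sum: "laplacian (\<lambda>v. \<Sum>i\<in>I. f i v) v = (\<Sum>i\<in>I. laplacian (f i) v)"
  unfolding laplacian_def by (simp add: sum_subtractf sum.swap[of _ "N v"] sum_distrib_left)

lemma arcs_swap: "(\<Sum>v\<in>V. \<Sum>w\<in>N v. \<phi> v w) = (\<Sum>v\<in>V. \<Sum>w\<in>N v. \<phi> w v)"
proof -
  have "(\<Sum>v\<in>V. \<Sum>w\<in>N v. \<phi> v w) = (\<Sum>(v, w)\<in>Sigma V N. \<phi> v w)"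
    by (subst sum.Sigma) auto
  also have "\<dots> = (\<Sum>(v, w)\<in>Sigma V N. \<phi> w v)"
    by (rule sum.reindex_bij_witness[of _ prod.swap prod.swap]) (auto dest: N_in_V N_sym)
  also have "\<dots> = (\<Sum>v\<in>V. \<Sum>w\<in>N v. \<phi> w v)"
    by (subst sum.Sigma) auto
  finally show ?thesis .
qed

text \<open>Summation by parts: the sum over arcs is averaged with its reversal, and the factor 1/2
  accounts for the two arcs of each edge.\<close>

lemma energy_eq: "energy f g = (\<Sum>v\<in>V. \<Sum>w\<in>N v. (f v - f w) * (g v - g w)) / 2"
proof -
  have "energy f g = (\<Sum>v\<in>V. \<Sum>w\<in>N v. f v * (g v - g w))"
    unfolding energy_def laplacian_def by (simp add: sum_distrib_left)
  moreover have "\<dots> = (\<Sum>v\<in>V. \<Sum>w\<in>N v. f w * (g w - g v))" by (rule arcs_swap)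
  ultimately have "2 * energy f g = (\<Sum>v\<in>V. \<Sum>w\<in>N v. f v * (g v - g w)) + (\<Sum>v\<in>V. \<Sum>w\<in>N v. f w * (g w - g v))"
    by simp
  also have "\<dots> = (\<Sum>v\<in>V. \<Sum>w\<in>N v. (f v - f w) * (g v - g w))"
    unfolding sum.distrib[symmetric] by (intro sum.cong refl) (simp add: algebra_simps)
  finally show ?thesis by simp
qed

lemma energy_commute: "energy f g = energy g f"
  unfolding energy_eq by (simp add: mult.commute)

lemma sum_laplacian: "(\<Sum>v\<in>V. laplacian f v) = 0"
proof -
  have "(\<Sum>v\<in>V. laplacian f v) = energy (\<lambda>_. 1) f" unfolding energy_def by simp
  also have "\<dots> = 0" unfolding energy_eq by simp
  finally show ?thesis .
qed

lemma energy_Cauchy_Schwarz: "(energy f g)\<^sup>2 \<le> energy f f * energy g g"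
proof -
  have e: "2 * energy f g = (\<Sum>(v, w)\<in>Sigma V N. (f v - f w) * (g v - g w))" for f g
    unfolding energy_eq by (subst sum.Sigma) auto
  have "(2 * energy f g)\<^sup>2 \<le> (2 * energy f f) * (2 * energy g g)"
    unfolding e split_def
    using Cauchy_Schwarz_ineq_sum[of "\<lambda>x. f (fst x) - f (snd x)" "\<lambda>x. g (fst x) - g (snd x)" "Sigma V N"]
    by (simp add: power2_eq_square)
  then show ?thesis by (simp add: power2_eq_square)
qed

text \<open>The probability that \<open>v\<close> belongs to the component of \<open>y\<close> in a
  uniform forest rooted at \<open>insert y S\<close>. By \<open>leads_count_harmonic\<close> it is
  the potential with value 1 at \<open>y\<close> and 0 on \<open>S\<close> that is harmonic
  elsewhere.\<close>

definition equilibrium :: "'a \<Rightarrow> 'a set \<Rightarrow> 'a \<Rightarrow> real" where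
  "equilibrium y S v = real (card {q \<in> F (insert y S). leads q v y}) / real (num_forests (insert y S))"

text \<open>The matrix-tree theorem expresses the effective resistance between \<open>y\<close> and
  \<open>S\<close>, with unit conductances and \<open>S\<close> short-circuited, as this ratio.
  Taking the ratio as the definition avoids determinants; \<open>laplacian_equilibrium_self\<close>
  recovers the electrical meaning.\<close>

definition eff_res :: "'a \<Rightarrow> 'a set \<Rightarrow> real" where
  "eff_res y S = real (num_forests (insert y S)) / real (num_forests S)"

end

text \<open>Connectedness is assumed in the form in which it is used: every vertex is the root of
  some spanning tree.\<close>

locale conn_graph = fin_graph +
  assumes V_nonempty: "V \<noteq> {}"
    and spanned: "x \<in> V \<Longrightarrow> F {x} \<noteq> {}"
begin

lemma num_forests_pos: assumes "S \<subseteq> V" "S \<noteq> {}" shows "num_forests S > 0"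
proof -
  obtain x where x: "x \<in> S" using assms by auto
  then obtain p where "p \<in> F {x}" using spanned assms by blast
  then have "F S \<noteq> {}" using F_override[of p "{x}" S] x by auto
  then show ?thesis unfolding num_forests_def by (simp add: card_gt_0_iff)
qed

context
  fixes y S assumes S: "S \<subseteq> V" "S \<noteq> {}" and y: "y \<in> V - S"
begin

lemma num_forests_insert_pos: "num_forests (insert y S) > 0"
  using num_forests_pos[of "insert y S"] S y by auto

lemma eff_res_pos: "eff_res y S > 0"
  unfolding eff_res_def using num_forests_insert_pos num_forests_pos[OF S] by simp

lemma equilibrium_self: "equilibrium y S y = 1"
  using num_forests_insert_pos by (auto simp: equilibrium_def num_forests_def)

lemma equilibrium_boundary: assumes "s \<in> S" shows "equilibrium y S s = 0"
proof -
  have "{q \<in> F (insert y S). leads q s y} = {}"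
    using assms y F_fixed[of _ "insert y S" s] by (auto simp: leads_fixed)
  then show ?thesis unfolding equilibrium_def by (simp only: card.empty of_nat_0 div_0)
qed

lemma laplacian_equilibrium_interior:
  assumes "v \<in> V - S" "v \<noteq> y"
  shows "laplacian (equilibrium y S) v = 0"
proof -
  have "(\<Sum>w\<in>N v. real (card {q \<in> F (insert y S). leads q w y}))
    = real (card (N v)) * real (card {q \<in> F (insert y S). leads q v y})"
    unfolding of_nat_sum[symmetric] of_nat_mult[symmetric] of_nat_eq_iff
    by (rule leads_count_harmonic) (use assms in auto)
  then show ?thesis
    unfolding laplacian_def equilibrium_def by (simp add: sum_subtractf flip: sum_divide_distrib)
qed

text \<open>A forest rooted at \<open>S\<close> is one rooted at \<open>insert y S\<close> with a
  parent chosen for \<open>y\<close> outside its component. After exchanging the two sums each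
  neighbour \<open>w\<close> of \<open>y\<close> has the weight
  \<open>1 - equilibrium y S w\<close>, and these weights add up to the Laplacian at
  \<open>y\<close>.\<close>

lemma laplacian_equilibrium_self: "laplacian (equilibrium y S) y = 1 / eff_res y S"
proof -
  have fN: "finite (N y)" using y by auto
  have "real (num_forests S) = (\<Sum>q\<in>F (insert y S). real (card {w \<in> N y. \<not> leads q w y}))"
    using num_forests_decompose[OF y] by simp
  also have "\<dots> = (\<Sum>q\<in>F (insert y S). \<Sum>w\<in>N y. 1 - of_bool (leads q w y))"
  proof (intro sum.cong refl)
    fix q
    have "(\<Sum>w\<in>N y. 1 - of_bool (leads q w y) :: real) = (\<Sum>w\<in>N y. of_bool (\<not> leads q w y))"
      by (intro sum.cong) auto
    also have "\<dots> = card {w \<in> N y. \<not> leads q w y}" using fN by (simp add: Int_def)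
    finally show "real (card {w \<in> N y. \<not> leads q w y}) = (\<Sum>w\<in>N y. 1 - of_bool (leads q w y))" by simp
  qed
  also have "\<dots> = (\<Sum>w\<in>N y. \<Sum>q\<in>F (insert y S). 1 - of_bool (leads q w y))" by (rule sum.swap)
  also have "\<dots> = (\<Sum>w\<in>N y. real (num_forests (insert y S)) * (1 - equilibrium y S w))"
  proof (intro sum.cong refl)
    fix w
    have "(\<Sum>q\<in>F (insert y S). 1 - of_bool (leads q w y) :: real)
      = real (num_forests (insert y S)) - real (card {q \<in> F (insert y S). leads q w y})"
      by (simp add: sum_subtractf num_forests_def Int_def)
    then show "(\<Sum>q\<in>F (insert y S). 1 - of_bool (leads q w y) :: real) = real (num_forests (insert y S)) * (1 - equilibrium y S w)"
      using num_forests_insert_pos unfolding equilibrium_def by (simp only: right_diff_distrib) simp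
  qed
  also have "\<dots> = real (num_forests (insert y S)) * laplacian (equilibrium y S) y"
    unfolding laplacian_def equilibrium_self by (simp add: sum_distrib_left)
  finally show ?thesis using num_forests_insert_pos num_forests_pos[OF S] by (simp add: eff_res_def field_simps)
qed

text \<open>The Laplacian of the potential has total mass zero, so the constant \<open>c\<close> may
  be subtracted from \<open>f\<close>; then only the contribution of \<open>y\<close>
  survives.\<close>

lemma energy_equilibrium:
  assumes "\<And>s. s \<in> S \<Longrightarrow> f s = c"
  shows "energy f (equilibrium y S) = (f y - c) / eff_res y S"
proof -
  have "energy f (equilibrium y S) = energy f (equilibrium y S) - c * (\<Sum>v\<in>V. laplacian (equilibrium y S) v)"
    by (simp add: sum_laplacian)
  also have "\<dots> = (\<Sum>v\<in>V. (f v - c) * laplacian (equilibrium y S) v)"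
    unfolding energy_def by (simp add: sum_distrib_left sum_subtractf[symmetric] left_diff_distrib)
  also have "\<dots> = (\<Sum>v\<in>{y}. (f v - c) * laplacian (equilibrium y S) v)"
    using y assms laplacian_equilibrium_interior by (intro sum.mono_neutral_right) auto
  also have "\<dots> = (f y - c) / eff_res y S" using laplacian_equilibrium_self by simp
  finally show ?thesis .
qed

lemma energy_equilibrium_self: "energy (equilibrium y S) (equilibrium y S) = 1 / eff_res y S"
  using energy_equilibrium[of "equilibrium y S" 0] equilibrium_boundary equilibrium_self by simp

text \<open>Cauchy-Schwarz against the equilibrium potential, whose inner product with every such
  \<open>f\<close> equals its own energy.\<close>

lemma Dirichlet:
  assumes "f y = 1" "\<And>s. s \<in> S \<Longrightarrow> f s = 0"
  shows "1 / eff_res y S \<le> energy f f"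
proof -
  have "(1 / eff_res y S)\<^sup>2 \<le> energy f f * (1 / eff_res y S)"
    using energy_Cauchy_Schwarz[of f "equilibrium y S"] energy_equilibrium[of f 0] assms energy_equilibrium_self by simp
  then show ?thesis using eff_res_pos by (simp add: power2_eq_square field_simps)
qed

text \<open>\<open>g\<close> is the potential of a unit flow that starts at \<open>y\<close> and
  leaves through \<open>s\<close> at rate \<open>c s\<close>; it need not be constant on
  \<open>S\<close>. Its energy is \<open>\<theta>\<close>, its inner product with the equilibrium
  potential is 1, and Cauchy-Schwarz concludes.\<close>

lemma Thomson:
  assumes "g y - (\<Sum>s\<in>S. c s * g s) = \<theta>" "(\<Sum>s\<in>S. c s) = 1"
    and "\<And>v. v \<in> V - S \<Longrightarrow> v \<noteq> y \<Longrightarrow> laplacian g v = 0"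
    and "laplacian g y = 1" and "\<And>s. s \<in> S \<Longrightarrow> laplacian g s = - c s"
  shows "eff_res y S \<le> \<theta>"
proof -
  have fS: "finite S" using S finite_subset finite_V by blast
  have en: "energy f g = f y - (\<Sum>s\<in>S. c s * f s)" for f
  proof -
    have "energy f g = (\<Sum>v\<in>insert y S. f v * laplacian g v)"
      unfolding energy_def using S y assms(3) by (intro sum.mono_neutral_right) auto
    also have "\<dots> = f y * laplacian g y + (\<Sum>s\<in>S. f s * laplacian g s)"
      using y fS by (subst sum.insert) auto
    also have "\<dots> = f y - (\<Sum>s\<in>S. c s * f s)"
      using assms(4,5) by (simp add: sum_negf mult.commute)
    finally show ?thesis .
  qed
  have "energy (equilibrium y S) g = 1" using en[of "equilibrium y S"] equilibrium_self equilibrium_boundary by simp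
  then have "1 \<le> (1 / eff_res y S) * \<theta>"
    using energy_Cauchy_Schwarz[of "equilibrium y S" g] energy_equilibrium_self en[of g] assms(1) by simp
  then show ?thesis using eff_res_pos by (simp add: field_simps)
qed

end

end

section \<open>Effective resistances\<close>

context conn_graph
begin

section \<open>Unit dipoles and the resistance metric\<close>

definition dipole :: "('a \<Rightarrow> real) \<Rightarrow> 'a \<Rightarrow> 'a \<Rightarrow> bool" where
  "dipole g u v \<longleftrightarrow> (\<forall>w\<in>V. laplacian g w = of_bool (w = u) - of_bool (w = v))"

text \<open>Dipoles represent differences of values in the energy form. Evaluating the energy of two
  dipoles in both orders yields the uniqueness and symmetry statements that follow.\<close>

lemma energy_dipole:
  assumes "dipole g u v" "u \<in> V" "v \<in> V"
  shows "energy f g = f u - f v"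
proof -
  have delta: "(\<Sum>w\<in>V. f w * of_bool (w = x)) = f x" if "x \<in> V" for x
  proof -
    have "(\<Sum>w\<in>V. f w * of_bool (w = x)) = (\<Sum>w\<in>V. if w = x then f w else 0)"
      by (rule sum.cong) auto
    then show ?thesis using that by simp
  qed
  have "energy f g = (\<Sum>w\<in>V. f w * of_bool (w = u) - f w * of_bool (w = v))"
    unfolding energy_def
  proof (intro sum.cong refl)
    fix w assume "w \<in> V"
    then have "laplacian g w = of_bool (w = u) - of_bool (w = v)" using assms(1) by (simp only: dipole_def)
    then show "f w * laplacian g w = f w * of_bool (w = u) - f w * of_bool (w = v)"
      by (simp only: right_diff_distrib)
  qed
  then show ?thesis using assms(2,3) by (simp only: sum_subtractf delta)
qed

lemma dipole_diff:
  assumes "dipole f u w" "dipole g v w"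
  shows "dipole (\<lambda>x. f x - g x) u v"
  using assms unfolding dipole_def laplacian_diff by simp

lemma dipole_uminus:
  assumes "dipole f u v"
  shows "dipole (\<lambda>x. - f x) v u"
  using assms laplacian_scale[of "-1" f] unfolding dipole_def by simp

definition dipole_pot :: "'a \<Rightarrow> 'a \<Rightarrow> 'a \<Rightarrow> real" where
  "dipole_pot y s v = eff_res y {s} * equilibrium y {s} v"

lemma dipole_pot_dipole:
  assumes "y \<in> V" "s \<in> V" "y \<noteq> s"
  shows "dipole (dipole_pot y s) y s"
proof -
  have S: "{s} \<subseteq> V" "{s} \<noteq> {}" "y \<in> V - {s}" using assms by auto
  have laplacian: "laplacian (dipole_pot y s) v = eff_res y {s} * laplacian (equilibrium y {s}) v" for v
    using laplacian_scale[of "eff_res y {s}" "equilibrium y {s}"] by (simp add: dipole_pot_def[abs_def])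
  have self: "laplacian (dipole_pot y s) y = 1"
    using laplacian laplacian_equilibrium_self[OF S] eff_res_pos[OF S] by simp
  have int: "laplacian (dipole_pot y s) v = 0" if "v \<in> V" "v \<noteq> y" "v \<noteq> s" for v
    using laplacian laplacian_equilibrium_interior[OF S] that by simp
  \<comment> \<open>The value at the sink \<open>s\<close> is forced because the Laplacian has total
    mass zero.\<close>
  have "0 = (\<Sum>v\<in>V. laplacian (dipole_pot y s) v)" by (simp add: sum_laplacian)
  also have "\<dots> = (\<Sum>v\<in>{y, s}. laplacian (dipole_pot y s) v)"
    using assms int by (intro sum.mono_neutral_right) auto
  also have "\<dots> = 1 + laplacian (dipole_pot y s) s" using assms self by simp
  finally show ?thesis using assms self int by (auto simp: dipole_def)
qed

lemma dipole_pot_pole: "y \<in> V \<Longrightarrow> s \<in> V \<Longrightarrow> y \<noteq> s \<Longrightarrow> dipole_pot y s y = eff_res y {s}"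
  unfolding dipole_pot_def by (subst equilibrium_self) auto

lemma dipole_pot_zero: "y \<in> V \<Longrightarrow> s \<in> V \<Longrightarrow> y \<noteq> s \<Longrightarrow> dipole_pot y s s = 0"
  unfolding dipole_pot_def by (subst equilibrium_boundary) auto

lemma dipole_unique:
  assumes "dipole g u v" "u \<in> V" "v \<in> V" "u \<noteq> v"
  shows "g u - g v = eff_res u {v}"
proof -
  have "g u - g v = energy (dipole_pot u v) g"
    using energy_dipole[OF dipole_pot_dipole[of u v], of g] energy_commute assms by simp
  also have "\<dots> = eff_res u {v}"
    using energy_dipole[OF assms(1-3)] dipole_pot_pole dipole_pot_zero assms by simp
  finally show ?thesis .
qed

definition R :: "'a \<Rightarrow> 'a \<Rightarrow> real" where
  "R u v = (if u = v then 0 else eff_res u {v})"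

lemma R_self [simp]: "R u u = 0"
  by (simp add: R_def)

lemma R_commute:
  assumes "u \<in> V" "v \<in> V"
  shows "R u v = R v u"
proof (cases "u = v")
  case False
  have "dipole (\<lambda>x. - dipole_pot v u x) u v"
    using dipole_pot_dipole[of v u] False assms by (intro dipole_uminus) auto
  then show ?thesis
    using dipole_unique[of "\<lambda>x. - dipole_pot v u x" u v] dipole_pot_pole[of v u] dipole_pot_zero[of v u] False assms
    by (simp add: R_def)
qed simp

text \<open>Both \<open>R u v\<close> and \<open>R v u\<close> have the numerator
  \<open>num_forests {u, v}\<close>, so the symmetry of \<open>R\<close> makes the denominators
  equal.\<close>

lemma num_forests_singleton_eq:
  assumes "u \<in> V" "v \<in> V"
  shows "num_forests {u} = num_forests {v}"
proof (cases "u = v")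
  case False
  have "eff_res u {v} = eff_res v {u}" using R_commute[OF assms] False by (simp add: R_def)
  moreover have "num_forests {u, v} > 0" "num_forests {u} > 0" "num_forests {v} > 0" using num_forests_pos assms by auto
  ultimately show ?thesis by (simp add: eff_res_def insert_commute[of v u] field_simps)
qed simp

text \<open>The inner product of the energy form between the two unit flows from \<open>y\<close> to \<open>s\<close> and to \<open>t\<close>.\<close>

lemma dipole_pot_drop:
  assumes "y \<in> V" "s \<in> V" "t \<in> V" "y \<noteq> s" "y \<noteq> t"
  shows "dipole_pot y s y - dipole_pot y s t = (R y s + R y t - R s t) / 2"
proof (cases "s = t")
  case True
  then show ?thesis using assms dipole_pot_pole dipole_pot_zero by (simp add: R_def)
next
  case False
  have dip: "dipole (\<lambda>x. dipole_pot y t x - dipole_pot y s x) s t"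
    using dipole_diff[OF dipole_uminus[OF dipole_pot_dipole[of y s]] dipole_uminus[OF dipole_pot_dipole[of y t]]]
      assms by simp
  have "(dipole_pot y t s - dipole_pot y s s) - (dipole_pot y t t - dipole_pot y s t) = R s t"
    using dipole_unique[OF dip] assms False by (simp add: R_def)
  moreover have "dipole_pot y s y - dipole_pot y s t = dipole_pot y t y - dipole_pot y t s"
    using energy_dipole[OF dipole_pot_dipole[of y s], of "dipole_pot y t"] energy_dipole[OF dipole_pot_dipole[of y t], of "dipole_pot y s"]
      energy_commute[of "dipole_pot y s" "dipole_pot y t"] assms by simp
  ultimately show ?thesis using assms dipole_pot_pole dipole_pot_zero by (simp add: R_def)
qed

text \<open>Thomson's principle for the average of the unit flows from \<open>y\<close> to the points of \<open>S\<close>.\<close>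

lemma eff_res_le_average:
  assumes S: "S \<subseteq> V" "S \<noteq> {}" and y: "y \<in> V - S"
  shows "eff_res y S \<le> (\<Sum>s\<in>S. R y s) / card S - (\<Sum>s\<in>S. \<Sum>t\<in>S. R s t) / (2 * (card S)\<^sup>2)"
proof -
  let ?k = "real (card S)"
  have fS: "finite S" using S finite_subset finite_V by blast
  have k: "?k > 0" using S fS by (simp add: card_gt_0_iff)
  define g where "g v = (1 / ?k) * (\<Sum>s\<in>S. dipole_pot y s v)" for v
  have laplacian_g: "laplacian g v = (1 / ?k) * (\<Sum>s\<in>S. laplacian (dipole_pot y s) v)" for v
    unfolding g_def[abs_def] laplacian_scale laplacian_sum ..
  have laplacian_dipole_pot: "laplacian (dipole_pot y s) v = of_bool (v = y) - of_bool (v = s)" if "s \<in> S" "v \<in> V" for s v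
  proof -
    have "dipole (dipole_pot y s) y s" using that S y by (intro dipole_pot_dipole) auto
    then show ?thesis using that by (simp add: dipole_def)
  qed
  have laplacian_g': "laplacian g v = of_bool (v = y) - of_bool (v \<in> S) / ?k" if "v \<in> V" for v
  proof -
    have "(\<Sum>s\<in>S. laplacian (dipole_pot y s) v) = (\<Sum>s\<in>S. of_bool (v = y) - of_bool (v = s))"
      using laplacian_dipole_pot that by (intro sum.cong) auto
    also have "\<dots> = ?k * of_bool (v = y) - of_bool (v \<in> S)"
      using fS by (simp add: sum_subtractf of_bool_def)
    finally show ?thesis unfolding laplacian_g using k by (simp add: field_simps)
  qed
  \<comment> \<open>The averaged flow leaves through every point of \<open>S\<close> at the same
    rate \<open>1 / ?k\<close>.\<close>
  have "eff_res y S \<le> g y - (\<Sum>t\<in>S. 1 / ?k * g t)"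
  proof (rule Thomson[OF S y])
    show "laplacian g v = 0" if "v \<in> V - S" "v \<noteq> y" for v using that laplacian_g'[of v] by auto
    show "laplacian g y = 1" using laplacian_g'[of y] y by auto
    show "laplacian g s = - (1 / ?k)" if "s \<in> S" for s using that laplacian_g'[of s] y S by auto
  qed (use k in auto)
  also have "\<dots> = (\<Sum>s\<in>S. \<Sum>t\<in>S. dipole_pot y s y - dipole_pot y s t) / ?k\<^sup>2"
  proof -
    have "(\<Sum>s\<in>S. \<Sum>t\<in>S. dipole_pot y s y - dipole_pot y s t) = ?k * (\<Sum>s\<in>S. dipole_pot y s y) - (\<Sum>t\<in>S. \<Sum>s\<in>S. dipole_pot y s t)"
      by (simp add: sum_subtractf sum_distrib_left sum.swap[of "\<lambda>s t. dipole_pot y s t"])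
    moreover have "(\<Sum>t\<in>S. 1 / ?k * g t) = (\<Sum>t\<in>S. \<Sum>s\<in>S. dipole_pot y s t) / ?k\<^sup>2"
      by (simp add: g_def sum_divide_distrib power2_eq_square)
    moreover have "g y = ?k * (\<Sum>s\<in>S. dipole_pot y s y) / ?k\<^sup>2"
      using k by (simp add: g_def power2_eq_square)
    ultimately show ?thesis by (simp only: diff_divide_distrib)
  qed
  also have "(\<Sum>s\<in>S. \<Sum>t\<in>S. dipole_pot y s y - dipole_pot y s t) = (\<Sum>s\<in>S. \<Sum>t\<in>S. (R y s + R y t - R s t) / 2)"
    using S y by (intro sum.cong refl dipole_pot_drop) auto
  also have "\<dots> = (2 * ?k * (\<Sum>s\<in>S. R y s) - (\<Sum>s\<in>S. \<Sum>t\<in>S. R s t)) / 2"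
    by (simp add: sum_divide_distrib[symmetric] sum_subtractf sum.distrib sum_distrib_left[symmetric])
  finally show ?thesis using k by (simp add: field_simps power2_eq_square)
qed

text \<open>Rayleigh monotonicity: the equilibrium potential for \<open>S\<close> is a test function
  for the single point \<open>s\<close>.\<close>

lemma eff_res_le_R:
  assumes S: "S \<subseteq> V" and s: "s \<in> S" and y: "y \<in> V - S"
  shows "eff_res y S \<le> R y s"
proof -
  have S': "S \<noteq> {}" and sV: "{s} \<subseteq> V" "{s} \<noteq> {}" "y \<in> V - {s}" using assms by auto
  have "1 / eff_res y {s} \<le> energy (equilibrium y S) (equilibrium y S)"
    using equilibrium_self[OF S S' y] equilibrium_boundary[OF S S' y] s by (intro Dirichlet[OF sV]) auto
  then have "1 / eff_res y {s} \<le> 1 / eff_res y S" using energy_equilibrium_self[OF S S' y] by simp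
  then show ?thesis
    using eff_res_pos[OF sV] eff_res_pos[OF S S' y] y s by (auto simp: R_def field_simps)
qed

section \<open>Green function grounded at a vertex\<close>

definition green :: "'a \<Rightarrow> 'a \<Rightarrow> 'a \<Rightarrow> real" where
  "green z u v = (if v = z then 0 else dipole_pot v z u)"

lemma dipole_green: "z \<in> V \<Longrightarrow> v \<in> V \<Longrightarrow> dipole (\<lambda>u. green z u v) v z"
  using dipole_pot_dipole[of v z] by (cases "v = z") (auto simp: green_def dipole_def laplacian_const)

lemma green_pole: "z \<in> V \<Longrightarrow> v \<in> V \<Longrightarrow> green z z v = 0"
  using dipole_pot_zero[of v z] by (auto simp: green_def)

lemma green_commute:
  assumes "z \<in> V" "u \<in> V" "v \<in> V"
  shows "green z u v = green z v u"
  using energy_dipole[OF dipole_green[of z u], of "\<lambda>x. green z x v"]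
    energy_dipole[OF dipole_green[of z v], of "\<lambda>x. green z x u"]
    energy_commute[of "\<lambda>x. green z x v" "\<lambda>x. green z x u"] green_pole assms by simp

text \<open>The difference of the Green functions with poles \<open>u\<close> and \<open>v\<close>
  is a dipole from \<open>u\<close> to \<open>v\<close>, the sinks at \<open>z\<close> cancelling;
  so \<open>R\<close> is the squared distance associated with the Green kernel.\<close>

lemma R_green:
  assumes "z \<in> V" "u \<in> V" "v \<in> V"
  shows "R u v = green z u u + green z v v - 2 * green z u v"
proof (cases "u = v")
  case False
  then show ?thesis
    using dipole_unique[OF dipole_diff[OF dipole_green[of z u] dipole_green[of z v]]]
      green_commute[of z u v] assms by (simp add: R_def)
qed simp

lemma sum_green:
  assumes "z \<in> V" "u \<in> V" "v \<in> V"
  shows "(\<Sum>w\<in>N u. green z w v) = card (N u) * green z u v - of_bool (u = v) + of_bool (u = z)"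
proof -
  have "laplacian (\<lambda>w. green z w v) u = of_bool (u = v) - of_bool (u = z)"
    using dipole_green[of z v] assms by (simp only: dipole_def)
  then show ?thesis unfolding laplacian_def sum_subtractf sum_constant by linarith
qed

end

section \<open>Two-sided resistance bounds in regular graphs\<close>

locale reg_graph = conn_graph +
  fixes d :: nat
  assumes degree: "v \<in> V \<Longrightarrow> card (N v) = d" and d_pos: "d \<ge> 1"
begin

text \<open>Dirichlet's principle with the constant value \<open>c\<close> off
  \<open>insert y S\<close>. To leading order each of the \<open>k + 1\<close> points of
  \<open>insert y S\<close> sends \<open>d\<close> edges to one further vertex; the harmonic value
  there, given 1 at \<open>y\<close> and 0 on \<open>S\<close>, is
  \<open>1 / (k + 1)\<close>.\<close>

lemma eff_res_lower:
  assumes S: "S \<subseteq> V" "S \<noteq> {}" and y: "y \<in> V - S"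
  shows "eff_res y S \<ge> (1 + 1 / card S) / (d + card S + 1)"
proof -
  define k where "k = real (card S)"
  have fS: "finite S" using S finite_subset finite_V by blast
  have k: "k \<ge> 1" using S fS unfolding k_def by (simp add: Suc_le_eq card_gt_0_iff)
  define c where "c = 1 / (k + 1)"
  have c: "0 \<le> c" "c \<le> 1" using k by (auto simp: c_def)
  define f where "f v = (if v = y then 1 else if v \<in> S then 0 else c)" for v
  have fN: "finite (N v)" if "v \<in> V" for v using that by simp
  have laplacian_y: "laplacian f y \<le> d * (1 - c) + c * k"
  proof -
    have "laplacian f y \<le> (\<Sum>w\<in>N y. (1 - c) + c * of_bool (w \<in> S))"
      unfolding laplacian_def f_def using N_irrefl y c by (intro sum_mono) auto
    also have "\<dots> = d * (1 - c) + c * card (N y \<inter> S)"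
      using fN y degree by (simp add: sum.distrib sum_distrib_left[symmetric] Int_def)
    also have "\<dots> \<le> d * (1 - c) + c * k"
      using c fS unfolding k_def by (intro add_mono mult_left_mono) (auto intro: card_mono)
    finally show ?thesis .
  qed
  have laplacian_s: "- laplacian f s \<le> d * c + (1 - c)" if s: "s \<in> S" for s
  proof -
    have sV: "s \<in> V" using s S by auto
    have "- laplacian f s = (\<Sum>w\<in>N s. f w)"
      unfolding laplacian_def using s y by (auto simp: f_def sum_negf[symmetric] simp del: sum_negf)
    also have "\<dots> \<le> (\<Sum>w\<in>N s. c + (1 - c) * of_bool (w = y))"
      unfolding f_def using c by (intro sum_mono) auto
    also have "\<dots> = d * c + (1 - c) * of_bool (y \<in> N s)"
      using fN[OF sV] degree[OF sV] by (simp add: sum.distrib sum_distrib_left[symmetric] of_bool_def)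
    also have "\<dots> \<le> d * c + (1 - c)" using c by auto
    finally show ?thesis .
  qed
  \<comment> \<open>Subtracting the background value \<open>c\<close>, at no cost since the
    Laplacian sums to zero, confines the energy to \<open>insert y S\<close>.\<close>
  have "energy f f = energy f f - c * (\<Sum>v\<in>V. laplacian f v)" by (simp add: sum_laplacian)
  also have "\<dots> = (\<Sum>v\<in>V. (f v - c) * laplacian f v)"
    unfolding energy_def by (simp add: sum_distrib_left sum_subtractf[symmetric] left_diff_distrib)
  also have "\<dots> = (\<Sum>v\<in>insert y S. (f v - c) * laplacian f v)"
    using S y by (intro sum.mono_neutral_right) (auto simp: f_def)
  also have "\<dots> = (1 - c) * laplacian f y + (\<Sum>s\<in>S. (f s - c) * laplacian f s)"
    using fS y by (subst sum.insert) (auto simp: f_def)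
  also have "(\<Sum>s\<in>S. (f s - c) * laplacian f s) = (\<Sum>s\<in>S. c * - laplacian f s)"
    using y by (intro sum.cong) (auto simp: f_def)
  also have "(1 - c) * laplacian f y + (\<Sum>s\<in>S. c * - laplacian f s)
    \<le> (1 - c) * (d * (1 - c) + c * k) + (\<Sum>s\<in>S. c * (d * c + (1 - c)))"
    using c laplacian_y laplacian_s by (intro add_mono sum_mono mult_left_mono) auto
  also have "\<dots> = (1 - c) * (d * (1 - c) + c * k) + k * c * (d * c + (1 - c))"
    by (simp add: k_def)
  also have "\<dots> \<le> k * (d + k + 1) / (k + 1)"
  proof -
    have 1: "1 - c = k * c" "c * (k + 1) = 1" using k by (auto simp: c_def field_simps)
    have "(1 - c) * (d * (1 - c) + c * k) + k * c * (d * c + (1 - c))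
      = k * c * (d * (c * (k + 1)) + 2 * (k * c))" unfolding 1(1) by (simp add: algebra_simps)
    also have "\<dots> = k * c * (d + 2 * (k * c))" unfolding 1(2) by simp
    also have "\<dots> \<le> k * c * (d + (k + 1))"
    proof -
      have "k * c \<le> 1" using 1(1) c by auto
      then show ?thesis using k c by (intro mult_left_mono) auto
    qed
    also have "\<dots> = k * (d + k + 1) / (k + 1)" by (simp add: c_def add.assoc)
    finally show ?thesis .
  qed
  finally have "energy f f \<le> k * (d + k + 1) / (k + 1)" .
  moreover have "1 / eff_res y S \<le> energy f f"
    using y by (intro Dirichlet[OF S y]) (auto simp: f_def)
  ultimately have le: "1 / eff_res y S \<le> k * (d + k + 1) / (k + 1)" by linarith
  have pos: "k * (d + k + 1) / (k + 1) > 0" "real d + k + 1 > 0" using k by auto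
  have "eff_res y S > 0" by (rule eff_res_pos[OF S y])
  then have "1 / (k * (d + k + 1) / (k + 1)) \<le> eff_res y S"
    using le pos(1) by (simp only: pos_divide_le_eq mult.commute)
  moreover have "1 / (k * (d + k + 1) / (k + 1)) = (1 + 1 / k) / (d + k + 1)"
    using k pos(2) by (simp add: divide_simps)
  ultimately show ?thesis by (simp add: k_def add_ac)
qed

lemma R_lower:
  assumes "u \<in> V" "v \<in> V" "u \<noteq> v"
  shows "R u v \<ge> 2 / (d + 2)"
  using eff_res_lower[of "{v}" u] assms by (simp add: R_def add.commute)

text \<open>\<open>R_lower\<close> is applied to the pairs inside \<open>S\<close>, which enter the
  averaged flow with a negative sign. With \<open>a = 2 / (d + 2)\<close> this leaves
  \<open>a - (k - 1) * a / (2 * k) = (1 + 1 / k) * (a / 2)\<close>, in agreement with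
  \<open>eff_res_lower\<close> to leading order.\<close>

lemma eff_res_upper:
  assumes S: "S \<subseteq> V" "S \<noteq> {}" and y: "y \<in> V - S"
    and le: "\<And>s. s \<in> S \<Longrightarrow> R y s \<le> 2 / (d + 2) + e"
  shows "eff_res y S \<le> (1 + 1 / card S) / (d + 2) + e"
proof -
  define k where "k = real (card S)"
  have fS: "finite S" using S finite_subset finite_V by blast
  have k: "k \<ge> 1" using S fS unfolding k_def by (simp add: Suc_le_eq card_gt_0_iff)
  have "(\<Sum>s\<in>S. R y s) \<le> (\<Sum>s\<in>S. 2 / (d + 2) + e)" using le by (rule sum_mono)
  then have 1: "(\<Sum>s\<in>S. R y s) \<le> k * (2 / (d + 2) + e)" by (simp add: k_def)
  have "(\<Sum>s\<in>S. \<Sum>t\<in>S. R s t) \<ge> (\<Sum>s\<in>S. \<Sum>t\<in>S. 2 / (d + 2) - of_bool (s = t) * (2 / (d + 2)))"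
    using S R_lower by (intro sum_mono) (auto simp: subset_iff)
  also have "(\<Sum>s\<in>S. \<Sum>t\<in>S. 2 / (d + 2) - of_bool (s = t) * (2 / (d + 2))) = k * (k - 1) * (2 / (d + 2))"
  proof -
    have "(\<Sum>t\<in>S. 2 / (d + 2) - of_bool (s = t) * (2 / (d + 2))) = (k - 1) * (2 / (d + 2))" if "s \<in> S" for s
      using that fS by (simp add: sum_subtractf k_def of_bool_def left_diff_distrib diff_divide_distrib sum_divide_distrib[symmetric] sum.delta'
          flip: sum_distrib_right)
    then show ?thesis by (simp add: k_def)
  qed
  finally have 2: "k * (k - 1) * (2 / (d + 2)) \<le> (\<Sum>s\<in>S. \<Sum>t\<in>S. R s t)" .
  have "eff_res y S \<le> (\<Sum>s\<in>S. R y s) / k - (\<Sum>s\<in>S. \<Sum>t\<in>S. R s t) / (2 * k\<^sup>2)"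
    using eff_res_le_average[OF S y] by (simp add: k_def)
  also have "\<dots> \<le> k * (2 / (d + 2) + e) / k - k * (k - 1) * (2 / (d + 2)) / (2 * k\<^sup>2)"
    using 1 2 k by (intro diff_mono divide_right_mono) auto
  also have "\<dots> = (1 + 1 / k) / (d + 2) + e"
  proof -
    have eq: "k * (a + e) / k - k * (k - 1) * a / (2 * k\<^sup>2) = (1 + 1 / k) * (a / 2) + e" for a
      using k by (simp add: field_simps power2_eq_square)
    have half: "2 / x / 2 = 1 / x" for x :: real by simp
    show ?thesis unfolding eq half by simp
  qed
  finally show ?thesis by (simp add: k_def)
qed

end

section \<open>Averages over tree homomorphisms\<close>

text \<open>A rooted tree on \<open>{..<l}\<close> with root 0, numbered so that parents precede
  children; such a tree is built by adding one leaf at a time.\<close>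

definition tree_order :: "(nat \<Rightarrow> nat) \<Rightarrow> nat \<Rightarrow> bool" where
  "tree_order par l \<longleftrightarrow> (\<forall>i. 1 \<le> i \<and> i < l \<longrightarrow> par i < i)"

lemma tree_order_Suc: "l \<ge> 1 \<Longrightarrow> tree_order par (Suc l) \<longleftrightarrow> tree_order par l \<and> par l < l"
  unfolding tree_order_def by (auto simp: less_Suc_eq)

context fin_graph
begin

definition homs :: "(nat \<Rightarrow> nat) \<Rightarrow> nat \<Rightarrow> 'a list set" where
  "homs par l = {xs. length xs = l \<and> set xs \<subseteq> V \<and> (\<forall>i. 1 \<le> i \<and> i < l \<longrightarrow> xs ! i \<in> N (xs ! par i))}"

lemma finite_homs [simp]: "finite (homs par l)"
  by (rule finite_subset[OF _ finite_lists_length_eq[OF finite_V, of l]]) (auto simp: homs_def)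

lemma homs_nth: "xs \<in> homs par l \<Longrightarrow> i < l \<Longrightarrow> xs ! i \<in> V"
  by (auto simp: homs_def)

lemma homs_length: "xs \<in> homs par l \<Longrightarrow> length xs = l"
  by (auto simp: homs_def)

lemma homs_one: "homs par 1 = (\<lambda>x. [x]) ` V"
  by (auto simp: homs_def length_Suc_conv)

lemma homs_snoc:
  assumes "l \<ge> 1" "tree_order par (Suc l)"
  shows "xs @ [v] \<in> homs par (Suc l) \<longleftrightarrow> xs \<in> homs par l \<and> v \<in> N (xs ! par l)"
proof -
  have par: "par l < l" "\<And>i. 1 \<le> i \<Longrightarrow> i < l \<Longrightarrow> par i < l"
    using assms unfolding tree_order_def by (auto intro: less_trans)
  have "(\<forall>i. 1 \<le> i \<and> i < Suc l \<longrightarrow> (xs @ [v]) ! i \<in> N ((xs @ [v]) ! par i)) \<longleftrightarrow>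
    (\<forall>i. 1 \<le> i \<and> i < l \<longrightarrow> xs ! i \<in> N (xs ! par i)) \<and> v \<in> N (xs ! par l)" if "length xs = l"
    using that par assms(1) by (auto simp: less_Suc_eq nth_append)
  moreover have "v \<in> V" if "length xs = l" "set xs \<subseteq> V" "v \<in> N (xs ! par l)"
    using that par by (meson N_in_V nth_mem subsetD)
  ultimately show ?thesis by (auto simp: homs_def)
qed

lemma sum_homs_Suc:
  assumes "l \<ge> 1" "tree_order par (Suc l)"
  shows "(\<Sum>xs\<in>homs par (Suc l). f xs) = (\<Sum>xs\<in>homs par l. \<Sum>v\<in>N (xs ! par l). f (xs @ [v]))"
proof -
  have par: "par l < l" using assms by (simp add: tree_order_Suc)
  have "(\<Sum>xs\<in>homs par (Suc l). f xs)
    = (\<Sum>(xs, v)\<in>(SIGMA xs:homs par l. N (xs ! par l)). f (xs @ [v]))"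
  proof (rule sum.reindex_bij_witness[of _ "\<lambda>(xs, v). xs @ [v]" "\<lambda>xs. (butlast xs, last xs)"])
    fix xs assume xs: "xs \<in> homs par (Suc l)"
    then have "xs \<noteq> []" by (auto simp: homs_def)
    then show "(case (butlast xs, last xs) of (xs, v) \<Rightarrow> xs @ [v]) = xs"
      and "(case (butlast xs, last xs) of (xs, v) \<Rightarrow> f (xs @ [v])) = f xs" by auto
    have "butlast xs @ [last xs] \<in> homs par (Suc l)" using xs \<open>xs \<noteq> []\<close> by simp
    then show "(butlast xs, last xs) \<in> (SIGMA xs:homs par l. N (xs ! par l))"
      unfolding homs_snoc[OF assms] by simp
  qed (use homs_snoc[OF assms] in auto)
  also have "\<dots> = (\<Sum>xs\<in>homs par l. \<Sum>v\<in>N (xs ! par l). f (xs @ [v]))"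
    using homs_nth par by (subst sum.Sigma) auto
  finally show ?thesis .
qed

end

context reg_graph
begin

lemma sum_homs_prefix:
  fixes f :: "'a list \<Rightarrow> real"
  assumes "l \<ge> 1" "tree_order par (Suc l)"
    and "\<And>xs v. xs \<in> homs par l \<Longrightarrow> f (xs @ [v]) = g xs"
  shows "(\<Sum>xs\<in>homs par (Suc l). f xs) = real d * (\<Sum>xs\<in>homs par l. g xs)"
proof -
  have "par l < l" using assms by (simp add: tree_order_Suc)
  then show ?thesis
    unfolding sum_homs_Suc[OF assms(1,2)]
    using assms(3) homs_nth degree by (simp add: sum_distrib_left)
qed

lemma card_homs:
  assumes "l \<ge> 1" "tree_order par l"
  shows "real (card (homs par l)) = real (card V) * real d ^ (l - 1)"
  using assms
proof (induction l rule: nat_induct_at_least)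
  case base
  show ?case by (simp only: homs_one) (simp add: card_image inj_on_def)
next
  case (Suc l)
  have "real (card (homs par (Suc l))) = real d * (\<Sum>xs\<in>homs par l. 1)"
    using sum_homs_prefix[OF Suc.hyps Suc.prems, of "\<lambda>_. 1" "\<lambda>_. 1"] by simp
  also have "\<dots> = real (card V) * real d ^ (Suc l - 1)"
    using Suc by (cases l) (auto simp: tree_order_Suc)
  finally show ?case .
qed

text \<open>A step to a uniform neighbour preserves the uniform distribution in a regular graph, so
  each coordinate of a uniform homomorphism is uniform on \<open>V\<close>.\<close>

lemma sum_homs_single:
  assumes "l \<ge> 1" "tree_order par l" "a < l"
  shows "(\<Sum>xs\<in>homs par l. f (xs ! a)) = real d ^ (l - 1) * (\<Sum>v\<in>V. f v :: real)"
  using assms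
proof (induction l arbitrary: a f rule: nat_induct_at_least)
  case base
  then show ?case by (simp only: homs_one) (simp add: sum.reindex inj_on_def)
next
  case (Suc l)
  have t: "tree_order par l" "par l < l" using Suc by (auto simp: tree_order_Suc)
  have pow: "real d ^ (Suc l - 1) = real d * real d ^ (l - 1)" using Suc.hyps by (cases l) auto
  show ?case
  proof (cases "a = l")
    case True
    have "(\<Sum>xs\<in>homs par (Suc l). f (xs ! a)) = (\<Sum>xs\<in>homs par l. \<Sum>v\<in>N (xs ! par l). f v)"
      unfolding sum_homs_Suc[OF Suc.hyps Suc.prems(1)]
      using True by (intro sum.cong refl) (auto simp: homs_length nth_append)
    also have "\<dots> = real d ^ (l - 1) * (\<Sum>u\<in>V. \<Sum>v\<in>N u. f v)"
      using Suc.IH[OF t(1), of "par l" "\<lambda>u. \<Sum>v\<in>N u. f v"] t by simp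
    also have "(\<Sum>u\<in>V. \<Sum>v\<in>N u. f v) = (\<Sum>u\<in>V. \<Sum>v\<in>N u. f u)" by (rule arcs_swap)
    also have "\<dots> = real d * (\<Sum>v\<in>V. f v)" by (simp add: degree sum_distrib_left)
    finally show ?thesis unfolding pow by (simp only: ac_simps)
  next
    case False
    have "(\<Sum>xs\<in>homs par (Suc l). f (xs ! a)) = real d * (\<Sum>xs\<in>homs par l. f (xs ! a))"
      using False Suc.prems by (intro sum_homs_prefix[OF Suc.hyps Suc.prems(1)]) (auto simp: homs_length nth_append)
    then show ?thesis using Suc.IH[OF t(1), of a f] False Suc.prems pow by simp
  qed
qed

text \<open>When the later of the two vertices is placed, at most one of its \<open>d\<close>
  possible positions is the earlier vertex, which saves one factor \<open>d\<close>.\<close>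

lemma sum_homs_coincide:
  assumes "l \<ge> 1" "tree_order par l" "a < l" "b < l" "a \<noteq> b"
  shows "(\<Sum>xs\<in>homs par l. of_bool (xs ! a = xs ! b)) \<le> real (card V) * real d ^ (l - 2)"
  using assms
proof (induction l arbitrary: a b rule: nat_induct_at_least)
  case base
  then show ?case by simp
next
  case (Suc l)
  have t: "tree_order par l" "par l < l" using Suc by (auto simp: tree_order_Suc)
  have last: "(\<Sum>xs\<in>homs par (Suc l). of_bool (xs ! a = xs ! l)) \<le> real (card V) * real d ^ (Suc l - 2)"
    if a: "a < l" for a
  proof -
    have "(\<Sum>xs\<in>homs par (Suc l). of_bool (xs ! a = xs ! l) :: real)
      = (\<Sum>xs\<in>homs par l. \<Sum>v\<in>N (xs ! par l). of_bool (xs ! a = v))"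
      unfolding sum_homs_Suc[OF Suc.hyps Suc.prems(1)]
      using a by (intro sum.cong refl) (auto simp: homs_length nth_append)
    also have "\<dots> \<le> (\<Sum>xs\<in>homs par l. 1)"
    proof (rule sum_mono)
      fix xs assume "xs \<in> homs par l"
      then have "finite (N (xs ! par l))" using t homs_nth by auto
      then have "(\<Sum>v\<in>N (xs ! par l). of_bool (xs ! a = v) :: real) = of_bool (xs ! a \<in> N (xs ! par l))"
        by (simp add: of_bool_def sum.delta')
      then show "(\<Sum>v\<in>N (xs ! par l). of_bool (xs ! a = v) :: real) \<le> 1" by simp
    qed
    also have "\<dots> = real (card V) * real d ^ (Suc l - 2)"
      using card_homs[OF Suc.hyps t(1)] by (simp add: numeral_2_eq_2)
    finally show ?thesis .
  qed
  consider "a < l" "b < l" | "a < l" "b = l" | "a = l" "b < l" using Suc.prems by linarith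
  then show ?case
  proof cases
    case 1
    have "(\<Sum>xs\<in>homs par (Suc l). of_bool (xs ! a = xs ! b) :: real)
      = real d * (\<Sum>xs\<in>homs par l. of_bool (xs ! a = xs ! b))"
      using 1 Suc.prems by (intro sum_homs_prefix[OF Suc.hyps Suc.prems(1)]) (auto simp: homs_length nth_append)
    also have "\<dots> \<le> real d * (real (card V) * real d ^ (l - 2))"
      using Suc.IH[OF t(1) 1] Suc.prems by (intro mult_left_mono) auto
    also have "\<dots> = real (card V) * real d ^ (Suc l - 2)"
    proof -
      have "Suc l - 2 = Suc (l - 2)" using 1 Suc.prems by linarith
      then show ?thesis by simp
    qed
    finally show ?thesis .
  next
    case 2
    then show ?thesis using last[of a] by simp
  next
    case 3
    then show ?thesis using last[of b] by (simp add: eq_commute)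
  qed
qed

text \<open>
  Averaging the Green function over the neighbours of a vertex changes it only at the pole and at \<open>z\<close>,
  so the last vertex of the tree can be replaced by its parent; the error terms are coincidences.
\<close>

lemma sum_homs_green:
  assumes z: "z \<in> V" and "l \<ge> 1" "tree_order par l" "a < l" "b < l" "a \<noteq> b"
  shows "(\<Sum>xs\<in>homs par l. green z (xs ! a) (xs ! b))
    \<ge> real d ^ (l - 1) * (\<Sum>v\<in>V. green z v v) - real (card V) * real d ^ (l - 2) * (1 + real l / real d)"
  using assms(2-)
proof (induction l arbitrary: a b rule: nat_induct_at_least)
  case base
  then show ?case by simp
next
  case (Suc l)
  let ?A = "\<Sum>v\<in>V. green z v v" and ?n = "real (card V)"
  have d: "real d > 0" using d_pos by simp
  have t: "tree_order par l" "par l < l" using Suc by (auto simp: tree_order_Suc)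
  have pow: "real d ^ (Suc l - 1) = real d * real d ^ (l - 1)" "real d ^ (Suc l - 2) = real d ^ (l - 1)"
    using Suc.hyps by (cases l; simp add: numeral_2_eq_2)+
  have pow': "real d ^ (l - 1) = real d * real d ^ (l - 2)" if "l \<ge> 2"
  proof -
    have "l - 1 = Suc (l - 2)" using that by linarith
    then show ?thesis by simp
  qed
  have last: "(\<Sum>xs\<in>homs par (Suc l). green z (xs ! l) (xs ! a))
      \<ge> real d ^ (Suc l - 1) * ?A - ?n * real d ^ (Suc l - 2) * (1 + real (Suc l) / real d)"
    if a: "a < l" for a
  proof -
    let ?c = "par l"
    have "(\<Sum>xs\<in>homs par (Suc l). green z (xs ! l) (xs ! a))
      = (\<Sum>xs\<in>homs par l. \<Sum>v\<in>N (xs ! ?c). green z v (xs ! a))"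
      unfolding sum_homs_Suc[OF Suc.hyps Suc.prems(1)]
      using a by (intro sum.cong refl) (auto simp: homs_length nth_append)
    also have "\<dots> = (\<Sum>xs\<in>homs par l. real d * green z (xs ! ?c) (xs ! a)
        - of_bool (xs ! ?c = xs ! a) + of_bool (xs ! ?c = z))"
      using a t homs_nth z by (intro sum.cong refl) (simp add: sum_green degree)
    \<comment> \<open>Coincidences with the grounded vertex \<open>z\<close> have the favourable
      sign and are dropped.\<close>
    also have "\<dots> \<ge> (\<Sum>xs\<in>homs par l. real d * green z (xs ! ?c) (xs ! a) - of_bool (xs ! ?c = xs ! a))"
      by (intro sum_mono) auto
    also have "(\<Sum>xs\<in>homs par l. real d * green z (xs ! ?c) (xs ! a) - of_bool (xs ! ?c = xs ! a))
      = real d * (\<Sum>xs\<in>homs par l. green z (xs ! ?c) (xs ! a)) - (\<Sum>xs\<in>homs par l. of_bool (xs ! ?c = xs ! a))"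
      by (simp add: sum_subtractf sum_distrib_left)
    finally have 1: "(\<Sum>xs\<in>homs par (Suc l). green z (xs ! l) (xs ! a))
      \<ge> real d * (\<Sum>xs\<in>homs par l. green z (xs ! ?c) (xs ! a)) - (\<Sum>xs\<in>homs par l. of_bool (xs ! ?c = xs ! a))" .
    show ?thesis
    proof (cases "?c = a")
      case True
      \<comment> \<open>The diagonal is reached: the Green function depends on a single uniform
        vertex, and the coincidence sum is the full count \<open>?n * d ^ (l - 1)\<close>, the main
        error.\<close>
      have 2: "(\<Sum>xs\<in>homs par l. green z (xs ! ?c) (xs ! a)) = real d ^ (l - 1) * ?A"
        using sum_homs_single[OF Suc.hyps t(1) a, of "\<lambda>u. green z u u"] True by simp
      have 3: "(\<Sum>xs\<in>homs par l. of_bool (xs ! ?c = xs ! a)) = ?n * real d ^ (l - 1)"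
        using card_homs[OF Suc.hyps t(1)] True by simp
      have "?n * real d ^ (l - 1) \<le> ?n * real d ^ (l - 1) * (1 + real (Suc l) / real d)"
        using d by (simp add: field_simps)
      then show ?thesis using 1 unfolding 2 3 pow by (simp only: mult.assoc)
    next
      case False
      have l2: "l \<ge> 2" using False a t by linarith
      have 2: "(\<Sum>xs\<in>homs par l. green z (xs ! ?c) (xs ! a))
        \<ge> real d ^ (l - 1) * ?A - ?n * real d ^ (l - 2) * (1 + real l / real d)"
        using Suc.IH[OF t(1) t(2) a False] .
      have 3: "(\<Sum>xs\<in>homs par l. of_bool (xs ! ?c = xs ! a)) \<le> ?n * real d ^ (l - 2)"
        using sum_homs_coincide[OF Suc.hyps t(1) t(2) a False] .
      \<comment> \<open>Replacing the vertex by its parent costs one more coincidence sum, a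
        proportion \<open>1 / d\<close> of the main error; this turns \<open>l\<close> into
        \<open>Suc l\<close> in the bound.\<close>
      have "real d * (real d ^ (l - 1) * ?A - ?n * real d ^ (l - 2) * (1 + real l / real d)) - ?n * real d ^ (l - 2)
        \<le> (\<Sum>xs\<in>homs par (Suc l). green z (xs ! l) (xs ! a))"
        using 1 3 mult_left_mono[OF 2, of "real d"] d by linarith
      moreover have "real d * (real d ^ (l - 1) * ?A - ?n * real d ^ (l - 2) * (1 + real l / real d)) - ?n * real d ^ (l - 2)
        = real d ^ (Suc l - 1) * ?A - ?n * real d ^ (Suc l - 2) * (1 + real (Suc l) / real d)"
        unfolding pow pow'[OF l2] using d by (simp add: field_simps)
      ultimately show ?thesis by simp
    qed
  qed
  consider "a < l" "b < l" | "a < l" "b = l" | "a = l" "b < l" using Suc.prems by linarith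
  then show ?case
  proof cases
    case 1
    have l2: "l \<ge> 2" using 1 Suc.prems by linarith
    have "(\<Sum>xs\<in>homs par (Suc l). green z (xs ! a) (xs ! b))
      = real d * (\<Sum>xs\<in>homs par l. green z (xs ! a) (xs ! b))"
      using 1 Suc.prems by (intro sum_homs_prefix[OF Suc.hyps Suc.prems(1)]) (auto simp: homs_length nth_append)
    also have "\<dots> \<ge> real d * (real d ^ (l - 1) * ?A - ?n * real d ^ (l - 2) * (1 + real l / real d))"
      using Suc.IH[OF t(1) 1] Suc.prems by (intro mult_left_mono) auto
    also have "real d * (real d ^ (l - 1) * ?A - ?n * real d ^ (l - 2) * (1 + real l / real d))
      = real d ^ (Suc l - 1) * ?A - ?n * real d ^ (Suc l - 2) * (1 + real l / real d)"
      unfolding pow pow'[OF l2] by (simp add: algebra_simps)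
    also have "\<dots> \<ge> real d ^ (Suc l - 1) * ?A - ?n * real d ^ (Suc l - 2) * (1 + real (Suc l) / real d)"
      using d by (intro diff_mono mult_left_mono) (auto simp: field_simps)
    finally show ?thesis .
  next
    case 2
    have "(\<Sum>xs\<in>homs par (Suc l). green z (xs ! l) (xs ! a)) = (\<Sum>xs\<in>homs par (Suc l). green z (xs ! a) (xs ! b))"
      using 2 Suc.prems z homs_nth green_commute by (intro sum.cong refl) auto
    then show ?thesis using last[of a] 2 by simp
  next
    case 3
    then show ?thesis using last[of b] by simp
  qed
qed

text \<open>In the polarisation \<open>R_green\<close> the two diagonal sums cancel the leading part
  of the mixed sum, so the unknown sum of the \<open>green z v v\<close> disappears together with
  the choice of \<open>z\<close>. For a single edge this is, up to a factor
  \<open>1 + O(1 / d)\<close>, Foster's bound on the total resistance of the edges.\<close>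

lemma sum_homs_R:
  assumes "l \<ge> 1" "tree_order par l" "a < l" "b < l" "a \<noteq> b"
  shows "(\<Sum>xs\<in>homs par l. R (xs ! a) (xs ! b)) \<le> 2 * real (card V) * real d ^ (l - 2) * (1 + real l / real d)"
proof -
  obtain z where z: "z \<in> V" using V_nonempty by auto
  have "(\<Sum>xs\<in>homs par l. R (xs ! a) (xs ! b))
    = (\<Sum>xs\<in>homs par l. green z (xs ! a) (xs ! a)) + (\<Sum>xs\<in>homs par l. green z (xs ! b) (xs ! b))
      - 2 * (\<Sum>xs\<in>homs par l. green z (xs ! a) (xs ! b))"
    using assms homs_nth z R_green[OF z]
    by (simp add: sum.distrib[symmetric] sum_subtractf[symmetric] sum_distrib_left)
  also have "\<dots> = 2 * (real d ^ (l - 1) * (\<Sum>v\<in>V. green z v v)) - 2 * (\<Sum>xs\<in>homs par l. green z (xs ! a) (xs ! b))"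
    using sum_homs_single[OF assms(1-3), of "\<lambda>u. green z u u"]
      sum_homs_single[OF assms(1,2,4), of "\<lambda>u. green z u u"] by simp
  also have "\<dots> \<le> 2 * real (card V) * real d ^ (l - 2) * (1 + real l / real d)"
    using sum_homs_green[OF z assms] by linarith
  finally show ?thesis .
qed

text \<open>The value 0 on the diagonal keeps the excess nonnegative; coincidences are penalised
  separately.\<close>

definition excess :: "'a \<Rightarrow> 'a \<Rightarrow> real" where
  "excess u v = (if u = v then 0 else R u v - 2 / (d + 2))"

lemma excess_nonneg: "u \<in> V \<Longrightarrow> v \<in> V \<Longrightarrow> excess u v \<ge> 0"
  using R_lower by (auto simp: excess_def)

text \<open>In the difference between the mean resistance and its pointwise minimum
  \<open>2 / (d + 2)\<close> the terms of order \<open>1 / d\<close> cancel. The summand 6 bounds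
  \<open>3 * a' * d\<close>: two copies of \<open>a'\<close> come from
  \<open>a' * d = 2 - 2 * a'\<close>, the third from the coincidences.\<close>

lemma sum_homs_excess:
  assumes "l \<ge> 1" "tree_order par l" "a < l" "b < l" "a \<noteq> b"
  shows "(\<Sum>xs\<in>homs par l. excess (xs ! a) (xs ! b)) \<le> real (card V) * real d ^ (l - 2) * (2 * l + 6) / real d"
proof -
  let ?n = "real (card V)" and ?D = "real d ^ (l - 2)"
  have d: "real d > 0" using d_pos by simp
  have pow: "real d ^ (l - 1) = real d * ?D"
  proof -
    have "l - 1 = Suc (l - 2)" using assms by linarith
    then show ?thesis by simp
  qed
  define a' where "a' = 2 / real (d + 2)"
  have a': "a' * real d = 2 - 2 * a'" "a' \<ge> 0" by (simp_all add: a'_def field_simps)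
  have "(\<Sum>xs\<in>homs par l. excess (xs ! a) (xs ! b))
    = (\<Sum>xs\<in>homs par l. R (xs ! a) (xs ! b) - a' + a' * of_bool (xs ! a = xs ! b))"
    by (intro sum.cong) (auto simp: excess_def a'_def)
  also have "\<dots> = (\<Sum>xs\<in>homs par l. R (xs ! a) (xs ! b)) - a' * card (homs par l)
     + a' * (\<Sum>xs\<in>homs par l. of_bool (xs ! a = xs ! b))"
    by (simp only: sum.distrib sum_subtractf sum_constant sum_distrib_left[symmetric] mult.commute)
  also have "\<dots> \<le> 2 * ?n * ?D * (1 + real l / real d) - a' * (?n * (real d * ?D)) + a' * (?n * ?D)"
    using sum_homs_R[OF assms] sum_homs_coincide[OF assms] card_homs[OF assms(1,2)] pow a'
    by (intro add_mono diff_mono mult_left_mono) auto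
  also have "\<dots> = ?n * ?D * (2 + 2 * (real l / real d) - a' * real d + a')"
    by (simp add: algebra_simps)
  also have "\<dots> = ?n * ?D * (2 * (real l / real d) + 3 * a')" unfolding a' by simp
  also have "\<dots> \<le> ?n * ?D * (2 * (real l / real d) + 6 / real d)"
    using d by (intro mult_left_mono add_mono) (auto simp: a'_def field_simps)
  also have "2 * (real l / real d) + 6 / real d = (2 * real l + 6) / real d"
    by (simp add: add_divide_distrib)
  finally show ?thesis by simp
qed

section \<open>Typical copies\<close>

definition tol :: real where "tol = 1 / sqrt d"

lemma tol: "0 < tol" "tol \<le> 1" "real d * tol * tol = 1"
  using d_pos by (auto simp: tol_def)

lemma inverse_degree_le: "1 / real d \<le> tol"
proof -
  have "1 / real d = tol * tol" using tol d_pos by (simp add: field_simps)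
  also have "\<dots> \<le> tol" using tol by (simp add: mult_left_le)
  finally show ?thesis .
qed

text \<open>The threshold has order \<open>d powr (- 3 / 2)\<close>, between the mean excess of
  order \<open>1 / d ^ 2\<close> and the resistances of order \<open>1 / d\<close>: most copies
  satisfy it, and it still determines all resistances to leading order.\<close>

definition good :: "'a list \<Rightarrow> bool" where
  "good xs \<longleftrightarrow> distinct xs \<and> (\<forall>a<length xs. \<forall>b<length xs. excess (xs ! a) (xs ! b) \<le> tol / real d)"

text \<open>Union bound over the ordered pairs of indices, and Markov's inequality. A coincidence
  has proportion at most \<open>1 / d\<close>, an excess above the threshold at most
  \<open>(2 * l + 6) / (d * tol)\<close>, and \<open>1 / (d * tol) = tol\<close>; the coincidences
  raise 6 to 7.\<close>

lemma sum_not_good: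
  assumes "l \<ge> 1" "tree_order par l"
  shows "(\<Sum>xs\<in>homs par l. of_bool (\<not> good xs)) \<le> l\<^sup>2 * (2 * l + 7) * (real (card V) * real d ^ (l - 1)) * tol"
proof -
  let ?I = "{..<l} \<times> {..<l} - Id" and ?n = "real (card V)"
  have d: "real d > 0" using d_pos by simp
  have "(\<Sum>xs\<in>homs par l. of_bool (\<not> good xs))
    \<le> (\<Sum>xs\<in>homs par l. \<Sum>(a, b)\<in>?I. of_bool (xs ! a = xs ! b) + real d / tol * excess (xs ! a) (xs ! b))"
  proof (rule sum_mono)
    fix xs assume xs: "xs \<in> homs par l"
    let ?t = "\<lambda>p. of_bool (xs ! fst p = xs ! snd p) + real d / tol * excess (xs ! fst p) (xs ! snd p)"
    have nn: "?t p \<ge> 0" if "p \<in> ?I" for p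
      using that xs homs_nth excess_nonneg tol d by (intro add_nonneg_nonneg mult_nonneg_nonneg) auto
    show "of_bool (\<not> good xs) \<le> (\<Sum>(a, b)\<in>?I. of_bool (xs ! a = xs ! b) + real d / tol * excess (xs ! a) (xs ! b))"
    proof (cases "good xs")
      case True
      then show ?thesis using nn by (auto intro!: sum_nonneg simp: split_def)
    next
      case False
      have len: "length xs = l" using xs by (rule homs_length)
      obtain p where p: "p \<in> ?I" "?t p \<ge> 1"
      proof (cases "distinct xs")
        case False
        then obtain a b where ab: "a < l" "b < l" "a \<noteq> b" "xs ! a = xs ! b"
          using len by (auto simp: distinct_conv_nth)
        then show ?thesis using excess_nonneg[of "xs ! a" "xs ! b"] homs_nth[OF xs] tol d
          by (intro that[of "(a, b)"]) auto
      next
        case True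
        then obtain a b where ab: "a < l" "b < l" "excess (xs ! a) (xs ! b) > tol / real d"
          using len \<open>\<not> good xs\<close> by (auto simp: good_def not_le)
        moreover have "a \<noteq> b"
        proof
          assume "a = b"
          then have "tol / real d < 0" using ab(3) by (simp add: excess_def)
          moreover have "tol / real d > 0" using tol d by simp
          ultimately show False by simp
        qed
        moreover have "1 \<le> real d / tol * excess (xs ! a) (xs ! b)"
          using ab(3) tol d by (simp add: field_simps)
        ultimately show ?thesis by (intro that[of "(a, b)"]) auto
      qed
      have "1 \<le> (\<Sum>p\<in>?I. ?t p)"
        using p nn member_le_sum[of p ?I ?t] by force
      then show ?thesis using False by (simp add: split_def)
    qed
  qed
  also have "\<dots> = (\<Sum>(a, b)\<in>?I. (\<Sum>xs\<in>homs par l. of_bool (xs ! a = xs ! b))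
      + real d / tol * (\<Sum>xs\<in>homs par l. excess (xs ! a) (xs ! b)))"
    unfolding split_def by (subst sum.swap) (simp add: sum.distrib sum_distrib_left)
  also have "\<dots> \<le> (\<Sum>(a, b)\<in>?I. (2 * l + 7) * (?n * real d ^ (l - 1)) * tol)"
  proof (rule sum_mono)
    fix p assume "p \<in> ?I"
    then obtain a b where p: "p = (a, b)" and ab: "a < l" "b < l" "a \<noteq> b" by auto
    have pow: "real d ^ (l - 1) = real d * real d ^ (l - 2)"
    proof -
      have "l - 1 = Suc (l - 2)" using ab by linarith
      then show ?thesis by simp
    qed
    have "(\<Sum>xs\<in>homs par l. of_bool (xs ! a = xs ! b)) + real d / tol * (\<Sum>xs\<in>homs par l. excess (xs ! a) (xs ! b))
      \<le> ?n * real d ^ (l - 2) + real d / tol * (?n * real d ^ (l - 2) * (2 * l + 6) / real d)"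
      using sum_homs_coincide[OF assms ab] sum_homs_excess[OF assms ab] tol d
      by (intro add_mono mult_left_mono) auto
    also have "\<dots> = ?n * real d ^ (l - 2) * (1 + (2 * l + 6) / tol)"
      using d tol by (simp add: field_simps)
    also have "\<dots> \<le> ?n * real d ^ (l - 2) * ((2 * l + 7) / tol)"
      using tol by (intro mult_left_mono) (auto simp: field_simps)
    also have "\<dots> = (2 * l + 7) * (?n * real d ^ (l - 1)) * tol"
    proof -
      have inv: "x / tol = x * (real d * tol)" for x using tol by (simp add: field_simps)
      show ?thesis unfolding pow inv by (simp add: algebra_simps)
    qed
    finally show "(case p of (a, b) \<Rightarrow> (\<Sum>xs\<in>homs par l. of_bool (xs ! a = xs ! b))
        + real d / tol * (\<Sum>xs\<in>homs par l. excess (xs ! a) (xs ! b)))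
      \<le> (case p of (a, b) \<Rightarrow> (2 * l + 7) * (?n * real d ^ (l - 1)) * tol)"
      unfolding p by simp
  qed
  also have "\<dots> = card ?I * ((2 * l + 7) * (?n * real d ^ (l - 1)) * tol)" by (simp add: split_def)
  also have "\<dots> \<le> l\<^sup>2 * ((2 * l + 7) * (?n * real d ^ (l - 1)) * tol)"
  proof -
    have "card ?I \<le> card ({..<l} \<times> {..<l})" by (rule card_mono) auto
    then have "real (card ?I) \<le> l\<^sup>2" unfolding power2_eq_square by (simp flip: of_nat_mult)
    then show ?thesis using tol by (intro mult_right_mono) auto
  qed
  finally show ?thesis by (simp add: mult.assoc)
qed

end

section \<open>Forest counts along typical embeddings\<close>

text \<open>These constants depend on the tree only, which makes the error bounds uniform in the graph.\<close>

definition not_good_bound :: "nat \<Rightarrow> real" where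
  "not_good_bound l = real (l\<^sup>2 * (2 * l + 7))"

definition mean_error :: "nat \<Rightarrow> real" where
  "mean_error l = l * (not_good_bound l + l\<^sup>2 + 3 ^ l) + 3 ^ l * not_good_bound l"

text \<open>The two summands belong to the two parts \<open>2 / d\<close> and \<open>excess\<close>
  of the resistance of the last vertex, with \<open>2 * l + 8 = 2 * Suc l + 6\<close>; the power of
  3 bounds the weight of the prefix.\<close>

definition bad_step_bound :: "nat \<Rightarrow> real" where
  "bad_step_bound l = 3 ^ l * (2 * not_good_bound (Suc l) + (2 * l + 8))"

lemma one_plus_power_le:
  fixes x :: real
  assumes "0 \<le> x" "x \<le> 1"
  shows "(1 + x) ^ m \<le> 1 + 3 ^ m * x"
proof (induction m)
  case (Suc m)
  have "x * x \<le> x" using assms by (simp add: mult_left_le)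
  then have "3 ^ m * (x * x) \<le> 3 ^ m * x" by (intro mult_left_mono) auto
  have "(1 + x) ^ Suc m \<le> (1 + 3 ^ m * x) * (1 + x)"
    using Suc assms by (simp add: mult.commute mult_left_mono)
  also have "\<dots> = 1 + x + 3 ^ m * x + 3 ^ m * (x * x)" by (simp add: algebra_simps)
  also have "\<dots> \<le> 1 + x + 3 ^ m * x + 3 ^ m * x"
    using \<open>3 ^ m * (x * x) \<le> 3 ^ m * x\<close> by simp
  also have "\<dots> \<le> 1 + 3 ^ Suc m * x"
  proof -
    have "1 * x \<le> 3 ^ m * x" using assms by (intro mult_right_mono) auto
    then show ?thesis by (simp add: algebra_simps)
  qed
  finally show ?case .
qed (use assms in simp)

lemma Suc_ratio: "c * real (Suc m) * (1 + 1 / real (Suc m)) = c * real (Suc (Suc m))"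
  by (simp add: field_simps)

lemma bad_step_algebra:
  fixes d :: real
  assumes "p \<noteq> 0" "d \<noteq> 0"
  shows "num_trees * (t / p) * (2 / d * (A * (n * (d * p)) * tol) + n * p * B * tol)
    = t * (2 * A + B) * (num_trees * n) * tol"
proof -
  have "2 / d * (A * (n * (d * p)) * tol) + n * p * B * tol = p * ((2 * A + B) * n * tol)" using assms(2)
    by (simp add: distrib_left distrib_right mult_ac)
  then have "num_trees * (t / p) * (2 / d * (A * (n * (d * p)) * tol) + n * p * B * tol) = num_trees * (t / p) * (p * ((2 * A + B) * n * tol))" by (simp only:)
  also have "\<dots> = num_trees * t * ((2 * A + B) * n * tol)" using assms by simp
  finally show ?thesis by (simp only: mult_ac)
qed

context reg_graph
begin

text \<open>The root is picked arbitrarily, the number being the same for every vertex by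
  \<open>num_forests_singleton_eq\<close>.\<close>

definition num_trees :: real where "num_trees = real (num_forests {SOME x. x \<in> V})"

lemma num_forests_singleton: "x \<in> V \<Longrightarrow> real (num_forests {x}) = num_trees"
  using num_forests_singleton_eq[of x "SOME x. x \<in> V"] someI[of "\<lambda>x. x \<in> V" x] by (simp add: num_trees_def)

lemma num_trees_pos: "num_trees > 0"
proof -
  obtain x where "x \<in> V" using V_nonempty by auto
  then show ?thesis using num_forests_singleton[of x] num_forests_pos[of "{x}"] by simp
qed

lemma num_forests_insert: "S \<subseteq> V \<Longrightarrow> S \<noteq> {} \<Longrightarrow> real (num_forests (insert y S)) = num_forests S * eff_res y S"
  using num_forests_pos[of S] by (simp add: eff_res_def)

text \<open>The vertices are added one at a time. The factors \<open>1 + 1 / i\<close> of the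
  successive resistances telescope to \<open>length xs\<close>, which is the origin of the factor
  \<open>l\<close> in the containment probability.\<close>

lemma num_forests_lower:
  assumes "xs \<noteq> []" "distinct xs" "set xs \<subseteq> V"
  shows "real (num_forests (set xs)) \<ge> num_trees * length xs / real (d + length xs) ^ (length xs - 1)"
  using assms
proof (induction xs rule: rev_nonempty_induct)
  case (single x)
  then show ?case using num_forests_singleton by simp
next
  case (snoc y xs)
  let ?l = "length xs"
  have l: "?l \<ge> 1" using snoc by (cases xs) auto
  have S: "set xs \<subseteq> V" "set xs \<noteq> {}" "y \<in> V - set xs" using snoc by auto
  have cS: "card (set xs) = ?l" using snoc by (simp add: distinct_card)
  have pos: "0 < real (d + ?l)" "real (d + ?l) \<le> real (d + ?l + 1)" using l by auto
  have "num_trees * length (xs @ [y]) / real (d + length (xs @ [y])) ^ (length (xs @ [y]) - 1)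
    = (num_trees * ?l) * ((1 + 1 / ?l) / (d + ?l + 1)) / real (d + ?l + 1) ^ (?l - 1)"
  proof -
    obtain m where m: "?l = Suc m" using l by (cases ?l) auto
    have "num_trees * real (Suc m) * ((1 + 1 / real (Suc m)) / X) / Y = num_trees * real (Suc (Suc m)) / (X * Y)" for X Y
      by (simp only: times_divide_eq_right Suc_ratio divide_divide_eq_left)
    note eq = this
    show ?thesis unfolding length_append m eq by simp
  qed
  also have "\<dots> \<le> (num_trees * ?l) * ((1 + 1 / ?l) / (d + ?l + 1)) / real (d + ?l) ^ (?l - 1)"
    using pos num_trees_pos l by (intro divide_left_mono power_mono mult_pos_pos mult_nonneg_nonneg) auto
  also have "\<dots> = (num_trees * ?l / real (d + ?l) ^ (?l - 1)) * ((1 + 1 / ?l) / (d + ?l + 1))" by simp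
  also have "\<dots> \<le> real (num_forests (set xs)) * eff_res y (set xs)"
    using snoc eff_res_lower[OF S] cS num_trees_pos by (intro mult_mono) auto
  also have "\<dots> = real (num_forests (set (xs @ [y])))" using num_forests_insert[OF S(1,2)] by simp
  finally show ?case .
qed

lemma good_snoc:
  assumes "good (xs @ [y])"
  shows "good xs"
  unfolding good_def
proof (intro conjI allI impI)
  show "distinct xs" using assms by (simp add: good_def)
  fix a b assume ab: "a < length xs" "b < length xs"
  then have "excess ((xs @ [y]) ! a) ((xs @ [y]) ! b) \<le> tol / d"
    using assms by (simp add: good_def)
  then show "excess (xs ! a) (xs ! b) \<le> tol / d" using ab by (simp add: nth_append)
qed

lemma good_R_le:
  assumes "good xs" "set xs \<subseteq> V" "a < length xs" "b < length xs"
  shows "R (xs ! a) (xs ! b) \<le> 2 / (d + 2) + tol / d"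
proof (cases "xs ! a = xs ! b")
  case True
  then show ?thesis using tol by simp
next
  case False
  have "excess (xs ! a) (xs ! b) \<le> tol / d" using assms by (simp add: good_def)
  then show ?thesis using False by (simp add: excess_def)
qed

text \<open>The same telescoping product, now with \<open>eff_res_upper\<close>; each added vertex
  costs a further factor of at most \<open>1 + tol\<close>.\<close>

lemma num_forests_upper_good:
  assumes "xs \<noteq> []" "good xs" "set xs \<subseteq> V"
  shows "real (num_forests (set xs)) \<le> num_trees * length xs * ((1 + tol) / d) ^ (length xs - 1)"
  using assms
proof (induction xs rule: rev_nonempty_induct)
  case (single x)
  then show ?case using num_forests_singleton by simp
next
  case (snoc y xs)
  let ?l = "length xs"
  have d: "real d > 0" using d_pos by simp
  have l: "?l \<ge> 1" using snoc by (cases xs) auto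
  have g: "good xs" using snoc good_snoc by blast
  have dist: "distinct (xs @ [y])" using snoc by (simp add: good_def)
  have S: "set xs \<subseteq> V" "set xs \<noteq> {}" "y \<in> V - set xs" using snoc dist by auto
  have cS: "card (set xs) = ?l" using dist by (simp add: distinct_card)
  have "R y s \<le> 2 / (d + 2) + tol / d" if "s \<in> set xs" for s
  proof -
    obtain a where "a < ?l" "xs ! a = s" using \<open>s \<in> set xs\<close> by (auto simp: in_set_conv_nth)
    then show ?thesis using good_R_le[OF snoc.prems(1,2), of ?l a] by (simp add: nth_append)
  qed
  then have "eff_res y (set xs) \<le> (1 + 1 / ?l) / (d + 2) + tol / d"
    using eff_res_upper[OF S, of "tol / d"] cS by simp
  also have "\<dots> \<le> (1 + 1 / ?l) / d + (1 + 1 / ?l) * (tol / d)"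
  proof (intro add_mono)
    show "(1 + 1 / real ?l) / real (d + 2) \<le> (1 + 1 / real ?l) / real d"
      using d by (intro divide_left_mono) auto
    have "1 * (tol / real d) \<le> (1 + 1 / real ?l) * (tol / real d)"
      using tol d by (intro mult_right_mono) auto
    then show "tol / real d \<le> (1 + 1 / real ?l) * (tol / real d)" by simp
  qed
  also have "\<dots> = (1 + 1 / ?l) * ((1 + tol) / d)" by (simp add: add_divide_distrib algebra_simps)
  finally have eff_res: "eff_res y (set xs) \<le> (1 + 1 / ?l) * ((1 + tol) / d)" .
  have "real (num_forests (set (xs @ [y]))) = real (num_forests (set xs)) * eff_res y (set xs)"
    using num_forests_insert[OF S(1,2)] by simp
  also have "\<dots> \<le> (num_trees * ?l * ((1 + tol) / d) ^ (?l - 1)) * ((1 + 1 / ?l) * ((1 + tol) / d))"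
    using snoc.IH[OF g S(1)] eff_res eff_res_pos[OF S] num_trees_pos tol d by (intro mult_mono) auto
  also have "\<dots> = num_trees * length (xs @ [y]) * ((1 + tol) / d) ^ (length (xs @ [y]) - 1)"
  proof -
    obtain m where m: "?l = Suc m" using l by (cases ?l) auto
    have "num_trees * real (Suc m) * x * ((1 + 1 / real (Suc m)) * y)
      = num_trees * real (Suc m) * (1 + 1 / real (Suc m)) * (y * x)" for x y
      by (simp only: ac_simps)
    note eq = this[unfolded Suc_ratio]
    show ?thesis unfolding length_append m eq by simp
  qed
  finally show ?case .
qed

text \<open>Only resistances along tree edges are restricted, so the condition allows several new
  leaves at a typical copy that are not typical relative to each other. It still bounds the forest
  count up to a constant factor.\<close>

definition edge_good :: "(nat \<Rightarrow> nat) \<Rightarrow> 'a list \<Rightarrow> bool" where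
  "edge_good par xs \<longleftrightarrow> distinct xs \<and> (\<forall>i. 1 \<le> i \<and> i < length xs \<longrightarrow> R (xs ! i) (xs ! par i) \<le> 3 / d)"

lemma good_R_le_3:
  assumes "good xs" "set xs \<subseteq> V" "a < length xs" "b < length xs"
  shows "R (xs ! a) (xs ! b) \<le> 3 / d"
proof -
  have d: "real d > 0" using d_pos by simp
  have "R (xs ! a) (xs ! b) \<le> 2 / (d + 2) + tol / d" by (rule good_R_le[OF assms])
  also have "\<dots> \<le> 2 / d + 1 / d"
    using d tol by (intro add_mono divide_left_mono divide_right_mono) auto
  finally show ?thesis by (simp flip: add_divide_distrib)
qed

lemma good_edge_good:
  assumes "good xs" "set xs \<subseteq> V" "tree_order par (length xs)"
  shows "edge_good par xs"
  unfolding edge_good_def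
proof (intro conjI allI impI)
  show "distinct xs" using assms(1) by (simp add: good_def)
  fix i assume i: "1 \<le> i \<and> i < length xs"
  then have "par i < length xs" using assms(3) by (auto simp: tree_order_def intro: less_trans)
  then show "R (xs ! i) (xs ! par i) \<le> 3 / d" using i by (intro good_R_le_3[OF assms(1,2)]) auto
qed

text \<open>By monotonicity the resistance between a new vertex and the whole set is at most that
  between the vertex and its parent.\<close>

lemma num_forests_upper_edge_good:
  assumes "xs \<noteq> []" "edge_good par xs" "set xs \<subseteq> V" "tree_order par (length xs)"
  shows "real (num_forests (set xs)) \<le> num_trees * (3 / d) ^ (length xs - 1)"
  using assms
proof (induction xs rule: rev_nonempty_induct)
  case (single x)
  then show ?case using num_forests_singleton by simp
next
  case (snoc y xs)
  let ?l = "length xs"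
  have d: "real d > 0" using d_pos by simp
  have l: "?l \<ge> 1" using snoc by (cases xs) auto
  have t: "tree_order par ?l" "par ?l < ?l" using snoc l by (auto simp: tree_order_Suc)
  have e: "edge_good par xs"
    unfolding edge_good_def
  proof (intro conjI allI impI)
    show "distinct xs" using snoc(3) by (simp add: edge_good_def)
    fix i assume i: "1 \<le> i \<and> i < ?l"
    then have "par i < ?l" using t(1) by (auto simp: tree_order_def intro: less_trans)
    moreover have "R ((xs @ [y]) ! i) ((xs @ [y]) ! par i) \<le> 3 / d"
      using snoc(3) i by (simp add: edge_good_def)
    ultimately show "R (xs ! i) (xs ! par i) \<le> 3 / d" using i by (simp add: nth_append)
  qed
  have dist: "distinct (xs @ [y])" using snoc by (simp add: edge_good_def)
  have S: "set xs \<subseteq> V" "set xs \<noteq> {}" "y \<in> V - set xs" using snoc dist by auto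
  have "eff_res y (set xs) \<le> R y (xs ! par ?l)"
    using t S by (intro eff_res_le_R) auto
  also have "\<dots> \<le> 3 / d"
  proof -
    have "\<forall>i. 1 \<le> i \<and> i < length (xs @ [y]) \<longrightarrow> R ((xs @ [y]) ! i) ((xs @ [y]) ! par i) \<le> 3 / d"
      using snoc(3) unfolding edge_good_def by (rule conjunct2)
    from this[rule_format, of ?l] have "R ((xs @ [y]) ! ?l) ((xs @ [y]) ! par ?l) \<le> 3 / d"
      using l by simp
    then show ?thesis using t by (simp add: nth_append)
  qed
  finally have eff_res: "eff_res y (set xs) \<le> 3 / d" .
  have "real (num_forests (set (xs @ [y]))) = real (num_forests (set xs)) * eff_res y (set xs)"
    using num_forests_insert[OF S(1,2)] by simp
  also have "\<dots> \<le> (num_trees * (3 / d) ^ (?l - 1)) * (3 / d)"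
    using snoc.IH[OF e S(1) t(1)] eff_res eff_res_pos[OF S] num_trees_pos d by (intro mult_mono) auto
  also have "\<dots> = num_trees * (3 / d) ^ (length (xs @ [y]) - 1)"
    using l by (cases ?l) auto
  finally show ?case .
qed

text \<open>The typical copies contribute \<open>l\<close> up to a multiple of \<open>tol\<close>.
  The other members of \<open>Q\<close> form at most a proportion
  \<open>not_good_bound l * tol\<close> of all homomorphisms, and \<open>edge_good\<close> bounds
  the weight of each by a constant multiple of the typical one. \<open>Q\<close> is left open
  between these conditions because the factorial moments need an intermediate set.\<close>

lemma mean_count:
  assumes l: "l \<ge> 1" and t: "tree_order par l" and Q: "Q \<subseteq> homs par l"
    and goodQ: "\<And>xs. xs \<in> homs par l \<Longrightarrow> good xs \<Longrightarrow> xs \<in> Q"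
    and Qedge: "\<And>xs. xs \<in> Q \<Longrightarrow> edge_good par xs"
  shows "\<bar>(\<Sum>xs\<in>Q. real (num_forests (set xs))) / (num_trees * card V) - l\<bar> \<le> mean_error l * tol"
proof -
  let ?n = "real (card V)" and ?G = "{xs \<in> homs par l. good xs}"
  let ?B = "?n * real d ^ (l - 1)" and ?e = "not_good_bound l * tol"
  let ?X = "\<Sum>xs\<in>Q. real (num_forests (set xs))"
  have d: "real d > 0" using d_pos by simp
  have n: "?n > 0" using V_nonempty by (simp add: card_gt_0_iff)
  have fQ: "finite Q" using Q finite_subset finite_homs by blast
  have GQ: "?G \<subseteq> Q" using goodQ by auto
  have e0: "?e \<ge> 0" "not_good_bound l \<ge> 0" using tol by (auto simp: not_good_bound_def)
  note inv = inverse_degree_le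
  have len: "length xs = l" "xs \<noteq> []" "set xs \<subseteq> V" if "xs \<in> homs par l" for xs
    using that l by (auto simp: homs_def)
  have bad: "(\<Sum>xs\<in>homs par l. of_bool (\<not> good xs)) \<le> ?B * ?e"
    using sum_not_good[OF l t] by (simp add: not_good_bound_def mult_ac)
  have cardG: "real (card ?G) = ?B - (\<Sum>xs\<in>homs par l. of_bool (\<not> good xs))"
  proof -
    have "real (card ?G) = (\<Sum>xs\<in>homs par l. of_bool (good xs))" by (simp add: Int_def)
    also have "\<dots> = (\<Sum>xs\<in>homs par l. 1 - of_bool (\<not> good xs))" by (intro sum.cong) auto
    finally show ?thesis by (simp only: sum_subtractf card_homs[OF l t] sum_constant mult_1_right)
  qed
  have "card (Q - ?G) \<le> card (homs par l \<inter> {xs. \<not> good xs})" using Q by (intro card_mono) auto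
  then have cardR: "real (card (Q - ?G)) \<le> ?B * ?e" using bad by simp
  have cardG_le: "real (card ?G) \<le> ?B" unfolding cardG by (simp add: sum_nonneg)
  have cardG_ge: "real (card ?G) \<ge> ?B * (1 - ?e)" unfolding cardG using bad by (simp add: algebra_simps)
  have "?X = (\<Sum>xs\<in>?G. real (num_forests (set xs))) + (\<Sum>xs\<in>Q - ?G. real (num_forests (set xs)))"
    using sum.subset_diff[OF GQ fQ] by (simp add: add.commute)
  also have "\<dots> \<le> (\<Sum>xs\<in>?G. num_trees * l * ((1 + tol) / d) ^ (l - 1)) + (\<Sum>xs\<in>Q - ?G. num_trees * (3 / d) ^ (l - 1))"
  proof (intro add_mono sum_mono)
    show "real (num_forests (set xs)) \<le> num_trees * l * ((1 + tol) / d) ^ (l - 1)" if "xs \<in> ?G" for xs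
      using num_forests_upper_good[of xs] len[of xs] that by auto
    show "real (num_forests (set xs)) \<le> num_trees * (3 / d) ^ (l - 1)" if "xs \<in> Q - ?G" for xs
      using num_forests_upper_edge_good[of xs par] len[of xs] that Qedge Q t by auto
  qed
  also have "\<dots> = card ?G * (num_trees * l * ((1 + tol) / d) ^ (l - 1)) + card (Q - ?G) * (num_trees * (3 / d) ^ (l - 1))"
    by simp
  also have "\<dots> \<le> ?B * (num_trees * l * ((1 + tol) / d) ^ (l - 1)) + ?B * ?e * (num_trees * (3 / d) ^ (l - 1))"
    using cardG_le cardR num_trees_pos tol d by (intro add_mono mult_right_mono) auto
  also have "\<dots> = num_trees * ?n * (l * (1 + tol) ^ (l - 1) + 3 ^ (l - 1) * ?e)"
  proof -
    have "?n * p * (num_trees * l * (A / p)) + ?n * p * ?e * (num_trees * (T / p)) = num_trees * ?n * (l * A + T * ?e)"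
      if "p \<noteq> 0" for p A T :: real
      using that by (simp add: algebra_simps)
    then show ?thesis using d by (simp add: power_divide algebra_simps)
  qed
  also have "\<dots> \<le> num_trees * ?n * (l * (1 + 3 ^ (l - 1) * tol) + 3 ^ (l - 1) * ?e)"
    using num_trees_pos tol one_plus_power_le[of tol "l - 1"] e0
    by (intro mult_left_mono add_mono) auto
  also have "\<dots> \<le> num_trees * ?n * (l * (1 + 3 ^ l * tol) + 3 ^ l * ?e)"
    using num_trees_pos tol e0 by (intro mult_left_mono add_mono mult_right_mono power_increasing) auto
  also have "\<dots> \<le> num_trees * ?n * (l + mean_error l * tol)"
    using num_trees_pos tol e0 by (intro mult_left_mono) (auto simp: mean_error_def algebra_simps)
  finally have "?X \<le> num_trees * ?n * (l + mean_error l * tol)" .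
  then have upper: "?X / (num_trees * ?n) \<le> l + mean_error l * tol"
    using num_trees_pos n by (simp add: divide_le_eq mult_ac)
  have me: "mean_error l \<ge> l * (not_good_bound l + l\<^sup>2)"
    using e0 by (simp add: mean_error_def distrib_left)
  have lower: "?X / (num_trees * ?n) \<ge> l - mean_error l * tol"
  proof (cases "?e \<le> 1")
    \<comment> \<open>For \<open>?e > 1\<close> the bound is trivial: its lower limit is not
      positive.\<close>
    case False
    have "l - mean_error l * tol \<le> l - l * (not_good_bound l + l\<^sup>2) * tol"
      using me tol by (intro diff_left_mono mult_right_mono) auto
    also have "\<dots> = l * (1 - ?e) - l * l\<^sup>2 * tol" by (simp add: algebra_simps)
    also have "\<dots> \<le> 0"
    proof -
      have "l * (1 - ?e) \<le> 0" using False by (intro mult_nonneg_nonpos) auto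
      moreover have "l * l\<^sup>2 * tol \<ge> 0" using tol by simp
      ultimately show ?thesis by linarith
    qed
    also have "0 \<le> ?X / (num_trees * ?n)"
      using num_trees_pos by (intro divide_nonneg_nonneg sum_nonneg) auto
    finally show ?thesis .
  next
    case True
    let ?q = "(real d / real (d + l)) ^ (l - 1)"
    have q: "?q \<ge> 1 - l\<^sup>2 * tol"
    proof -
      have "1 + real (l - 1) * (- real l / real (d + l)) \<le> (1 + (- real l / real (d + l))) ^ (l - 1)"
        using d by (intro Bernoulli_inequality) (simp add: field_simps)
      also have "1 + (- real l / real (d + l)) = real d / real (d + l)" using d by (simp add: field_simps)
      finally have "1 - real (l - 1) * (real l / real (d + l)) \<le> ?q" by simp
      moreover have "real (l - 1) * (real l / real (d + l)) \<le> real l * (real l * tol)"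
      proof (intro mult_mono)
        have "real l / real (d + l) \<le> real l / real d" using d by (intro divide_left_mono) auto
        also have "\<dots> \<le> real l * tol" using inv mult_left_mono[of "1 / real d" tol "real l"] by simp
        finally show "real l / real (d + l) \<le> real l * tol" .
      qed auto
      ultimately show ?thesis by (simp add: power2_eq_square mult.assoc)
    qed
    have "l - mean_error l * tol \<le> l - l * (not_good_bound l + l\<^sup>2) * tol"
      using me tol by (intro diff_left_mono mult_right_mono) auto
    also have "\<dots> \<le> l * ((1 - ?e) * (1 - l\<^sup>2 * tol))"
      using e0 tol by (simp add: algebra_simps)
    also have "\<dots> \<le> l * ((1 - ?e) * ?q)"
      using q True by (intro mult_left_mono) auto
    also have "\<dots> = (?B * (1 - ?e)) * (num_trees * l / real (d + l) ^ (l - 1)) / (num_trees * ?n)"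
      using num_trees_pos n V_nonempty by (simp add: power_divide)
    also have "\<dots> \<le> card ?G * (num_trees * l / real (d + l) ^ (l - 1)) / (num_trees * ?n)"
      using cardG_ge num_trees_pos by (intro divide_right_mono mult_right_mono) auto
    also have "\<dots> = (\<Sum>xs\<in>?G. num_trees * l / real (d + l) ^ (l - 1)) / (num_trees * ?n)" by simp
    also have "\<dots> \<le> (\<Sum>xs\<in>?G. real (num_forests (set xs))) / (num_trees * ?n)"
    proof (intro divide_right_mono sum_mono)
      show "num_trees * l / real (d + l) ^ (l - 1) \<le> real (num_forests (set xs))" if "xs \<in> ?G" for xs
        using num_forests_lower[of xs] len[of xs] that by (auto simp: good_def)
    qed (use num_trees_pos in auto)
    also have "\<dots> \<le> ?X / (num_trees * ?n)"
      using GQ fQ num_trees_pos by (intro divide_right_mono sum_mono2) auto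
    finally show ?thesis .
  qed
  show ?thesis using upper lower by linarith
qed

text \<open>
  The expected number of embedded subtrees of the spanning tree at which an embedding stops being good
  is negligible. No pointwise bound on the probabilities is available once the embedding is not good,
  so the excess resistance of the last edge is averaged instead.
\<close>

lemma bad_step:
  assumes l: "l \<ge> 1" and t: "tree_order par (Suc l)"
  shows "(\<Sum>ys | ys \<in> homs par (Suc l) \<and> distinct ys \<and> good (butlast ys) \<and> \<not> good ys. real (num_forests (set ys)))
    \<le> bad_step_bound l * (num_trees * card V) * tol"
proof -
  let ?n = "real (card V)"
  let ?a = "\<lambda>ys. if distinct ys \<and> good (butlast ys) \<and> \<not> good ys then real (num_forests (set ys)) else 0"
  \<comment> \<open>\<open>?b\<close> dominates the resistance of the last vertex. Its fixed part
    \<open>2 / d\<close> carries the indicator of a rare event; the excess is small on average even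
    without an indicator.\<close>
  let ?b = "\<lambda>ys. 2 / d * of_bool (\<not> good ys) + excess (ys ! l) (ys ! par l)"
  have d: "real d > 0" using d_pos by simp
  have t': "tree_order par l" "par l < l" using l t by (auto simp: tree_order_Suc)
  note inv = inverse_degree_le
  let ?c = "num_trees * (3 / d) ^ (l - 1)"
  have c: "?c \<ge> 0" using num_trees_pos d by auto
  have "(\<Sum>ys | ys \<in> homs par (Suc l) \<and> distinct ys \<and> good (butlast ys) \<and> \<not> good ys. real (num_forests (set ys)))
    = (\<Sum>ys\<in>homs par (Suc l). ?a ys)"
    by (rule sum.inter_filter) simp
  also have "\<dots> \<le> (\<Sum>ys\<in>homs par (Suc l). ?c * (?b ys))"
  proof (rule sum_mono)
    fix ys assume ys: "ys \<in> homs par (Suc l)"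
    then have yV: "ys ! l \<in> V" "ys ! par l \<in> V" using homs_nth t' by auto
    have ex: "excess (ys ! l) (ys ! par l) \<ge> 0" using yV by (rule excess_nonneg)
    show "?a ys
      \<le> ?c * (?b ys)"
    proof (cases "distinct ys \<and> good (butlast ys) \<and> \<not> good ys")
      case True
      define xs v where "xs = butlast ys" and "v = last ys"
      have len: "length ys = Suc l" using ys by (rule homs_length)
      then have "ys \<noteq> []" by auto
      then have eq: "ys = xs @ [v]" by (simp add: xs_def v_def)
      have lx: "length xs = l" "xs \<noteq> []" using len l eq by auto
      have xsh: "xs \<in> homs par l" using ys unfolding eq homs_snoc[OF l t] by simp
      have v: "ys ! l = v" "ys ! par l = xs ! par l" using lx t' by (auto simp: eq nth_append)
      have S: "set xs \<subseteq> V" "set xs \<noteq> {}" "v \<in> V - set xs"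
        using xsh lx yV v True eq by (auto simp: homs_def)
      have gx: "good xs" using True by (simp add: xs_def)
      have nfx: "real (num_forests (set xs)) \<le> ?c"
        using num_forests_upper_edge_good[OF lx(2) good_edge_good[OF gx S(1)] S(1)] t' lx by simp
      have ne: "v \<noteq> xs ! par l" using S t' lx by auto
      have "eff_res v (set xs) \<le> R v (xs ! par l)" using t' lx S by (intro eff_res_le_R) auto
      also have "\<dots> = 2 / (d + 2) + excess v (xs ! par l)" using ne by (simp add: excess_def)
      also have "\<dots> \<le> 2 / d + excess v (xs ! par l)" using d by (intro add_mono divide_left_mono) auto
      finally have eff_res: "eff_res v (set xs) \<le> 2 / d + excess v (xs ! par l)" .
      have "real (num_forests (set ys)) = real (num_forests (set xs)) * eff_res v (set xs)"
        using num_forests_insert[OF S(1,2)] eq by simp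
      also have "\<dots> \<le> ?c * (2 / d + excess v (xs ! par l))"
        using nfx eff_res eff_res_pos[OF S] c by (intro mult_mono) auto
      finally show ?thesis using True v by simp
    next
      case False
      have "0 \<le> ?c * (?b ys)"
        using c ex d num_trees_pos by (intro mult_nonneg_nonneg add_nonneg_nonneg) auto
      then show ?thesis using False by (simp only: if_False)
    qed
  qed
  also have "\<dots> = ?c * (2 / d * (\<Sum>ys\<in>homs par (Suc l). of_bool (\<not> good ys))
      + (\<Sum>ys\<in>homs par (Suc l). excess (ys ! l) (ys ! par l)))"
    by (simp only: sum_distrib_left[symmetric] sum.distrib)
  also have "\<dots> \<le> ?c * (2 / d * (not_good_bound (Suc l) * (?n * real d ^ l) * tol) + ?n * real d ^ (l - 1) * (2 * l + 8) * tol)"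
  proof (intro mult_left_mono add_mono)
    show "(\<Sum>ys\<in>homs par (Suc l). of_bool (\<not> good ys)) \<le> not_good_bound (Suc l) * (?n * real d ^ l) * tol"
      using sum_not_good[OF _ t] by (simp add: not_good_bound_def)
    have "(\<Sum>ys\<in>homs par (Suc l). excess (ys ! l) (ys ! par l))
      \<le> ?n * real d ^ (Suc l - 2) * (2 * Suc l + 6) / real d"
      using sum_homs_excess[OF _ t, of l "par l"] t' by simp
    also have "\<dots> = ?n * real d ^ (l - 1) * (2 * l + 8) * (1 / real d)"
    proof -
      have "Suc l - 2 = l - 1" by simp
      then show ?thesis by simp
    qed
    also have "\<dots> \<le> ?n * real d ^ (l - 1) * (2 * l + 8) * tol"
      using inv by (intro mult_left_mono) auto
    finally show "(\<Sum>ys\<in>homs par (Suc l). excess (ys ! l) (ys ! par l))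
      \<le> ?n * real d ^ (l - 1) * (2 * l + 8) * tol" .
  qed (use c d in auto)
  also have "\<dots> = 3 ^ (l - 1) * (2 * not_good_bound (Suc l) + (2 * l + 8)) * (num_trees * ?n) * tol"
  proof -
    obtain m where m: "l = Suc m" using l by (cases l) auto
    then have m': "l - 1 = m" "real d ^ l = real d * real d ^ m" by auto
    show ?thesis unfolding m' power_divide by (rule bad_step_algebra) (use d in auto)
  qed
  also have "\<dots> \<le> bad_step_bound l * (num_trees * ?n) * tol"
  proof -
    have "(3 :: real) ^ (l - 1) \<le> 3 ^ l" by (rule power_increasing) auto
    moreover have "2 * not_good_bound (Suc l) + (2 * l + 8) \<ge> 0" by (simp add: not_good_bound_def)
    ultimately show ?thesis
      unfolding bad_step_bound_def using num_trees_pos tol by (intro mult_right_mono) auto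
  qed
  finally show ?thesis .
qed

end

section \<open>Factorial moments of the number of additional children\<close>

definition consistent :: "(nat \<Rightarrow> nat) \<Rightarrow> ('a \<Rightarrow> 'a) \<Rightarrow> 'a list \<Rightarrow> bool" where
  "consistent par p xs \<longleftrightarrow> (\<forall>i. 1 \<le> i \<and> i < length xs \<longrightarrow> p (xs ! i) = xs ! par i)"

context fin_graph
begin

text \<open>Contraction of the prescribed edges, by downward induction on \<open>j\<close>: with the
  first \<open>j\<close> vertices as roots and the parents from index \<open>j\<close> on
  prescribed, \<open>num_forests (set xs)\<close> choices remain, since \<open>F_with_value\<close>
  trades the edge at \<open>xs ! j\<close> for a new root.\<close>

lemma card_consistent:
  assumes xs: "xs \<in> homs par l" and dist: "distinct xs" and l: "l \<ge> 1" and t: "tree_order par l"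
  shows "card {p \<in> F {xs ! 0}. consistent par p xs} = num_forests (set xs)"
proof -
  have len: "length xs = l" using xs by (rule homs_length)
  let ?P = "\<lambda>j p. \<forall>i. j \<le> i \<and> i < l \<longrightarrow> p (xs ! i) = xs ! par i"
  have "card {p \<in> F (set (take j xs)). ?P j p} = num_forests (set xs)" if "1 \<le> j" "j \<le> l" for j
    using that(2,1)
  proof (induction j rule: inc_induct)
    case base
    have "{p \<in> F (set (take l xs)). ?P l p} = F (set (take l xs))" by auto
    then show ?case using len by (simp only: num_forests_def) simp
  next
    case (step j)
    let ?S = "set (take j xs)" and ?y = "xs ! j" and ?u = "xs ! par j"
    have "set (take (Suc j) xs) = insert ?y ?S" using step len by (simp add: take_Suc_conv_app_nth)
    have par: "par j < j" using t step by (auto simp: tree_order_def)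
    have y: "?y \<in> V - ?S"
      using dist step len homs_nth[OF xs, of j] by (auto simp: in_set_conv_nth nth_eq_iff_index_eq)
    have u: "?u \<in> ?S"
      using par step len by (force simp: in_set_conv_nth)
    have "?y \<in> N ?u" using xs step by (auto simp: homs_def)
    then have uy: "?u \<in> N ?y" using N_sym homs_nth[OF xs, of "par j"] par step by auto
    have bij: "bij_betw (\<lambda>q. q(?y := ?u)) (F (insert ?y ?S)) {p \<in> F ?S. p ?y = ?u}"
      by (rule F_with_value[OF y u uy])
    have P: "?P (Suc j) (q(?y := ?u)) \<longleftrightarrow> ?P (Suc j) q" for q
      using dist step len by (auto simp: nth_eq_iff_index_eq)
    have "j \<le> i \<longleftrightarrow> i = j \<or> Suc j \<le> i" for i by auto
    then have "?P j p \<longleftrightarrow> p ?y = ?u \<and> ?P (Suc j) p" for p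
      using step(2) by (simp only:) blast
    then have "{p \<in> F ?S. ?P j p} = {p \<in> {p \<in> F ?S. p ?y = ?u}. ?P (Suc j) p}"
      by blast
    also have "\<dots> = (\<lambda>q. q(?y := ?u)) ` {q \<in> F (insert ?y ?S). ?P (Suc j) q}"
      unfolding bij_betw_imp_surj_on[OF bij, symmetric] using P by blast
    also have "card \<dots> = card {q \<in> F (insert ?y ?S). ?P (Suc j) q}"
      using bij_betw_imp_inj_on[OF bij] by (intro card_image) (auto intro: inj_on_subset)
    also have "\<dots> = num_forests (set xs)"
      using step(3) \<open>set (take (Suc j) xs) = insert ?y ?S\<close> by simp
    finally show ?case .
  qed
  from this[of 1] have "card {p \<in> F (set (take 1 xs)). ?P 1 p} = num_forests (set xs)" using l by simp
  moreover have "take 1 xs = [xs ! 0]" using l len by (cases xs) auto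
  ultimately show ?thesis using len by (simp add: consistent_def)
qed

lemma consistent_homs_snoc:
  assumes p: "p \<in> F {xs ! 0}" and xs: "xs \<in> homs par l" and l: "l \<ge> 1" and t: "tree_order par l"
    and a: "a < l" and v: "v \<in> V" "v \<noteq> xs ! 0" and pv: "p v = xs ! a"
  shows "xs @ [v] \<in> homs (par(l := a)) (Suc l)"
proof -
  have "p v \<in> N v" using rooted_forestsD(2)[OF p] v by auto
  then have "v \<in> N (xs ! a)" using pv N_sym v by auto
  moreover have "xs \<in> homs (par(l := a)) l" using xs by (auto simp: homs_def)
  moreover have "tree_order (par(l := a)) (Suc l)" using t a l by (auto simp: tree_order_def)
  ultimately show ?thesis using homs_snoc[of l "par(l := a)" xs v] l by simp
qed

end

definition attach_par :: "nat \<Rightarrow> (nat \<Rightarrow> nat) \<Rightarrow> nat list \<Rightarrow> nat \<Rightarrow> nat" where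
  "attach_par k par as i = (if i < k then par i else as ! (i - k))"

lemma tree_order_attach:
  assumes "tree_order par k" "set as \<subseteq> {..<k}"
  shows "tree_order (attach_par k par as) (k + length as)"
proof -
  have "as ! (i - k) < i" if "k \<le> i" "i < k + length as" for i
  proof -
    have "i - k < length as" using that by linarith
    then have "as ! (i - k) \<in> set as" by simp
    then have "as ! (i - k) < k" using assms(2) by blast
    then show ?thesis using that by linarith
  qed
  then show ?thesis using assms(1) by (auto simp: tree_order_def attach_par_def)
qed

text \<open>Bonferroni: for \<open>y = Suc z\<close> the alternating sum telescopes by Pascal's rule
  to \<open>(-1) ^ J * (z choose J)\<close>, and \<open>z choose J\<close> is at most
  \<open>y choose Suc J\<close>.\<close>

lemma abs_of_bool_minus_alternating:
  "\<bar>of_bool (y = 0) - (\<Sum>j\<le>J. (-1) ^ j * real (y choose j))\<bar> \<le> real (y choose Suc J)"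
proof (cases y)
  case 0
  have "(\<Sum>j\<le>J. (-1) ^ j * real (0 choose j)) = (\<Sum>j\<in>{0}. (-1) ^ j * real (0 choose j))"
    by (rule sum.mono_neutral_right) auto
  then show ?thesis using 0 by simp
next
  case (Suc z)
  have "(\<Sum>j\<le>J. (-1) ^ j * real (Suc z choose j)) = (-1) ^ J * real (z choose J)"
    by (induction J) (auto simp: algebra_simps)
  then show ?thesis using Suc by (simp add: abs_mult)
qed

lemma card_distinct_lists:
  assumes "finite A"
  shows "real (card {vs. length vs = j \<and> distinct vs \<and> set vs \<subseteq> A}) = fact j * real (card A choose j)"
proof (cases "j \<le> card A")
  case True
  have "card {vs. length vs = j \<and> distinct vs \<and> set vs \<subseteq> A} = \<Prod>{card A - j + 1..card A}"
    using card_lists_distinct_length_eq[OF assms True] by simp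
  also have "\<dots> = fact (card A) div fact (card A - j)"
    using True by (simp add: fact_div_fact)
  also have "(fact (card A) :: nat) = fact (card A - j) * (fact j * (card A choose j))"
    using binomial_fact_lemma[OF True] by (simp add: ac_simps)
  finally show ?thesis by simp
next
  case False
  have eq: "{vs. length vs = j \<and> distinct vs \<and> set vs \<subseteq> A} = {}"
    using False card_mono[OF assms] by (auto simp: distinct_card[symmetric])
  show ?thesis unfolding eq using False by simp
qed

context reg_graph
begin

context
  fixes par :: "nat \<Rightarrow> nat" and k :: nat and I :: "nat set"
  assumes k: "k \<ge> 1" and t: "tree_order par k" and I: "I \<subseteq> {..<k}"
begin

text \<open>Each new vertex is tested against \<open>xs\<close> alone and not against other new
  vertices. Thus \<open>hits\<close> is a set, to whose cardinality the Bonferroni inequalities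
  apply.\<close>

definition good_exts :: "'a list \<Rightarrow> 'a set" where "good_exts xs = {v \<in> V. good (xs @ [v])}"

definition hits :: "('a \<Rightarrow> 'a) \<Rightarrow> 'a list \<Rightarrow> 'a set" where
  "hits p xs = {v \<in> good_exts xs. p v \<in> (!) xs ` I}"

definition matching :: "'a list \<Rightarrow> ('a \<Rightarrow> 'a) set" where
  "matching xs = {p \<in> F {xs ! 0}. consistent par p xs}"

text \<open>All further children count here, whereas \<open>hits\<close> sees only those that keep
  the copy typical; the difference is estimated in \<open>missed_hits\<close>.\<close>

definition exact :: "('a \<Rightarrow> 'a) \<Rightarrow> 'a list \<Rightarrow> bool" where
  "exact p xs \<longleftrightarrow> (\<forall>v \<in> V - set xs. p v \<notin> (!) xs ` I)"

definition indices :: "nat \<Rightarrow> nat list set" where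
  "indices j = {as. length as = j \<and> set as \<subseteq> I}"

lemma finite_I: "finite I" using I finite_subset by blast

lemma finite_matching [simp]: "finite (matching xs)" by (simp add: matching_def)

lemma finite_good_exts [simp]: "finite (good_exts xs)" by (simp add: good_exts_def)

lemma finite_hits [simp]: "finite (hits p xs)" by (simp add: hits_def)

lemma finite_indices [simp]: "finite (indices j)"
  using finite_lists_length_eq[OF finite_I, of j] unfolding indices_def by (rule finite_subset[rotated]) auto

lemma card_indices: "card (indices j) = card I ^ j"
  using card_lists_length_eq[OF finite_I, of j] by (simp add: indices_def conj_commute)

lemma good_exts_notin: "v \<in> good_exts xs \<Longrightarrow> v \<notin> set xs"
  by (auto simp: good_exts_def good_def)

text \<open>The lists of hits are sorted by the positions \<open>as\<close> of their parents in
  \<open>xs\<close>, which are unique because \<open>xs\<close> is distinct.\<close>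

lemma hits_lists:
  assumes "distinct xs" "length xs = k"
  shows "card {vs. length vs = j \<and> distinct vs \<and> set vs \<subseteq> hits p xs}
    = (\<Sum>as\<in>indices j. card {vs. length vs = j \<and> distinct vs \<and> set vs \<subseteq> good_exts xs \<and> (\<forall>i<j. p (vs ! i) = xs ! (as ! i))})"
proof -
  let ?A = "\<lambda>as. {vs. length vs = j \<and> distinct vs \<and> set vs \<subseteq> good_exts xs \<and> (\<forall>i<j. p (vs ! i) = xs ! (as ! i))}"
  have fin: "finite (?A as)" for as
    using finite_lists_length_eq[OF finite_good_exts[of xs], of j] by (rule finite_subset[rotated]) auto
  have inj: "as = bs" if "as \<in> indices j" "bs \<in> indices j" "vs \<in> ?A as" "vs \<in> ?A bs" for as bs vs
  proof (rule nth_equalityI)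
    show "length as = length bs" using that by (simp add: indices_def)
    fix i assume i: "i < length as"
    then have "xs ! (as ! i) = xs ! (bs ! i)" using that by (auto simp: indices_def)
    moreover have "as ! i \<in> set as" "bs ! i \<in> set bs" using i that by (auto simp: indices_def)
    then have "as ! i < k" "bs ! i < k" using that I by (auto simp: indices_def)
    ultimately show "as ! i = bs ! i" using assms by (simp add: nth_eq_iff_index_eq)
  qed
  have "{vs. length vs = j \<and> distinct vs \<and> set vs \<subseteq> hits p xs} = (\<Union>as\<in>indices j. ?A as)"
  proof (intro equalityI subsetI)
    fix vs assume vs: "vs \<in> {vs. length vs = j \<and> distinct vs \<and> set vs \<subseteq> hits p xs}"
    have "\<forall>i. \<exists>a. i < j \<longrightarrow> a \<in> I \<and> p (vs ! i) = xs ! a"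
    proof
      fix i
      show "\<exists>a. i < j \<longrightarrow> a \<in> I \<and> p (vs ! i) = xs ! a"
      proof (cases "i < j")
        case True
        then have "vs ! i \<in> hits p xs" using vs nth_mem by blast
        then show ?thesis by (auto simp: hits_def)
      qed auto
    qed
    then obtain a where a: "\<And>i. i < j \<Longrightarrow> a i \<in> I \<and> p (vs ! i) = xs ! a i" by metis
    have "map a [0..<j] \<in> indices j" using a by (auto simp: indices_def)
    moreover have "vs \<in> ?A (map a [0..<j])" using vs a by (auto simp: hits_def)
    ultimately show "vs \<in> (\<Union>as\<in>indices j. ?A as)" by blast
  next
    fix vs assume "vs \<in> (\<Union>as\<in>indices j. ?A as)"
    then obtain as where as: "as \<in> indices j" "vs \<in> ?A as" by blast
    have "v \<in> hits p xs" if v: "v \<in> set vs" for v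
    proof -
      obtain i where i: "i < j" "vs ! i = v" using v as by (auto simp: in_set_conv_nth)
      have "as ! i \<in> set as" using i as by (auto simp: indices_def)
      then have "as ! i \<in> I" using as by (auto simp: indices_def)
      moreover have "p v = xs ! (as ! i)" using as i by auto
      ultimately have "p v \<in> (!) xs ` I" by blast
      then show ?thesis using v as by (auto simp: hits_def)
    qed
    then show "vs \<in> {vs. length vs = j \<and> distinct vs \<and> set vs \<subseteq> hits p xs}" using as by auto
  qed
  then show ?thesis using fin inj by (simp only:) (rule card_UN_disjoint, auto)
qed

definition extended :: "nat list \<Rightarrow> 'a list set" where
  "extended as = {zs \<in> homs (attach_par k par as) (k + length as).
     distinct zs \<and> good (take k zs) \<and> set (drop k zs) \<subseteq> good_exts (take k zs)}"

lemma homs_attach: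
  assumes "xs \<in> homs par k" "length vs = length as" "set vs \<subseteq> V" "set as \<subseteq> {..<k}"
  shows "xs @ vs \<in> homs (attach_par k par as) (k + length as) \<longleftrightarrow> (\<forall>i<length as. vs ! i \<in> N (xs ! (as ! i)))"
proof
  have len: "length xs = k" using assms(1) by (rule homs_length)
  have as: "as ! i < k" if "i < length as" for i
    using that assms(4) nth_mem by blast
  {
    assume h: "xs @ vs \<in> homs (attach_par k par as) (k + length as)"
    show "\<forall>i<length as. vs ! i \<in> N (xs ! (as ! i))"
    proof (intro allI impI)
      fix i assume i: "i < length as"
      then have "(xs @ vs) ! (k + i) \<in> N ((xs @ vs) ! attach_par k par as (k + i))"
        using h k by (auto simp: homs_def)
      then show "vs ! i \<in> N (xs ! (as ! i))"
        using as[OF i] len by (simp add: attach_par_def nth_append)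
    qed
  next
    assume h: "\<forall>i<length as. vs ! i \<in> N (xs ! (as ! i))"
    have "(xs @ vs) ! i \<in> N ((xs @ vs) ! attach_par k par as i)" if i: "1 \<le> i" "i < k + length as" for i
    proof (cases "i < k")
      case True
      then have "par i < k" using t i by (auto simp: tree_order_def intro: less_trans)
      then show ?thesis using True i assms(1) len by (simp add: attach_par_def nth_append homs_def)
    next
      case False
      then have "i - k < length as" using i by linarith
      then show ?thesis using h as[of "i - k"] False len by (simp add: attach_par_def nth_append)
    qed
    then show "xs @ vs \<in> homs (attach_par k par as) (k + length as)"
      using assms len by (auto simp: homs_def)
  }
qed

lemma consistent_attach:
  assumes "length xs = k" "length vs = length as" "set as \<subseteq> {..<k}"
  shows "consistent (attach_par k par as) p (xs @ vs)
    \<longleftrightarrow> consistent par p xs \<and> (\<forall>i<length as. p (vs ! i) = xs ! (as ! i))"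
proof
  have as: "as ! i < k" if "i < length as" for i
    using that assms(3) nth_mem by blast
  {
    assume h: "consistent (attach_par k par as) p (xs @ vs)"
    have "p (xs ! i) = xs ! par i" if i: "1 \<le> i" "i < k" for i
    proof -
      have "par i < k" using t i by (auto simp: tree_order_def intro: less_trans)
      moreover have "p ((xs @ vs) ! i) = (xs @ vs) ! attach_par k par as i"
        using h i assms by (simp add: consistent_def)
      ultimately show ?thesis using i assms by (simp add: attach_par_def nth_append)
    qed
    moreover have "p (vs ! i) = xs ! (as ! i)" if i: "i < length as" for i
    proof -
      have "p ((xs @ vs) ! (k + i)) = (xs @ vs) ! attach_par k par as (k + i)"
        using h i k assms by (simp add: consistent_def)
      then show ?thesis using as[OF i] assms by (simp add: attach_par_def nth_append)
    qed
    ultimately show "consistent par p xs \<and> (\<forall>i<length as. p (vs ! i) = xs ! (as ! i))"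
      using assms by (simp add: consistent_def)
  next
    assume h: "consistent par p xs \<and> (\<forall>i<length as. p (vs ! i) = xs ! (as ! i))"
    have "p ((xs @ vs) ! i) = (xs @ vs) ! attach_par k par as i" if i: "1 \<le> i" "i < k + length as" for i
    proof (cases "i < k")
      case True
      then have "par i < k" using t i by (auto simp: tree_order_def intro: less_trans)
      then show ?thesis using True i h assms by (simp add: attach_par_def nth_append consistent_def)
    next
      case False
      then have "i - k < length as" using i by linarith
      then show ?thesis using h as[of "i - k"] False assms by (simp add: attach_par_def nth_append)
    qed
    then show "consistent (attach_par k par as) p (xs @ vs)" using assms by (simp add: consistent_def)
  }
qed

lemma sum_extended:
  "(\<Sum>zs\<in>extended as. g zs) =
    (\<Sum>xs | xs \<in> homs par k \<and> good xs. \<Sum>vs | xs @ vs \<in> homs (attach_par k par as) (k + length as)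
      \<and> distinct (xs @ vs) \<and> set vs \<subseteq> good_exts xs. g (xs @ vs))"
proof -
  let ?W = "\<lambda>xs. {vs. xs @ vs \<in> homs (attach_par k par as) (k + length as) \<and> distinct (xs @ vs) \<and> set vs \<subseteq> good_exts xs}"
  let ?G = "{xs. xs \<in> homs par k \<and> good xs}"
  have fin: "finite (?W xs)" for xs
  proof (rule finite_subset)
    show "?W xs \<subseteq> {vs. set vs \<subseteq> good_exts xs \<and> length vs = k + length as - length xs}"
      by (auto simp: homs_def)
    show "finite {vs. set vs \<subseteq> good_exts xs \<and> length vs = k + length as - length xs}"
      by (rule finite_lists_length_eq) simp
  qed
  have fG: "finite ?G" by (rule finite_subset[OF _ finite_homs[of par k]]) auto
  have prefix: "take k zs \<in> homs par k" if zs: "zs \<in> homs (attach_par k par as) (k + length as)" for zs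
  proof -
    have len: "length zs = k + length as" using zs by (rule homs_length)
    have "zs ! i \<in> N (take k zs ! par i)" if i: "1 \<le> i" "i < k" for i
    proof -
      have "par i < k" using t i by (auto simp: tree_order_def intro: less_trans)
      moreover have "zs ! i \<in> N (zs ! attach_par k par as i)" using zs i by (simp add: homs_def)
      ultimately show ?thesis using i by (simp add: attach_par_def)
    qed
    moreover have "set (take k zs) \<subseteq> V" using zs set_take_subset[of k zs] by (auto simp: homs_def)
    ultimately show ?thesis using len by (auto simp: homs_def)
  qed
  have "(\<Sum>zs\<in>extended as. g zs) = (\<Sum>(xs, vs)\<in>Sigma ?G ?W. g (xs @ vs))"
  proof (rule sum.reindex_bij_witness[of _ "\<lambda>(xs, vs). xs @ vs" "\<lambda>zs. (take k zs, drop k zs)"])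
    fix zs assume "zs \<in> extended as"
    then show "(take k zs, drop k zs) \<in> Sigma ?G ?W"
      using prefix by (auto simp: extended_def dest: set_take_disj_set_drop_if_distinct[of _ k k])
  next
    fix b assume b: "b \<in> Sigma ?G ?W"
    then obtain xs vs where b': "b = (xs, vs)" by (cases b)
    have "length xs = k" using b b' by (auto simp: homs_def)
    then show "(take k (case b of (xs, vs) \<Rightarrow> xs @ vs), drop k (case b of (xs, vs) \<Rightarrow> xs @ vs)) = b"
      and "(case b of (xs, vs) \<Rightarrow> xs @ vs) \<in> extended as"
      using b b' by (auto simp: extended_def)
  qed auto
  also have "\<dots> = (\<Sum>xs\<in>?G. \<Sum>vs\<in>?W xs. g (xs @ vs))"
    using fG fin by (subst sum.Sigma) auto
  finally show ?thesis .
qed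

text \<open>Double counting: the falling factorial counts ordered lists of \<open>j\<close> hits,
  and such a list together with \<open>xs\<close> is a copy of the tree with \<open>j\<close> new
  leaves. The parent functions containing this copy are then counted by
  \<open>card_consistent\<close>.\<close>

lemma factorial_moment_eq:
  "(\<Sum>xs | xs \<in> homs par k \<and> good xs. \<Sum>p\<in>matching xs. fact j * real (card (hits p xs) choose j))
    = (\<Sum>as\<in>indices j. \<Sum>zs\<in>extended as. real (num_forests (set zs)))"
proof -
  let ?m = "\<lambda>xs p as vs. \<forall>i<j. p (vs ! i) = xs ! (as ! i)" and ?n = "\<lambda>xs vs. real (num_forests (set (xs @ vs)))"
  let ?C = "\<lambda>xs as vs. {p \<in> F {xs ! 0}. consistent (attach_par k par as) p (xs @ vs)}"
  let ?c = "\<lambda>xs as vs. real (card (?C xs as vs))"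
  let ?G = "{xs. xs \<in> homs par k \<and> good xs}"
  let ?W = "\<lambda>as xs. {vs. xs @ vs \<in> homs (attach_par k par as) (k + length as) \<and> distinct (xs @ vs) \<and> set vs \<subseteq> good_exts xs}"
  let ?D = "\<lambda>xs. {vs. length vs = j \<and> distinct vs \<and> set vs \<subseteq> good_exts xs}"
  have fD: "finite (?D xs)" for xs
    using finite_lists_length_eq[OF finite_good_exts[of xs], of j] by (rule finite_subset[rotated]) auto
  have one: "(\<Sum>p\<in>matching xs. fact j * real (card (hits p xs) choose j))
    = (\<Sum>as\<in>indices j. \<Sum>vs\<in>?W as xs. ?n xs vs)" if xs: "xs \<in> ?G" for xs
  proof -
    have len: "length xs = k" and dist: "distinct xs" and xh: "xs \<in> homs par k"
      using xs by (auto simp: homs_def good_def)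
    have "(\<Sum>p\<in>matching xs. fact j * real (card (hits p xs) choose j))
      = (\<Sum>p\<in>matching xs. \<Sum>as\<in>indices j. \<Sum>vs\<in>?D xs. of_bool (?m xs p as vs))"
    proof (intro sum.cong refl)
      fix p
      have "fact j * real (card (hits p xs) choose j)
        = real (card {vs. length vs = j \<and> distinct vs \<and> set vs \<subseteq> hits p xs})"
        by (rule card_distinct_lists[symmetric]) simp
      also have "\<dots> = (\<Sum>as\<in>indices j. real (card {vs. length vs = j \<and> distinct vs \<and> set vs \<subseteq> good_exts xs
          \<and> (?m xs p as vs)}))"
        unfolding hits_lists[OF dist len] by simp
      also have "\<dots> = (\<Sum>as\<in>indices j. \<Sum>vs\<in>?D xs. of_bool (?m xs p as vs))"
      proof (intro sum.cong refl)
        fix as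
        have "{vs. length vs = j \<and> distinct vs \<and> set vs \<subseteq> good_exts xs \<and> (?m xs p as vs)}
          = ?D xs \<inter> {vs. ?m xs p as vs}" by auto
        then show "real (card {vs. length vs = j \<and> distinct vs \<and> set vs \<subseteq> good_exts xs
            \<and> (?m xs p as vs)})
          = (\<Sum>vs\<in>?D xs. of_bool (?m xs p as vs))"
          using fD by simp
      qed
      finally show "fact j * real (card (hits p xs) choose j)
        = (\<Sum>as\<in>indices j. \<Sum>vs\<in>?D xs. of_bool (?m xs p as vs))" .
    qed
    also have "\<dots> = (\<Sum>as\<in>indices j. \<Sum>vs\<in>?D xs. \<Sum>p\<in>matching xs. of_bool (?m xs p as vs))"
      unfolding sum.swap[of _ "indices j" "matching xs"]
      by (intro sum.cong refl sum.swap)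
    also have "\<dots> = (\<Sum>as\<in>indices j. \<Sum>vs\<in>?W as xs. ?n xs vs)"
    proof (rule sum.cong[OF refl])
      fix as assume as: "as \<in> indices j"
      then have as': "set as \<subseteq> {..<k}" "length as = j" using I by (auto simp: indices_def)
      have "(\<Sum>vs\<in>?D xs. \<Sum>p\<in>matching xs. of_bool (?m xs p as vs))
        = (\<Sum>vs\<in>?D xs. ?c xs as vs)"
      proof (intro sum.cong refl)
        fix vs assume vs: "vs \<in> ?D xs"
        then have "matching xs \<inter> {p. ?m xs p as vs}
          = ?C xs as vs"
          using consistent_attach[of xs vs as] as' len by (auto simp: matching_def)
        then show "(\<Sum>p\<in>matching xs. of_bool (?m xs p as vs))
          = ?c xs as vs" by simp
      qed
      also have "\<dots> = (\<Sum>vs\<in>?W as xs. ?c xs as vs)"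
      proof (rule sum.mono_neutral_right[OF fD])
        show "?W as xs \<subseteq> ?D xs" using as' len by (auto simp: homs_def)
        \<comment> \<open>Lists that do not form a copy of the enlarged tree contribute nothing,
          because a parent function only uses edges of the graph.\<close>
        show "\<forall>vs\<in>?D xs - ?W as xs.
          ?c xs as vs = 0"
        proof
          fix vs assume vs: "vs \<in> ?D xs - ?W as xs"
          then have vD: "length vs = length as" "set vs \<subseteq> V" "distinct vs" "set vs \<subseteq> good_exts xs"
            using as' by (auto simp: good_exts_def)
          have "distinct (xs @ vs)" using vD dist good_exts_notin by auto
          then obtain i where i: "i < length as" "vs ! i \<notin> N (xs ! (as ! i))"
            using vs vD homs_attach[OF xh vD(1,2) as'(1)] by auto
          have "vs ! i \<in> set vs" using i vD by simp
          then have v: "vs ! i \<in> V" "vs ! i \<notin> set xs" using vD good_exts_notin by auto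
          moreover have "xs ! 0 \<in> set xs" using len k by simp
          ultimately have v0: "vs ! i \<noteq> xs ! 0" by metis
          have False if p: "p \<in> F {xs ! 0}" "consistent (attach_par k par as) p (xs @ vs)" for p
          proof -
            have "p (vs ! i) = xs ! (as ! i)" using p(2) consistent_attach[of xs vs as] as' len vD i by auto
            moreover have "p (vs ! i) \<in> N (vs ! i)" using rooted_forestsD(2)[OF p(1)] v v0 by auto
            ultimately show False using N_sym[of "vs ! i" "xs ! (as ! i)"] v i by auto
          qed
          then have "?C xs as vs = {}" by blast
          then show "?c xs as vs = 0" by simp
        qed
      qed
      also have "\<dots> = (\<Sum>vs\<in>?W as xs. ?n xs vs)"
      proof (intro sum.cong refl)
        fix vs assume vs: "vs \<in> ?W as xs"
        have "(xs @ vs) ! 0 = xs ! 0" using len k by (simp add: nth_append)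
        then show "?c xs as vs
          = ?n xs vs"
          using card_consistent[of "xs @ vs" "attach_par k par as" "k + length as"] vs
            tree_order_attach[OF t as'(1)] k by auto
      qed
      finally show "(\<Sum>vs\<in>?D xs. \<Sum>p\<in>matching xs. of_bool (?m xs p as vs))
        = (\<Sum>vs\<in>?W as xs. ?n xs vs)" .
    qed
    finally show ?thesis .
  qed
  have "(\<Sum>xs\<in>?G. \<Sum>p\<in>matching xs. fact j * real (card (hits p xs) choose j))
    = (\<Sum>xs\<in>?G. \<Sum>as\<in>indices j. \<Sum>vs\<in>?W as xs. ?n xs vs)"
    using one by (rule sum.cong[OF refl])
  also have "\<dots> = (\<Sum>as\<in>indices j. \<Sum>xs\<in>?G. \<Sum>vs\<in>?W as xs. ?n xs vs)"
    by (rule sum.swap)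
  also have "\<dots> = (\<Sum>as\<in>indices j. \<Sum>zs\<in>extended as. real (num_forests (set zs)))"
    by (simp only: sum_extended)
  finally show ?thesis .
qed

text \<open>There are \<open>card I ^ j\<close> ways to attach the \<open>j\<close> leaves, each
  giving a tree with \<open>k + j\<close> vertices to which \<open>mean_count\<close> applies with
  \<open>extended as\<close> as the set \<open>Q\<close>.\<close>

lemma factorial_moment:
  "\<bar>(\<Sum>xs | xs \<in> homs par k \<and> good xs. \<Sum>p\<in>matching xs. fact j * real (card (hits p xs) choose j)) / (num_trees * card V)
     - card I ^ j * (k + j)\<bar> \<le> card I ^ j * mean_error (k + j) * tol"
proof -
  have ext: "\<bar>(\<Sum>zs\<in>extended as. real (num_forests (set zs))) / (num_trees * card V) - (k + j)\<bar> \<le> mean_error (k + j) * tol"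
    if as: "as \<in> indices j" for as
  proof -
    have as': "set as \<subseteq> {..<k}" "length as = j" using as I by (auto simp: indices_def)
    have tt: "tree_order (attach_par k par as) (k + j)" using tree_order_attach[OF t as'(1)] as' by simp
    show ?thesis
    proof (rule mean_count[OF _ tt])
      show "1 \<le> k + j" using k by simp
      show "extended as \<subseteq> homs (attach_par k par as) (k + j)" using as' by (auto simp: extended_def)
      fix zs
      {
        assume zs: "zs \<in> homs (attach_par k par as) (k + j)" "good zs"
        have len: "length zs = k + j" and zV: "set zs \<subseteq> V" using zs(1) by (auto simp: homs_def)
        have ex: "excess (zs ! a) (zs ! b) \<le> tol / d" if "a < k + j" "b < k + j" for a b
          using that zs(2) len by (simp add: good_def)
        have dist: "distinct zs" using zs by (simp add: good_def)
        have "good (take k zs)" using ex dist len by (simp add: good_def)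
        moreover have "v \<in> good_exts (take k zs)" if v: "v \<in> set (drop k zs)" for v
        proof -
          obtain i where i: "i < j" "v = zs ! (k + i)"
            using v len by (auto simp: in_set_conv_nth)
          have nth: "(take k zs @ [v]) ! b = zs ! (if b < k then b else k + i)" if "b < Suc k" for b
            using that len i by (auto simp: nth_append less_Suc_eq)
          have "distinct (take k zs @ [v])"
            using dist v set_take_disj_set_drop_if_distinct[OF dist, of k k] by auto
          moreover have "excess ((take k zs @ [v]) ! a) ((take k zs @ [v]) ! b) \<le> tol / d"
            if "a < Suc k" "b < Suc k" for a b
            using nth[OF that(1)] nth[OF that(2)] ex i by auto
          ultimately have "good (take k zs @ [v])" using len by (simp add: good_def)
          then show ?thesis using zV v by (auto simp: good_exts_def dest: in_set_dropD)
        qed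
        ultimately show "zs \<in> extended as" using zs as' dist by (auto simp: extended_def)
      next
        assume zs: "zs \<in> extended as"
        have zh: "zs \<in> homs (attach_par k par as) (k + j)" "distinct zs" "good (take k zs)"
          "set (drop k zs) \<subseteq> good_exts (take k zs)" using zs as' by (auto simp: extended_def)
        have len: "length zs = k + j" and zV: "set zs \<subseteq> V" using zh(1) by (auto simp: homs_def)
        have tV: "set (take k zs) \<subseteq> V" using zV set_take_subset[of k zs] by auto
        \<comment> \<open>Each edge of the enlarged tree lies in the typical copy or joins it to one
          typical extension, so pairs of new leaves are never compared.\<close>
        have "R (zs ! i) (zs ! attach_par k par as i) \<le> 3 / d" if i: "1 \<le> i" "i < k + j" for i
        proof (cases "i < k")
          case True
          then have "par i < k" using t i by (auto simp: tree_order_def intro: less_trans)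
          then show ?thesis
            using good_R_le_3[OF zh(3) tV, of i "par i"] True len by (simp add: attach_par_def)
        next
          case False
          let ?v = "zs ! i" and ?a = "as ! (i - k)"
          have ik: "i - k < length as" using False i as' by linarith
          then have a: "?a < k" using as' nth_mem by blast
          have "drop k zs ! (i - k) = zs ! i" using len False by simp
          then have v: "?v \<in> set (drop k zs)" using len ik as' by (metis diff_add_inverse length_drop nth_mem)
          then have "good (take k zs @ [?v])" using zh(4) by (auto simp: good_exts_def)
          then have "R ((take k zs @ [?v]) ! k) ((take k zs @ [?v]) ! ?a) \<le> 3 / d"
            using tV zV i len a by (intro good_R_le_3) auto
          then show ?thesis using a False len by (simp add: nth_append attach_par_def)
        qed
        then show "edge_good (attach_par k par as) zs" using zh len by (simp add: edge_good_def)
      }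
    qed
  qed
  have "\<bar>(\<Sum>xs | xs \<in> homs par k \<and> good xs. \<Sum>p\<in>matching xs. fact j * real (card (hits p xs) choose j)) / (num_trees * card V)
     - card I ^ j * (k + j)\<bar>
    = \<bar>\<Sum>as\<in>indices j. (\<Sum>zs\<in>extended as. real (num_forests (set zs))) / (num_trees * card V) - (k + j)\<bar>"
    unfolding factorial_moment_eq by (simp add: sum_subtractf sum_divide_distrib card_indices)
  also have "\<dots> \<le> (\<Sum>as\<in>indices j. \<bar>(\<Sum>zs\<in>extended as. real (num_forests (set zs))) / (num_trees * card V) - (k + j)\<bar>)"
    by (rule sum_abs)
  also have "\<dots> \<le> (\<Sum>as\<in>indices j. mean_error (k + j) * tol)"
    using ext by (rule sum_mono)
  finally show ?thesis by (simp add: card_indices)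
qed

end

end

section \<open>Counting exact embeddings\<close>

context reg_graph
begin

lemma good_single: "good [x]"
  using tol by (simp add: good_def excess_def)

lemma good_Nil: "good []"
  by (simp add: good_def)

context
  fixes par :: "nat \<Rightarrow> nat" and k :: nat and I :: "nat set"
  assumes k: "k \<ge> 1" and t: "tree_order par k" and I: "I \<subseteq> {..<k}"
begin

definition bad_homs :: "(nat \<Rightarrow> nat) \<Rightarrow> nat \<Rightarrow> 'a list set" where
  "bad_homs par' l = {ys. ys \<in> homs par' (Suc l) \<and> distinct ys \<and> good (butlast ys) \<and> \<not> good ys}"

lemma finite_bad_homs [simp]: "finite (bad_homs par' l)"
  by (rule finite_subset[OF _ finite_homs[of par' "Suc l"]]) (auto simp: bad_homs_def)

abbreviation bad_pairs :: "(nat \<Rightarrow> nat) \<Rightarrow> nat \<Rightarrow> ('a list \<times> ('a \<Rightarrow> 'a)) set" where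
  "bad_pairs par' l \<equiv> SIGMA ys:bad_homs par' l. {p \<in> F {ys ! 0}. consistent par' p ys}"

lemma card_bad_homs_matching:
  assumes "l \<ge> 1" "tree_order par' (Suc l)"
  shows "real (card (bad_pairs par' l))
    \<le> bad_step_bound l * (num_trees * card V) * tol"
proof -
  have "card (bad_pairs par' l)
    = (\<Sum>ys\<in>bad_homs par' l. card {p \<in> F {ys ! 0}. consistent par' p ys})"
    by (rule card_SigmaI) auto
  also have "\<dots> = (\<Sum>ys\<in>bad_homs par' l. num_forests (set ys))"
    using assms by (intro sum.cong refl card_consistent) (auto simp: bad_homs_def)
  finally show ?thesis using bad_step[OF assms] by (simp add: bad_homs_def)
qed

definition good_homs :: "'a list set" where "good_homs = {xs. xs \<in> homs par k \<and> good xs}"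

lemma finite_good_homs [simp]: "finite good_homs"
  by (rule finite_subset[OF _ finite_homs[of par k]]) (auto simp: good_homs_def)

text \<open>If \<open>xs\<close> has a further child \<open>v\<close> below a vertex with index in
  \<open>I\<close> but no hit, then \<open>xs @ [v]\<close>, as a copy of the tree with one more
  leaf, stops being typical exactly at its last vertex. Choosing one such child maps the pairs
  injectively to \<open>bad_pairs\<close>, which \<open>bad_step\<close> controls.\<close>

lemma missed_hits:
  "real (card (SIGMA xs:good_homs. {p \<in> matching par xs. hits I p xs = {} \<and> \<not> exact I p xs}))
    \<le> card I * bad_step_bound k * (num_trees * card V) * tol"
proof -
  let ?D = "SIGMA xs:good_homs. {p \<in> matching par xs. hits I p xs = {} \<and> \<not> exact I p xs}"
  let ?T = "SIGMA a:I. bad_pairs (par(k := a)) k"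
  have fI: "finite I" using I finite_subset by blast
  have tt: "tree_order (par(k := a)) (Suc k)" if "a \<in> I" for a
    using t that I k by (auto simp: tree_order_def)
  have ex: "\<exists>a v. (a, xs @ [v], p) \<in> ?T" if D: "(xs, p) \<in> ?D" for xs p
  proof -
    have xs: "xs \<in> homs par k" "good xs" and p: "p \<in> F {xs ! 0}" "consistent par p xs"
      and h: "hits I p xs = {}" "\<not> exact I p xs"
      using D by (auto simp: good_homs_def matching_def[OF k t I])
    obtain v a where v: "v \<in> V" "v \<notin> set xs" "a \<in> I" "p v = xs ! a"
      using h(2) by (auto simp: exact_def[OF k t I])
    have len: "length xs = k" using xs by (simp add: homs_length)
    have ng: "\<not> good (xs @ [v])"
      using h(1) v by (auto simp: hits_def[OF k t I] good_exts_def[OF k t I])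
    have a: "a < k" using v I by auto
    have v0: "v \<noteq> xs ! 0" using v len k by (metis Suc_le_eq One_nat_def nth_mem)
    have hom: "xs @ [v] \<in> homs (par(k := a)) (Suc k)"
      using consistent_homs_snoc[OF p(1) xs(1) k t a v(1) v0 v(4)] .
    have "consistent (par(k := a)) p (xs @ [v])"
      unfolding consistent_def
    proof (intro allI impI)
      fix i assume i: "1 \<le> i \<and> i < length (xs @ [v])"
      show "p ((xs @ [v]) ! i) = (xs @ [v]) ! (par(k := a)) i"
      proof (cases "i = k")
        case True
        then show ?thesis using len a v by (simp add: nth_append)
      next
        case False
        then have ik: "i < k" using i len by simp
        then have "par i < k" using t i by (auto simp: tree_order_def intro: less_trans)
        then show ?thesis using ik i p(2) len by (simp add: consistent_def nth_append)
      qed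
    qed
    moreover have "distinct (xs @ [v])" using xs v by (simp add: good_def)
    moreover have "(xs @ [v]) ! 0 = xs ! 0" using len k by (simp add: nth_append)
    ultimately have "(a, xs @ [v], p) \<in> ?T"
      using v ng xs hom p by (auto simp: bad_homs_def)
    then show ?thesis by blast
  qed
  define f where "f = (\<lambda>(xs, p). (SOME z. z \<in> ?T \<and> (\<exists>a v. z = (a, xs @ [v], p))))"
  have f: "f (xs, p) \<in> ?T \<and> (\<exists>a v. f (xs, p) = (a, xs @ [v], p))" if "(xs, p) \<in> ?D" for xs p
    unfolding f_def prod.case by (rule someI_ex) (use ex[OF that] in blast)
  have "inj_on f ?D"
  proof (rule inj_onI)
    fix x y assume x: "x \<in> ?D" and y: "y \<in> ?D" and eq: "f x = f y"
    obtain xs p where x': "x = (xs, p)" by (cases x)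
    obtain ys q where y': "y = (ys, q)" by (cases y)
    obtain a v where fx: "f (xs, p) = (a, xs @ [v], p)" using f x unfolding x' by blast
    obtain b w where fy: "f (ys, q) = (b, ys @ [w], q)" using f y unfolding y' by blast
    show "x = y" using eq fx fy x' y' by simp
  qed
  moreover have "f ` ?D \<subseteq> ?T" using f by (metis (no_types, lifting) image_subsetI surj_pair)
  moreover have "finite ?T" using fI by (intro finite_SigmaI) auto
  ultimately have "card ?D \<le> card ?T" by (rule card_inj_on_le)
  also have "card ?T = (\<Sum>a\<in>I. card (bad_pairs (par(k := a)) k))"
    using fI by (intro card_SigmaI) auto
  also have "real \<dots> = (\<Sum>a\<in>I. real (card (bad_pairs (par(k := a)) k)))"
    by simp
  also have "\<dots> \<le> (\<Sum>a\<in>I. bad_step_bound k * (num_trees * card V) * tol)"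
    using tt by (intro sum_mono card_bad_homs_matching[OF k]) auto
  finally show ?thesis by (simp add: mult.assoc)
qed

text \<open>
  Every exact embedding is cut at the first index where it stops being good, and a spanning tree has at
  most \<open>s\<close> exact embeddings with a given root.
\<close>

lemma bad_exact:
  assumes s: "\<And>x p. x \<in> V \<Longrightarrow> p \<in> F {x} \<Longrightarrow>
    card {xs \<in> homs par k. distinct xs \<and> xs ! 0 = x \<and> consistent par p xs \<and> exact I p xs} \<le> s"
  shows "real (card (SIGMA xs:{xs \<in> homs par k. distinct xs \<and> \<not> good xs}. {p \<in> matching par xs. exact I p xs}))
    \<le> s * (\<Sum>i = 1..<k. bad_step_bound i) * (num_trees * card V) * tol"
proof -
  let ?D = "SIGMA xs:{xs \<in> homs par k. distinct xs \<and> \<not> good xs}. {p \<in> matching par xs. exact I p xs}"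
  let ?T = "SIGMA i:{1..<k}. bad_pairs par i"
  have tt: "tree_order par (Suc i)" if "i < k" for i using t that by (auto simp: tree_order_def)
  have fin: "finite ?T" by (intro finite_SigmaI) auto
  have finD: "finite ?D"
    by (intro finite_SigmaI finite_subset[OF _ finite_homs[of par k]]) (auto simp: matching_def[OF k t I])
  \<comment> \<open>The exact embeddings with the root and the parent function recorded in
    \<open>z\<close>; the hypothesis bounds their number by \<open>s\<close>, whatever the prefix in
    \<open>z\<close> is.\<close>
  let ?fib = "\<lambda>z. {(xs, p). xs \<in> homs par k \<and> distinct xs \<and> xs ! 0 = fst (snd z) ! 0
      \<and> p = snd (snd z) \<and> consistent par p xs \<and> exact I p xs}"
  have fib_eq: "?fib z = (\<lambda>xs. (xs, snd (snd z))) ` {xs \<in> homs par k. distinct xs \<and> xs ! 0 = fst (snd z) ! 0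
      \<and> consistent par (snd (snd z)) xs \<and> exact I (snd (snd z)) xs}" for z :: "nat \<times> 'a list \<times> ('a \<Rightarrow> 'a)"
    by auto
  have fib: "card (?fib z) \<le> s" if "z \<in> ?T" for z
  proof -
    have "fst (snd z) \<in> homs par (Suc (fst z))" using that by (auto simp: bad_homs_def)
    then have "fst (snd z) ! 0 \<in> V" by (rule homs_nth) simp
    moreover have "snd (snd z) \<in> F {fst (snd z) ! 0}" using that by auto
    ultimately show ?thesis unfolding fib_eq
      by (intro order.trans[OF card_image_le s]) (auto intro: finite_subset[OF _ finite_homs[of par k]])
  qed
  have "?D \<subseteq> (\<Union>z\<in>?T. ?fib z)"
  proof
    fix x assume x: "x \<in> ?D"
    obtain xs p where x': "x = (xs, p)" by (cases x)
    have xs: "xs \<in> homs par k" "distinct xs" "\<not> good xs" and p: "p \<in> F {xs ! 0}" "consistent par p xs" "exact I p xs"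
      using x x' by (auto simp: matching_def[OF k t I])
    have len: "length xs = k" using xs by (simp add: homs_length)
    \<comment> \<open>Prefixes of length 0 and 1 are always good, so goodness is first lost at a
      length \<open>Suc i\<close> with \<open>1 \<le> i\<close> and \<open>i < k\<close>.\<close>
    define j where "j = (LEAST j. \<not> good (take j xs))"
    have nk: "\<not> good (take k xs)" using xs len by simp
    have j: "\<not> good (take j xs)" unfolding j_def using nk by (rule LeastI)
    have jk: "j \<le> k" unfolding j_def using nk by (rule Least_le)
    have "j \<noteq> 0" using j good_Nil by (metis take0 take_0)
    moreover have "j \<noteq> 1"
    proof
      assume "j = 1"
      moreover have "take 1 xs = [xs ! 0]" using k len by (cases xs) auto
      ultimately show False using j good_single by simp
    qed
    ultimately obtain i where i: "j = Suc i" "1 \<le> i" by (cases j) auto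
    have gi: "good (take i xs)" using not_less_Least[of i "\<lambda>j. \<not> good (take j xs)"] i by (auto simp: j_def)
    let ?ys = "take (Suc i) xs"
    have ik: "i < k" using i jk by simp
    have nth: "?ys ! m = xs ! m" if "m < Suc i" for m using that by simp
    have par: "par m < m" if "1 \<le> m" "m < k" for m using t that by (simp add: tree_order_def)
    have "?ys \<in> homs par (Suc i)"
      using xs(1) ik len set_take_subset[of "Suc i" xs] par
      by (auto simp: homs_def) (metis less_Suc_eq_le less_imp_le_nat less_le_trans nth_take order_less_le_trans Suc_leI One_nat_def)
    moreover have "butlast ?ys = take i xs" using ik len by (simp add: butlast_take)
    moreover have "consistent par p ?ys"
      unfolding consistent_def
    proof (intro allI impI)
      fix m assume m: "1 \<le> m \<and> m < length ?ys"
      then have "m < k" "m < Suc i" using ik len by auto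
      moreover have "par m < Suc i" using par[of m] m \<open>m < k\<close> \<open>m < Suc i\<close> by linarith
      ultimately show "p (?ys ! m) = ?ys ! par m" using m p(2) len by (simp add: consistent_def)
    qed
    ultimately have "(i, ?ys, p) \<in> ?T"
      using i ik xs(2) gi j p by (auto simp: bad_homs_def)
    moreover have "x \<in> ?fib (i, ?ys, p)" using x' xs p by simp
    ultimately show "x \<in> (\<Union>z\<in>?T. ?fib z)" by (rule UN_I)
  qed
  moreover have "finite (\<Union>z\<in>?T. ?fib z)"
    unfolding fib_eq by (intro finite_UN_I fin finite_imageI finite_subset[OF _ finite_homs[of par k]]) auto
  ultimately have "card ?D \<le> card (\<Union>z\<in>?T. ?fib z)" by (intro card_mono)
  also have "\<dots> \<le> (\<Sum>z\<in>?T. card (?fib z))" by (rule card_UN_le[OF fin])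
  also have "\<dots> \<le> (\<Sum>z\<in>?T. s)" using fib by (rule sum_mono)
  also have "\<dots> = card ?T * s" by simp
  finally have "card ?D \<le> card ?T * s" .
  then have "real (card ?D) \<le> real (card ?T * s)" by (rule of_nat_mono)
  also have "\<dots> = real (card ?T) * real s" by (rule of_nat_mult)
  also have "\<dots> \<le> ((\<Sum>i = 1..<k. bad_step_bound i) * (num_trees * card V) * tol) * s"
  proof (intro mult_right_mono)
    have "card ?T = (\<Sum>i = 1..<k. card (bad_pairs par i))"
      by (intro card_SigmaI) auto
    then have "real (card ?T) = (\<Sum>i = 1..<k. real (card (bad_pairs par i)))"
      by simp
    also have "\<dots> \<le> (\<Sum>i = 1..<k. bad_step_bound i * (num_trees * card V) * tol)"
      using tt by (intro sum_mono card_bad_homs_matching) auto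
    finally show "real (card ?T) \<le> (\<Sum>i = 1..<k. bad_step_bound i) * (num_trees * card V) * tol"
      by (simp add: sum_distrib_right)
  qed simp
  finally show ?thesis by (simp add: mult_ac)
qed

definition exact_pairs :: "('a list \<times> ('a \<Rightarrow> 'a)) set" where
  "exact_pairs = (SIGMA xs:{xs \<in> homs par k. distinct xs}. {p \<in> matching par xs. exact I p xs})"

text \<open>On typical copies the Bonferroni inequalities are summed over all \<open>p\<close>
  containing the copy. The first error term is the truncation at \<open>J\<close> and is independent
  of \<open>d\<close>; the coefficient of \<open>tol\<close> collects the moment errors up to order
  \<open>Suc J\<close>, the missed hits and the exact copies that are not typical.\<close>

lemma exact_pairs_approx:
  fixes m :: real
  assumes s: "\<And>x p. x \<in> V \<Longrightarrow> p \<in> F {x} \<Longrightarrow>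
    card {xs \<in> homs par k. distinct xs \<and> xs ! 0 = x \<and> consistent par p xs \<and> exact I p xs} \<le> s"
    and m_def: "m = real (card I)"
  shows "\<bar>real (card exact_pairs) / (num_trees * card V) - (\<Sum>j\<le>J. (-1) ^ j * (m ^ j * (k + j) / fact j))\<bar>
    \<le> m ^ Suc J * (k + Suc J) / fact (Suc J)
      + ((\<Sum>j\<le>Suc J. m ^ j * mean_error (k + j) / fact j) + m * bad_step_bound k
         + s * (\<Sum>i = 1..<k. bad_step_bound i)) * tol"
proof -
  let ?G = "{xs. xs \<in> homs par k \<and> good xs}"
  let ?B = "{xs \<in> homs par k. distinct xs \<and> \<not> good xs}"
  let ?X = "\<lambda>xs. {p \<in> matching par xs. exact I p xs}"
  let ?M = "\<lambda>xs. {p \<in> matching par xs. hits I p xs = {} \<and> \<not> exact I p xs}"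
  let ?XG = "Sigma ?G ?X" and ?Xb = "Sigma ?B ?X"
  let ?ch = "\<lambda>xs p j. real (card (hits I p xs) choose j)"
  define tn where "tn = num_trees * card V"
  have tn: "tn > 0" unfolding tn_def using num_trees_pos V_nonempty by (simp add: card_gt_0_iff)
  define M where "M j = (\<Sum>xs\<in>?G. \<Sum>p\<in>matching par xs. fact j * ?ch xs p j) / tn" for j
  have M: "\<bar>M j - m ^ j * (k + j)\<bar> \<le> m ^ j * mean_error (k + j) * tol" for j
    using factorial_moment[OF k t I, of j] unfolding M_def m_def tn_def by simp
  define A where "A = (\<Sum>xs\<in>?G. \<Sum>p\<in>matching par xs. of_bool (card (hits I p xs) = 0) :: real) / tn"
  define XG where "XG = real (card ?XG)"
  define Xb where "Xb = real (card ?Xb)"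
  define m1 where "m1 = real (card (SIGMA xs:good_homs. ?M xs))"
  have fc: "finite (matching par xs)" for xs by (rule finite_matching[OF k t I])
  have fG: "finite ?G" by (rule finite_subset[OF _ finite_homs[of par k]]) auto
  have fB: "finite ?B" by (rule finite_subset[OF _ finite_homs[of par k]]) auto
  have X: "real (card exact_pairs) = XG + Xb"
  proof -
    have "exact_pairs = ?XG
      \<union> ?Xb"
      by (auto simp: exact_pairs_def good_def)
    then have "card exact_pairs = card ?XG
      + card ?Xb"
      using fG fB fc by (simp only:) (intro card_Un_disjoint finite_SigmaI; auto)
    then show ?thesis by (simp add: XG_def Xb_def)
  qed
  have A: "A * tn = XG + m1"
  proof -
    have fh: "finite (hits I p xs)" for p xs by (rule finite_hits[OF k t I])
    have sub: "hits I p xs = {}" if "exact I p xs" for p xs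
      using that good_exts_notin[OF k t I, of _ xs] by (auto simp: exact_def[OF k t I] hits_def[OF k t I] good_exts_def[OF k t I])
    have "A * tn = (\<Sum>xs\<in>?G. \<Sum>p\<in>matching par xs. of_bool (hits I p xs = {}))"
      using tn fh by (simp add: A_def)
    also have "\<dots> = (\<Sum>xs\<in>?G. real (card (?X xs))+ real (card (?M xs)))"
    proof (rule sum.cong[OF refl])
      fix xs
      have "(\<Sum>p\<in>matching par xs. of_bool (hits I p xs = {}) :: real)
        = (\<Sum>p\<in>matching par xs. of_bool (exact I p xs) + of_bool (hits I p xs = {} \<and> \<not> exact I p xs))"
        using sub by (intro sum.cong refl) auto
      also have "\<dots> = real (card (?X xs))
        + real (card (?M xs))"
        using fc[of xs] by (simp only: sum.distrib) (simp add: Int_def)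
      finally show "(\<Sum>p\<in>matching par xs. of_bool (hits I p xs = {}) :: real)
        = real (card (?X xs))
        + real (card (?M xs))" .
    qed
    also have "\<dots> = XG + m1"
      unfolding XG_def m1_def good_homs_def using fG fc by (simp add: sum.distrib card_SigmaI)
    finally show ?thesis .
  qed
  have "m1 / tn \<le> m * bad_step_bound k * tol"
    using missed_hits[folded tn_def] tn unfolding m1_def m_def by (simp add: divide_le_eq mult_ac)
  moreover have "Xb / tn \<le> s * (\<Sum>i = 1..<k. bad_step_bound i) * tol"
    using bad_exact[OF s, folded tn_def] tn unfolding Xb_def by (simp add: divide_le_eq mult_ac)
  \<comment> \<open>Having no hits overcounts exactness by the missed hits \<open>m1\<close>, and
    \<open>A\<close> omits the exact copies \<open>Xb\<close> that are not typical.\<close>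
  moreover have "real (card exact_pairs) / tn = A - m1 / tn + Xb / tn"
  proof -
    have "XG = A * tn - m1" using A by simp
    then show ?thesis using tn unfolding X by (simp add: add_divide_distrib diff_divide_distrib)
  qed
  moreover have "m1 / tn \<ge> 0" "Xb / tn \<ge> 0" using tn by (auto simp: m1_def Xb_def)
  ultimately have 1: "\<bar>real (card exact_pairs) / tn - A\<bar>
    \<le> m * bad_step_bound k * tol + s * (\<Sum>i = 1..<k. bad_step_bound i) * tol"
    by linarith
  have Mj: "M j / fact j = (\<Sum>xs\<in>?G. \<Sum>p\<in>matching par xs. ?ch xs p j) / tn" for j
    unfolding M_def by (simp flip: sum_distrib_left)
  have 2: "\<bar>A - (\<Sum>j\<le>J. (-1) ^ j * (M j / fact j))\<bar> \<le> M (Suc J) / fact (Suc J)"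
  proof -
    have "(\<Sum>j\<le>J. (-1) ^ j * (M j / fact j))
      = (\<Sum>xs\<in>?G. \<Sum>p\<in>matching par xs. \<Sum>j\<le>J. (-1) ^ j * ?ch xs p j) / tn"
    proof -
      have "(\<Sum>j\<le>J. (-1) ^ j * (M j / fact j))
        = (\<Sum>j\<le>J. \<Sum>xs\<in>?G. \<Sum>p\<in>matching par xs. (-1) ^ j * ?ch xs p j) / tn"
        unfolding Mj by (simp add: sum_divide_distrib sum_distrib_left)
      also have "(\<Sum>j\<le>J. \<Sum>xs\<in>?G. \<Sum>p\<in>matching par xs. (-1) ^ j * ?ch xs p j)
        = (\<Sum>xs\<in>?G. \<Sum>j\<le>J. \<Sum>p\<in>matching par xs. (-1) ^ j * ?ch xs p j)"
        by (rule sum.swap)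
      also have "\<dots> = (\<Sum>xs\<in>?G. \<Sum>p\<in>matching par xs. \<Sum>j\<le>J. (-1) ^ j * ?ch xs p j)"
        by (intro sum.cong refl sum.swap)
      finally show ?thesis .
    qed
    then have eq: "A - (\<Sum>j\<le>J. (-1) ^ j * (M j / fact j))
      = (\<Sum>xs\<in>?G. \<Sum>p\<in>matching par xs. of_bool (card (hits I p xs) = 0)
          - (\<Sum>j\<le>J. (-1) ^ j * ?ch xs p j)) / tn"
      unfolding A_def by (simp only: sum_subtractf diff_divide_distrib)
    have "\<bar>\<Sum>xs\<in>?G. \<Sum>p\<in>matching par xs. of_bool (card (hits I p xs) = 0)
          - (\<Sum>j\<le>J. (-1) ^ j * ?ch xs p j)\<bar>
        \<le> (\<Sum>xs\<in>?G. \<Sum>p\<in>matching par xs. ?ch xs p (Suc J))"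
      by (intro order.trans[OF sum_abs] sum_mono abs_of_bool_minus_alternating)
    then have "\<bar>A - (\<Sum>j\<le>J. (-1) ^ j * (M j / fact j))\<bar>
      \<le> (\<Sum>xs\<in>?G. \<Sum>p\<in>matching par xs. ?ch xs p (Suc J)) / tn"
      unfolding eq abs_divide abs_of_pos[OF tn] using tn by (intro divide_right_mono) auto
    also have "\<dots> = M (Suc J) / fact (Suc J)" unfolding Mj ..
    finally show ?thesis .
  qed
  have Mf: "\<bar>M j / fact j - m ^ j * (k + j) / fact j\<bar> \<le> m ^ j * mean_error (k + j) / fact j * tol" for j
  proof -
    have "\<bar>M j / fact j - m ^ j * (k + j) / fact j\<bar> = \<bar>M j - m ^ j * (k + j)\<bar> / fact j"
      unfolding diff_divide_distrib[symmetric] abs_divide by simp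
    also have "\<dots> \<le> m ^ j * mean_error (k + j) * tol / fact j"
      by (intro divide_right_mono M) simp
    finally show ?thesis by simp
  qed
  have 3: "\<bar>(\<Sum>j\<le>J. (-1) ^ j * (M j / fact j)) - (\<Sum>j\<le>J. (-1) ^ j * (m ^ j * (k + j) / fact j))\<bar>
    \<le> (\<Sum>j\<le>J. m ^ j * mean_error (k + j) / fact j * tol)"
  proof -
    have eq: "(\<Sum>j\<le>J. (-1) ^ j * (M j / fact j)) - (\<Sum>j\<le>J. (-1) ^ j * (m ^ j * (k + j) / fact j))
      = (\<Sum>j\<le>J. (-1) ^ j * (M j / fact j - m ^ j * (k + j) / fact j))"
      by (simp only: sum_subtractf[symmetric] right_diff_distrib)
    have abs1: "\<bar>(-1) ^ j * y\<bar> = \<bar>y\<bar>" for y :: real and j :: nat by (simp add: abs_mult)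
    show ?thesis
      unfolding eq by (rule order.trans[OF sum_abs]) (intro sum_mono, simp only: abs1 Mf)
  qed
  have "M (Suc J) / fact (Suc J) \<le> m ^ Suc J * (k + Suc J) / fact (Suc J)
      + m ^ Suc J * mean_error (k + Suc J) / fact (Suc J) * tol"
    using Mf[of "Suc J"] by linarith
  then have "\<bar>real (card exact_pairs) / tn - (\<Sum>j\<le>J. (-1) ^ j * (m ^ j * (k + j) / fact j))\<bar>
    \<le> m ^ Suc J * (k + Suc J) / fact (Suc J)
      + (\<Sum>j\<le>Suc J. m ^ j * mean_error (k + j) / fact j * tol)
      + m * bad_step_bound k * tol + s * (\<Sum>i = 1..<k. bad_step_bound i) * tol"
    using 1 2 3 unfolding sum.atMost_Suc by linarith
  then show ?thesis by (simp only: distrib_right sum_distrib_right add.assoc tn_def)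
qed

end

end

section \<open>Spanning trees as parent functions\<close>

text \<open>The condition \<open>a \<noteq> b\<close> removes the loop at the root, which is a fixed
  point of \<open>p\<close>.\<close>

definition tree_of :: "'a set \<Rightarrow> ('a \<Rightarrow> 'a) \<Rightarrow> 'a pair_pre_digraph" where
  "tree_of V p = \<lparr>pverts = V, parcs = {(a, b). a \<in> V \<and> b \<in> V \<and> a \<noteq> b \<and> (p a = b \<or> p b = a)}\<rparr>"

lemma tree_of_simps [simp]:
  "pverts (tree_of V p) = V"
  "(a, b) \<in> parcs (tree_of V p) \<longleftrightarrow> a \<in> V \<and> b \<in> V \<and> a \<noteq> b \<and> (p a = b \<or> p b = a)"
  by (auto simp: tree_of_def)

definition depth :: "('a \<Rightarrow> 'a) \<Rightarrow> 'a \<Rightarrow> 'a \<Rightarrow> nat" where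
  "depth p x v = (LEAST i. (p ^^ i) v = x)"

definition nbrs :: "'a pair_pre_digraph \<Rightarrow> 'a \<Rightarrow> 'a set" where
  "nbrs G v = {w. (v, w) \<in> parcs G}"

lemma rooted_forests_mono:
  assumes "p \<in> rooted_forests V N S" "\<And>v. v \<in> V \<Longrightarrow> N v \<subseteq> N' v"
  shows "p \<in> rooted_forests V N' S"
  using assms unfolding rooted_forests_def by auto

text \<open>Breadth-first tree: every vertex chooses as its parent a neighbour strictly closer to
  \<open>x\<close>, so the iteration ends at \<open>x\<close>.\<close>

lemma connected_rooted_forest:
  assumes conn: "\<And>v. v \<in> V \<Longrightarrow> (v, x) \<in> r\<^sup>*" and r: "r \<subseteq> V \<times> V" and x: "x \<in> V"
  shows "\<exists>p. p \<in> rooted_forests V (\<lambda>v. {w. (v, w) \<in> r}) {x}"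
proof -
  define dst where "dst v = (LEAST n. (v, x) \<in> r ^^ n)" for v
  have dst: "(v, x) \<in> r ^^ dst v" if v: "v \<in> V" for v
  proof -
    obtain n where "(v, x) \<in> r ^^ n" using rtrancl_imp_relpow[OF conn[OF v]] by auto
    then show ?thesis unfolding dst_def by (rule LeastI)
  qed
  have step: "\<exists>w. (v, w) \<in> r \<and> dst w < dst v" if v: "v \<in> V" "v \<noteq> x" for v
  proof -
    obtain m where m: "dst v = Suc m" using dst[OF v(1)] v(2) by (cases "dst v") auto
    have "(v, x) \<in> r ^^ Suc m" using dst[OF v(1)] unfolding m .
    then have "\<exists>w. (v, w) \<in> r \<and> (w, x) \<in> r ^^ m" by (rule relpow_Suc_D2)
    then obtain w where w: "(v, w) \<in> r" "(w, x) \<in> r ^^ m" by blast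
    have "dst w \<le> m" unfolding dst_def using w(2) by (rule Least_le)
    then show ?thesis using w m by auto
  qed
  define p where "p v = (if v \<in> V \<and> v \<noteq> x then (SOME w. (v, w) \<in> r \<and> dst w < dst v) else v)" for v
  have p: "(v, p v) \<in> r" "dst (p v) < dst v" if v: "v \<in> V" "v \<noteq> x" for v
    using someI_ex[OF step[OF v]] v by (auto simp: p_def)
  have "leads p v x" if "v \<in> V" for v
    using that
  proof (induction "dst v" arbitrary: v rule: less_induct)
    case less
    show ?case
    proof (cases "v = x")
      case False
      have "p v \<in> V" using p(1)[OF less.prems False] r by auto
      then have "leads p (p v) x" using less.hyps[OF p(2)[OF less.prems False]] by simp
      then show ?thesis by (rule leads_step)
    qed simp
  qed
  then have "p \<in> rooted_forests V (\<lambda>v. {w. (v, w) \<in> r}) {x}"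
    using p by (intro rooted_forestsI) (auto simp: p_def)
  then show ?thesis by blast
qed

text \<open>Every neighbourhood is taken to be \<open>V\<close>, so that the locale covers parent
  functions in any ambient graph and also the fixed tree \<open>T\<close>.\<close>

locale rooted_tree =
  fixes V :: "'a set" and x :: 'a and p :: "'a \<Rightarrow> 'a"
  assumes finite_V: "finite V" and root_in: "x \<in> V" and forest: "p \<in> rooted_forests V (\<lambda>_. V) {x}"
begin

lemma parent_root: "p x = x"
  by (rule rooted_forestsD(1)[OF forest]) simp

lemma parent_in: "v \<in> V \<Longrightarrow> p v \<in> V"
  using rooted_forestsD(2)[OF forest, of v] parent_root root_in by (cases "v = x") auto

lemma reaches_root: "v \<in> V \<Longrightarrow> leads p v x"
  using rooted_forestsD(3)[OF forest, of v] by simp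

lemma parent_ne: "v \<in> V \<Longrightarrow> v \<noteq> x \<Longrightarrow> p v \<noteq> v"
  using reaches_root[of v] leads_fixed[of p v x] by auto

abbreviation dep where "dep \<equiv> depth p x"

lemma depth_root [simp]: "dep x = 0"
  unfolding depth_def by (rule Least_eq_0) simp

lemma depth_Suc: "v \<in> V \<Longrightarrow> v \<noteq> x \<Longrightarrow> dep v = Suc (dep (p v))"
proof -
  assume v: "v \<in> V" "v \<noteq> x"
  have "\<exists>i. (p ^^ i) v = x" using reaches_root[OF v(1)] by (simp add: leads_def)
  then obtain i where i: "(p ^^ i) v = x" by auto
  have "(LEAST i. (p ^^ i) v = x) = Suc (LEAST i. (p ^^ Suc i) v = x)"
    by (rule Least_Suc[of _ i]) (use i v in auto)
  then show ?thesis by (simp only: depth_def funpow_Suc_right o_apply)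
qed

lemma depth_eq_0: "v \<in> V \<Longrightarrow> dep v = 0 \<longleftrightarrow> v = x"
  using depth_Suc by (cases "v = x") auto

lemma depth_induct [consumes 1, case_names root step]:
  assumes "v \<in> V" and "P x" and "\<And>v. v \<in> V \<Longrightarrow> v \<noteq> x \<Longrightarrow> P (p v) \<Longrightarrow> P v"
  shows "P v"
  using assms(1)
proof (induction "dep v" arbitrary: v rule: less_induct)
  case less
  show ?case
  proof (cases "v = x")
    case False
    then show ?thesis using less parent_in depth_Suc assms(3) by auto
  qed (simp add: assms(2))
qed

lemma adj_cases:
  assumes "(a, b) \<in> parcs (tree_of V p)"
  obtains "p a = b" "dep a = Suc (dep b)" "a \<noteq> x" | "p b = a" "dep b = Suc (dep a)" "b \<noteq> x"
proof -
  have h: "a \<in> V" "b \<in> V" "a \<noteq> b" "p a = b \<or> p b = a" using assms by auto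
  show thesis
  proof (cases "p a = b")
    case True
    then have "a \<noteq> x" using h parent_root by auto
    then show thesis using True depth_Suc[of a] h by (intro that(1)) auto
  next
    case False
    then have "p b = a" using h by simp
    moreover from this have "b \<noteq> x" using h parent_root by auto
    ultimately show thesis using depth_Suc[of b] h by (intro that(2)) auto
  qed
qed

lemma adj_parent: "v \<in> V \<Longrightarrow> v \<noteq> x \<Longrightarrow> (v, p v) \<in> parcs (tree_of V p) \<and> (p v, v) \<in> parcs (tree_of V p)"
  using parent_in parent_ne parent_ne[THEN not_sym] by auto

lemma tree_pair_graph: "pair_graph (tree_of V p)"
proof -
  have "parcs (tree_of V p) \<subseteq> V \<times> V" by (auto simp: tree_of_def)
  then have "finite (parcs (tree_of V p))" using finite_V finite_subset by blast
  then show ?thesis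
    using finite_V
    by unfold_locales (auto simp: tree_of_def symmetric_def sym_def)
qed

end

sublocale rooted_tree \<subseteq> T: pair_graph "tree_of V p"
  by (rule tree_pair_graph)

context rooted_tree
begin

lemma walk_to_root:
  assumes "v \<in> V"
  shows "\<exists>q. T.awalk x q v \<and> length q = dep v"
  using assms
proof (induction rule: depth_induct)
  case root
  have "T.awalk x [] x" using root_in by (simp add: T.awalk_Nil_iff)
  then show ?case by (intro exI[of _ "[]"]) simp
next
  case (step v)
  then obtain q where q: "T.awalk x q (p v)" "length q = dep (p v)" by auto
  have "T.awalk (p v) [(p v, v)] v"
    using adj_parent[OF step(1,2)] step(1) by (simp add: T.awalk_simps)
  then have "T.awalk x (q @ [(p v, v)]) v" using q(1) by (rule T.awalk_appendI[rotated])
  then show ?case using q(2) depth_Suc[OF step(1,2)] by (intro exI[of _ "q @ [(p v, v)]"]) simp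
qed

text \<open>Depth changes by exactly one along every arc, so no walk from the root beats the path of
  parents.\<close>

lemma walk_length_ge:
  assumes "T.awalk u q v"
  shows "dep v \<le> dep u + length q"
  using assms
proof (induction q arbitrary: u)
  case Nil
  then show ?case by (simp add: T.awalk_Nil_iff)
next
  case (Cons e q)
  obtain a b where e: "e = (a, b)" by (cases e)
  then have "(a, b) \<in> parcs (tree_of V p)" "a = u" "T.awalk b q v"
    using Cons.prems by (auto simp: T.awalk_Cons_iff)
  moreover have "dep b \<le> Suc (dep a)" using calculation(1) by (rule adj_cases) auto
  ultimately show ?case using Cons.IH[of b] by simp
qed

lemma awalk_cost_one: "T.awalk_cost (\<lambda>_. 1) q = real (length q)"
  by (induction q) auto

lemma graph_dist_root:
  assumes "v \<in> V"
  shows "graph_dist (tree_of V p) x v = ereal (real (dep v))"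
proof -
  obtain q where q: "T.awalk x q v" "length q = dep v" using walk_to_root[OF assms] by auto
  have "T.\<mu> (\<lambda>_. 1) x v = ereal (real (dep v))"
  proof (rule antisym)
    show "T.\<mu> (\<lambda>_. 1) x v \<le> ereal (real (dep v))"
      using T.min_cost_le_walk_cost[OF q(1), of "\<lambda>_. 1"] q(2) by (simp add: awalk_cost_one)
    show "ereal (real (dep v)) \<le> T.\<mu> (\<lambda>_. 1) x v"
      unfolding T.\<mu>_def awalk_cost_one using walk_length_ge[of x _ v] by (intro INF_greatest) auto
  qed
  then show ?thesis by (simp add: graph_dist_def)
qed

lemma reachable_all: "u \<in> V \<Longrightarrow> v \<in> V \<Longrightarrow> u \<rightarrow>\<^sup>*\<^bsub>with_proj (tree_of V p)\<^esub> v"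
proof -
  assume u: "u \<in> V" and v: "v \<in> V"
  obtain q where "T.awalk x q u" using walk_to_root[OF u] by auto
  moreover obtain q' where "T.awalk x q' v" using walk_to_root[OF v] by auto
  ultimately have "T.awalk u (rev_path q) x" "T.awalk x q' v" by simp_all
  then have "T.awalk u (rev_path q @ q') v" by (rule T.awalk_appendI)
  then show ?thesis by (rule T.reachable_awalkI)
qed

lemma tree_connected: "Digraph_Component.connected (with_proj (tree_of V p))"
  unfolding connected_def strongly_connected_def
  using root_in reachable_all T.reachable_mk_symmetric_eq[OF T.pair_sym_arcs] by auto

lemma cas_nth:
  "pcas u c v \<Longrightarrow> c \<noteq> [] \<Longrightarrow> fst (c ! 0) = u \<and> snd (last c) = v \<and> (\<forall>i. Suc i < length c \<longrightarrow> snd (c ! i) = fst (c ! Suc i))"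
proof (induction c arbitrary: u)
  case (Cons e c)
  show ?case
  proof (cases "c = []")
    case False
    then have IH: "fst (c ! 0) = snd e" "snd (last c) = v" "\<forall>i. Suc i < length c \<longrightarrow> snd (c ! i) = fst (c ! Suc i)"
      using Cons by auto
    have "snd ((e # c) ! i) = fst ((e # c) ! Suc i)" if "Suc i < length (e # c)" for i
      using IH that by (cases i) auto
    then show ?thesis using IH Cons.prems False by auto
  qed (use Cons in auto)
qed simp

text \<open>At a deepest vertex of the cycle both cyclic neighbours must be its parent and hence
  coincide; in a cycle with at least three arcs they are distinct.\<close>

lemma tree_acyclic: "\<not> (\<exists>c. T.cycle c \<and> length c \<ge> 3)"
proof
  assume "\<exists>c. T.cycle c \<and> length c \<ge> 3"
  then obtain c u where c: "T.awalk u c u" "distinct (tl (pawalk_verts u c))" "length c \<ge> 3"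
    by (auto simp: T.cycle_def)
  let ?L = "length c" and ?W = "\<lambda>i. snd (c ! i)"
  have ne: "c \<noteq> []" using c(3) by auto
  have cas: "pcas u c u" and arcs: "set c \<subseteq> parcs (tree_of V p)" using c(1) by (auto simp: T.awalk_def)
  have "tl (pawalk_verts u c) = map snd c"
    using T.awalk_verts_conv'[of u c u] cas ne by simp
  then have dist: "?W i = ?W j \<longleftrightarrow> i = j" if "i < ?L" "j < ?L" for i j
    using c(2) nth_eq_iff_index_eq[of "map snd c" i j] that by simp
  \<comment> \<open>Cyclic predecessor and successor of an index; arc \<open>i\<close> runs from
    \<open>?W (pr i)\<close> to \<open>?W i\<close>.\<close>
  define pr where "pr i = (if i = 0 then ?L - 1 else i - 1)" for i :: nat
  define nx where "nx i = (if i = ?L - 1 then 0 else Suc i)" for i :: nat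
  have fst_eq: "fst (c ! i) = ?W (pr i)" if "i < ?L" for i
    using cas_nth[OF cas ne] that ne by (cases i) (auto simp: pr_def last_conv_nth)
  obtain i where i: "i < ?L" "\<And>j. j < ?L \<Longrightarrow> dep (?W j) \<le> dep (?W i)"
  proof -
    have "Max ((\<lambda>j. dep (?W j)) ` {..<?L}) \<in> (\<lambda>j. dep (?W j)) ` {..<?L}"
      using ne by (intro Max_in) auto
    then obtain i where "i < ?L" "dep (?W i) = Max ((\<lambda>j. dep (?W j)) ` {..<?L})" by auto
    then show ?thesis by (intro that[of i]) auto
  qed
  have nxL: "nx i < ?L" and prL: "pr i < ?L" and prnx: "pr (nx i) = i" and neq: "pr i \<noteq> nx i"
    using i(1) c(3) by (auto simp: nx_def pr_def)
  have "(?W (pr i), ?W i) \<in> parcs (tree_of V p)"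
  proof -
    have "c ! i \<in> parcs (tree_of V p)" using arcs i(1) nth_mem by blast
    then show ?thesis unfolding fst_eq[OF i(1), symmetric] by (simp only: prod.collapse)
  qed
  then have 1: "p (?W i) = ?W (pr i)"
    by (rule adj_cases) (use i(2)[OF prL] in auto)
  have "(?W i, ?W (nx i)) \<in> parcs (tree_of V p)"
  proof -
    have "c ! nx i \<in> parcs (tree_of V p)" using arcs nxL nth_mem by blast
    moreover have "c ! nx i = (?W i, ?W (nx i))"
      using fst_eq[OF nxL] prnx by (intro prod_eqI) simp_all
    ultimately show ?thesis by (simp only:)
  qed
  then have 2: "p (?W i) = ?W (nx i)"
    by (rule adj_cases) (use i(2)[OF nxL] in auto)
  show False using 1 2 dist[OF prL nxL] neq by simp
qed

lemma undirected_tree_of: "undirected_tree (tree_of V p)"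
  unfolding undirected_tree_def using tree_pair_graph tree_connected tree_acyclic by blast

text \<open>Induction from the root. If the edge between \<open>v\<close> and \<open>p v\<close>
  were not the parent edge of \<open>v\<close> for \<open>q\<close>, then
  \<open>q (p v) = v\<close>, hence \<open>p (p v) = v\<close> by induction, which contradicts the
  depths.\<close>

lemma tree_of_inject:
  assumes q: "rooted_tree V x q" and eq: "tree_of V p = tree_of V q"
  shows "p = q"
proof
  interpret Q: rooted_tree V x q by (rule q)
  have arcs: "(a, b) \<in> parcs (tree_of V p) \<longleftrightarrow> (a, b) \<in> parcs (tree_of V q)" for a b using eq by simp
  fix v
  show "p v = q v"
  proof (cases "v \<in> V")
    case True
    then show ?thesis
    proof (induction rule: depth_induct)
      case root
      show ?case using parent_root Q.parent_root by simp
    next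
      case (step v)
      have "(v, p v) \<in> parcs (tree_of V q)" using adj_parent[OF step(1,2)] arcs by blast
      then consider "q v = p v" | "q (p v) = v" by auto
      then show ?case
      proof cases
        case 2
        then have pp: "p (p v) = v" using step by simp
        have "p v \<noteq> x" using pp parent_root step(2) by auto
        then have "dep v = Suc (Suc (dep v))"
          using depth_Suc[OF step(1,2)] depth_Suc[of "p v"] parent_in[OF step(1)] pp by simp
        then show ?thesis by simp
      qed simp
    qed
  next
    case False
    then show ?thesis using rooted_forestsD(1)[OF forest, of v] rooted_forestsD(1)[OF Q.forest, of v] by simp
  qed
qed

end

section \<open>Parent functions and the spanning trees of a graph\<close>

lemma connected_reachable:
  assumes G: "pair_graph G" and "Digraph_Component.connected (with_proj G)" "u \<in> pverts G" "v \<in> pverts G"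
  shows "u \<rightarrow>\<^sup>*\<^bsub>with_proj G\<^esub> v"
proof -
  interpret pair_graph G by (rule G)
  show ?thesis
    using assms reachable_mk_symmetric_eq[OF pair_sym_arcs, of u v]
    by (auto simp: connected_def strongly_connected_def)
qed

lemma connected_parent_function:
  assumes G: "pair_graph G" and conn: "Digraph_Component.connected (with_proj G)" and x: "x \<in> pverts G"
  shows "\<exists>p. p \<in> rooted_forests (pverts G) (nbrs G) {x}"
proof -
  interpret pair_graph G by (rule G)
  have "(v, x) \<in> (parcs G)\<^sup>*" if "v \<in> pverts G" for v
  proof -
    have "(v, x) \<in> rtrancl_on (pverts G) (parcs G)"
      using connected_reachable[OF G conn that x] by (simp add: reachable_def)
    then show ?thesis by (induction rule: rtrancl_on_induct) auto
  qed
  moreover have "parcs G \<subseteq> pverts G \<times> pverts G" using in_arcsD1 in_arcsD2 by auto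
  ultimately show ?thesis
    using connected_rooted_forest[of "pverts G" x "parcs G"] x by (simp add: nbrs_def[abs_def])
qed

lemma rooted_tree_forest:
  assumes "pair_graph G" "x \<in> pverts G" "p \<in> rooted_forests (pverts G) (nbrs G) {x}"
  shows "rooted_tree (pverts G) x p"
proof -
  interpret G: pair_graph G by fact
  have "p \<in> rooted_forests (pverts G) (\<lambda>_. pverts G) {x}"
    using assms(3) by (rule rooted_forests_mono) (auto simp: nbrs_def dest: G.in_arcsD2)
  then show ?thesis using G.pair_finite_verts assms(2) by unfold_locales
qed

lemma parcs_tree_of_subset:
  assumes G: "pair_graph G" and x: "x \<in> pverts G" and p: "p \<in> rooted_forests (pverts G) (nbrs G) {x}"
  shows "parcs (tree_of (pverts G) p) \<subseteq> parcs G"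
proof
  interpret G: pair_graph G by (rule G)
  interpret P: rooted_tree "pverts G" x p by (rule rooted_tree_forest[OF G x p])
  fix e assume e: "e \<in> parcs (tree_of (pverts G) p)"
  obtain a b where ab: "e = (a, b)" by (cases e)
  have par: "(v, p v) \<in> parcs G" if "v \<in> pverts G" "v \<noteq> x" for v
    using rooted_forestsD(2)[OF p] that by (auto simp: nbrs_def)
  have "(a, b) \<in> parcs (tree_of (pverts G) p)" using e ab by simp
  then show "e \<in> parcs G" unfolding ab
  proof (rule P.adj_cases)
    assume "p a = b" "a \<noteq> x"
    then show "(a, b) \<in> parcs G" using par[of a] e ab by simp
  next
    assume "p b = a" "b \<noteq> x"
    then have "(b, a) \<in> parcs G" using par[of b] e ab by simp
    then show "(a, b) \<in> parcs G" by (rule G.arcs_symmetric)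
  qed
qed

text \<open>
  An edge outside the tree of parent edges would close a cycle with the path in that tree between its
  endpoints.
\<close>

lemma undirected_treeE:
  assumes T: "undirected_tree \<Gamma>" and x: "x \<in> pverts \<Gamma>"
  obtains p where "p \<in> rooted_forests (pverts \<Gamma>) (nbrs \<Gamma>) {x}" "\<Gamma> = tree_of (pverts \<Gamma>) p"
    "rooted_tree (pverts \<Gamma>) x p"
proof -
  have G: "pair_graph \<Gamma>" and conn: "Digraph_Component.connected (with_proj \<Gamma>)"
    and acyc: "\<not> (\<exists>c. pre_digraph.cycle (with_proj \<Gamma>) c \<and> length c \<ge> 3)"
    using T by (auto simp: undirected_tree_def)
  interpret G: pair_graph \<Gamma> by (rule G)
  let ?V = "pverts \<Gamma>"
  obtain p where p: "p \<in> rooted_forests ?V (nbrs \<Gamma>) {x}" using connected_parent_function[OF G conn x] by auto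
  interpret P: rooted_tree ?V x p by (rule rooted_tree_forest[OF G x p])
  have sub: "parcs (tree_of ?V p) \<subseteq> parcs \<Gamma>" by (rule parcs_tree_of_subset[OF G x p])
  have "parcs \<Gamma> \<subseteq> parcs (tree_of ?V p)"
  proof (rule ccontr)
    assume "\<not> parcs \<Gamma> \<subseteq> parcs (tree_of ?V p)"
    then obtain e where e: "e \<in> parcs \<Gamma>" "e \<notin> parcs (tree_of ?V p)" by blast
    obtain u v where "e = (u, v)" by (cases e)
    then have uv: "(u, v) \<in> parcs \<Gamma>" "(u, v) \<notin> parcs (tree_of ?V p)" using e by simp_all
    have uvV: "u \<in> ?V" "v \<in> ?V" "u \<noteq> v" using uv(1) G.in_arcsD1 G.in_arcsD2 G.no_loops' by auto
    obtain q where q: "P.T.apath u q v"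
      using P.reachable_all[OF uvV(1,2)] P.T.reachable_apath by blast
    have cas: "pcas u q v" and qa: "set q \<subseteq> parcs (tree_of ?V p)" and dq: "distinct (pawalk_verts u q)"
      using q by (auto simp: P.T.apath_def P.T.awalk_def)
    \<comment> \<open>The path has at least two arcs because \<open>u\<close> and \<open>v\<close>
      are distinct and not adjacent in the tree of parent edges; the extra edge brings the cycle to
      the forbidden length 3.\<close>
    have len: "length q \<ge> 2"
    proof (rule ccontr)
      assume "\<not> length q \<ge> 2"
      then have "q = [] \<or> (\<exists>e. q = [e])" by (cases q) (auto simp: Suc_le_eq)
      then show False using cas qa uvV uv by auto
    qed
    have w1: "G.awalk u q v" using cas qa sub uvV by (auto simp: G.awalk_def)
    have "G.awalk v [(v, u)] u" using G.arcs_symmetric[OF uv(1)] uvV by (simp add: G.awalk_simps)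
    then have w: "G.awalk u (q @ [(v, u)]) u" using w1 by (rule G.awalk_appendI[rotated])
    have "pawalk_verts u (q @ [(v, u)]) = pawalk_verts u q @ [u]"
      using G.awalk_verts_append[OF w] w1 by simp
    moreover obtain ws where ws: "pawalk_verts u q = u # ws"
    proof -
      have "pawalk_verts u q \<noteq> []" "hd (pawalk_verts u q) = u" using w1 by (auto intro: G.awhd_of_awalk)
      then show ?thesis using that by (cases "pawalk_verts u q") auto
    qed
    ultimately have "distinct (tl (pawalk_verts u (q @ [(v, u)])))" using dq by simp
    then have "G.cycle (q @ [(v, u)])" using w unfolding G.cycle_def by blast
    then show False using acyc len by auto
  qed
  then have "parcs \<Gamma> = parcs (tree_of ?V p)" using sub by blast
  then have "\<Gamma> = tree_of ?V p" by simp
  then show ?thesis using that p P.rooted_tree_axioms by blast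
qed

lemma bij_betw_spanning_trees:
  assumes G: "pair_graph G" and x: "x \<in> pverts G"
  shows "bij_betw (tree_of (pverts G)) (rooted_forests (pverts G) (nbrs G) {x}) (spanning_trees G)"
proof (rule bij_betw_imageI)
  interpret G: pair_graph G by (rule G)
  let ?V = "pverts G" and ?F = "rooted_forests (pverts G) (nbrs G) {x}"
  have rt: "rooted_tree ?V x p" if "p \<in> ?F" for p using rooted_tree_forest[OF G x that] .
  show "inj_on (tree_of ?V) ?F"
    by (intro inj_onI) (rule rooted_tree.tree_of_inject[OF rt rt])
  show "tree_of ?V ` ?F = spanning_trees G"
  proof (intro equalityI subsetI)
    fix \<Gamma> assume "\<Gamma> \<in> tree_of ?V ` ?F"
    then obtain p where p: "p \<in> ?F" "\<Gamma> = tree_of ?V p" by auto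
    interpret P: rooted_tree ?V x p by (rule rt[OF p(1)])
    have "parcs \<Gamma> \<subseteq> parcs G" unfolding p(2) by (rule parcs_tree_of_subset[OF G x p(1)])
    then show "\<Gamma> \<in> spanning_trees G"
      using P.undirected_tree_of p G.wf_digraph P.T.wf_digraph
      by (simp add: spanning_trees_def spanning_def subgraph_def compatible_def)
  next
    fix \<Gamma> assume "\<Gamma> \<in> spanning_trees G"
    then have T: "undirected_tree \<Gamma>" and V: "pverts \<Gamma> = ?V" and sub: "parcs \<Gamma> \<subseteq> parcs G"
      by (auto simp: spanning_trees_def spanning_def subgraph_def)
    obtain p where p: "p \<in> rooted_forests ?V (nbrs \<Gamma>) {x}" "\<Gamma> = tree_of ?V p"
      using undirected_treeE[OF T, of x] x V by auto
    have "p \<in> ?F" using p(1) by (rule rooted_forests_mono) (use sub in \<open>auto simp: nbrs_def\<close>)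
    then show "\<Gamma> \<in> tree_of ?V ` ?F" using p(2) by blast
  qed
qed

section \<open>Balls of the tree and embeddings\<close>

lemma dominates_induce:
  "(a, b) \<in> arcs_ends (with_proj G \<restriction> ball_verts) \<longleftrightarrow> (a, b) \<in> parcs G \<and> a \<in> ball_verts \<and> b \<in> ball_verts"
  by (auto simp: arcs_ends_conv induce_subgraph_def image_iff)

section \<open>Rooted isomorphisms\<close>

lemma rooted_isosI:
  assumes "f \<in> extensional (verts G)" "bij_betw f (verts G) (verts H)" "f u = v"
    and "\<And>a b. a \<in> verts G \<Longrightarrow> b \<in> verts G \<Longrightarrow> (a, b) \<in> arcs_ends G \<longleftrightarrow> (f a, f b) \<in> arcs_ends H"
  shows "f \<in> rooted_isos G u H v"
  using assms unfolding rooted_isos_def by (auto simp: PiE_def bij_betw_def)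

lemma rooted_isosD:
  assumes "f \<in> rooted_isos G u H v"
  shows "f \<in> extensional (verts G)" "bij_betw f (verts G) (verts H)" "f u = v"
    and "\<And>a b. a \<in> verts G \<Longrightarrow> b \<in> verts G \<Longrightarrow> (a, b) \<in> arcs_ends G \<longleftrightarrow> (f a, f b) \<in> arcs_ends H"
  using assms unfolding rooted_isos_def by (auto simp: PiE_def)

text \<open>Composition with the inverse of a fixed isomorphism \<open>g\<close> turns isomorphisms
  into automorphisms of \<open>H\<close>; \<open>compose\<close> keeps the functions
  extensional.\<close>

lemma card_rooted_isos:
  assumes "rooted_isos G u H v \<noteq> {}" and u: "u \<in> verts G"
  shows "card (rooted_isos G u H v) = card (rooted_isos H v H v)"
proof -
  obtain g where g: "g \<in> rooted_isos G u H v" using assms by auto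
  let ?A = "verts G" and ?B = "verts H"
  note gD = rooted_isosD[OF g]
  define g' where "g' = inv_into ?A g"
  have g': "g' y \<in> ?A" "g (g' y) = y" if "y \<in> ?B" for y
    using that gD(2) by (auto simp: g'_def bij_betw_def inv_into_into f_inv_into_f)
  have g'g: "g' (g a) = a" if "a \<in> ?A" for a
    using that gD(2) by (auto simp: g'_def bij_betw_def)
  have gB: "g a \<in> ?B" if "a \<in> ?A" for a using that gD(2) by (auto simp: bij_betw_def)
  have v: "v \<in> ?B" "g' v = u" using gB[OF u] g'g[OF u] gD(3) by auto
  have bg': "bij_betw g' ?B ?A" unfolding g'_def by (rule bij_betw_inv_into[OF gD(2)])
  have "bij_betw (\<lambda>f. compose ?B f g') (rooted_isos G u H v) (rooted_isos H v H v)"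
  proof (rule bij_betw_byWitness[where f' = "\<lambda>h. compose ?A h g"])
    show "\<forall>f\<in>rooted_isos G u H v. compose ?A (compose ?B f g') g = f"
    proof
      fix f assume f: "f \<in> rooted_isos G u H v"
      show "compose ?A (compose ?B f g') g = f"
      proof (rule extensionalityI[of _ ?A])
        fix a assume "a \<in> ?A"
        then show "compose ?A (compose ?B f g') g a = f a" using gB g'g by (simp add: compose_def)
      qed (use rooted_isosD(1)[OF f] in \<open>auto simp: compose_def\<close>)
    qed
    show "\<forall>h\<in>rooted_isos H v H v. compose ?B (compose ?A h g) g' = h"
    proof
      fix h assume h: "h \<in> rooted_isos H v H v"
      show "compose ?B (compose ?A h g) g' = h"
      proof (rule extensionalityI[of _ ?B])
        fix a assume "a \<in> ?B"
        then show "compose ?B (compose ?A h g) g' a = h a" using g' by (simp add: compose_def)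
      qed (use rooted_isosD(1)[OF h] in \<open>auto simp: compose_def\<close>)
    qed
    show "(\<lambda>f. compose ?B f g') ` rooted_isos G u H v \<subseteq> rooted_isos H v H v"
    proof (intro image_subsetI rooted_isosI)
      fix f assume f: "f \<in> rooted_isos G u H v"
      show "compose ?B f g' \<in> extensional ?B" by (simp add: compose_def)
      show "bij_betw (compose ?B f g') ?B ?B"
        by (rule bij_betw_compose[OF bg' rooted_isosD(2)[OF f]])
      show "compose ?B f g' v = v" using v rooted_isosD(3)[OF f] by (simp add: compose_def)
      fix a b assume ab: "a \<in> ?B" "b \<in> ?B"
      then show "(a, b) \<in> arcs_ends H \<longleftrightarrow> (compose ?B f g' a, compose ?B f g' b) \<in> arcs_ends H"
        using rooted_isosD(4)[OF f g'(1)[OF ab(1)] g'(1)[OF ab(2)]] gD(4)[OF g'(1)[OF ab(1)] g'(1)[OF ab(2)]] g'(2)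
        by (simp add: compose_def)
    qed
    show "(\<lambda>h. compose ?A h g) ` rooted_isos H v H v \<subseteq> rooted_isos G u H v"
    proof (intro image_subsetI rooted_isosI)
      fix h assume h: "h \<in> rooted_isos H v H v"
      show "compose ?A h g \<in> extensional ?A" by (simp add: compose_def)
      show "bij_betw (compose ?A h g) ?A ?B"
        by (rule bij_betw_compose[OF gD(2) rooted_isosD(2)[OF h]])
      show "compose ?A h g u = v" using u gD(3) rooted_isosD(3)[OF h] by (simp add: compose_def)
      fix a b assume ab: "a \<in> ?A" "b \<in> ?A"
      then show "(a, b) \<in> arcs_ends G \<longleftrightarrow> (compose ?A h g a, compose ?A h g b) \<in> arcs_ends H"
        using gD(4)[OF ab] rooted_isosD(4)[OF h gB[OF ab(1)] gB[OF ab(2)]] by (simp add: compose_def)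
    qed
  qed
  then show ?thesis by (rule bij_betw_same_card)
qed

text \<open>The first tree plays the role of the spanning tree with root \<open>x\<close>, the
  second that of the fixed tree, whose vertices are listed in \<open>ts\<close> with parents before
  children.\<close>

locale tree_pair = P: rooted_tree V x p + Q: rooted_tree W \<rho> q
  for V :: "'a set" and x p and W :: "'b set" and \<rho> q +
  fixes r :: nat and ts :: "'b list" and par :: "nat \<Rightarrow> nat"
  assumes ts: "distinct ts" "set ts = W" "ts ! 0 = \<rho>"
    and par: "1 \<le> i \<Longrightarrow> i < length ts \<Longrightarrow> par i < i \<and> q (ts ! i) = ts ! par i"
    and height: "w \<in> W \<Longrightarrow> depth q \<rho> w \<le> r"
begin

definition ball_verts where "ball_verts = {v \<in> V. depth p x v \<le> r}"

abbreviation isos where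
  "isos \<equiv> rooted_isos (tree_ball (tree_of V p) x r) x (with_proj (tree_of W q)) \<rho>"

text \<open>Vertices at depth \<open>r\<close> are exempt: their further children lie outside the
  ball and are unrestricted.\<close>

definition interior where "interior = {i. i < length ts \<and> depth q \<rho> (ts ! i) < r}"

definition embeddings :: "'a list set" where
  "embeddings = {xs. length xs = length ts \<and> set xs \<subseteq> V \<and> distinct xs \<and> xs ! 0 = x \<and> consistent par p xs
     \<and> (\<forall>v \<in> V - set xs. p v \<notin> (!) xs ` interior)}"

lemma ts_pos: "0 < length ts"
  using ts Q.root_in by auto

lemma verts_ball: "verts (tree_ball (tree_of V p) x r) = ball_verts"
  using P.graph_dist_root by (auto simp: tree_ball_def ball_verts_def)

lemma arcs_ball: "(a, b) \<in> arcs_ends (tree_ball (tree_of V p) x r)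
  \<longleftrightarrow> (a, b) \<in> parcs (tree_of V p) \<and> a \<in> ball_verts \<and> b \<in> ball_verts"
  using verts_ball unfolding tree_ball_def by (simp only: dominates_induce) simp

lemma x_in_ball: "x \<in> ball_verts"
  using P.root_in by (simp add: ball_verts_def)

lemma parent_in_ball: "v \<in> ball_verts \<Longrightarrow> p v \<in> ball_verts"
  using P.parent_in P.depth_Suc[of v] P.parent_root by (cases "v = x") (auto simp: ball_verts_def)

lemma parent_parent_ne: "v \<in> V \<Longrightarrow> v \<noteq> x \<Longrightarrow> p (p v) \<noteq> v"
  using P.depth_Suc[of v] P.depth_Suc[of "p v"] P.parent_in[of v] P.parent_root
  by (cases "p v = x") auto

text \<open>Induction from the root. \<open>f (p v)\<close> is adjacent to \<open>f v\<close>, hence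
  its parent or its child; it is not a child, because the parent of \<open>f (p v)\<close> is
  \<open>f (p (p v))\<close> by induction and \<open>f\<close> is injective.\<close>

lemma iso_parent:
  assumes f: "f \<in> isos" and v: "v \<in> ball_verts"
  shows "f (p v) = q (f v) \<and> depth q \<rho> (f v) = depth p x v"
proof -
  note fD = rooted_isosD[OF f, unfolded verts_ball arcs_ball]
  have fW: "f a \<in> W" if "a \<in> ball_verts" for a using that fD(2) by (auto simp: bij_betw_def)
  have inj: "f a = f b \<longleftrightarrow> a = b" if "a \<in> ball_verts" "b \<in> ball_verts" for a b
    using that fD(2) by (auto simp: bij_betw_def inj_on_eq_iff)
  have "v \<in> V" using v by (simp add: ball_verts_def)
  then have "v \<in> ball_verts \<Longrightarrow> ?thesis"
  proof (induction rule: P.depth_induct)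
    case root
    show ?case using fD(3) P.parent_root Q.parent_root by simp
  next
    case (step v)
    have pB: "p v \<in> ball_verts" using parent_in_ball step by blast
    have IH: "f (p (p v)) = q (f (p v))" "depth q \<rho> (f (p v)) = depth p x (p v)" using step.IH pB by auto
    have fv: "f v \<noteq> \<rho>" using inj[OF step.prems x_in_ball] fD(3) step.hyps by auto
    have "(f v, f (p v)) \<in> parcs (tree_of W q)"
      using fD(4)[OF step.prems pB] P.adj_parent[OF step.hyps] step.prems pB by simp
    then have adj: "f v \<in> W" "q (f v) = f (p v) \<or> q (f (p v)) = f v" by auto
    have "q (f (p v)) \<noteq> f v"
      using IH(1) inj[of "p (p v)" v] parent_in_ball[OF pB] step.prems parent_parent_ne[OF step.hyps] by auto
    then have "f (p v) = q (f v)" using adj by simp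
    then show ?case using Q.depth_Suc[OF adj(1) fv] P.depth_Suc[OF step.hyps] IH by simp
  qed
  then show ?thesis using v by blast
qed

definition emb_of :: "('a \<Rightarrow> 'b) \<Rightarrow> 'a list" where
  "emb_of f = map (inv_into ball_verts f) ts"

lemma emb_of_nth:
  assumes f: "f \<in> isos" and i: "i < length ts"
  shows "emb_of f ! i \<in> ball_verts" "f (emb_of f ! i) = ts ! i"
proof -
  have b: "bij_betw f ball_verts W" using rooted_isosD(2)[OF f] by (simp add: verts_ball)
  have "ts ! i \<in> f ` ball_verts" using b ts(2) i by (auto simp: bij_betw_def)
  then show "emb_of f ! i \<in> ball_verts" "f (emb_of f ! i) = ts ! i"
    using i by (auto simp: emb_of_def inv_into_into f_inv_into_f)
qed

lemma set_emb_of: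
  assumes "f \<in> isos"
  shows "set (emb_of f) = ball_verts" "distinct (emb_of f)"
proof -
  have b: "bij_betw (inv_into ball_verts f) W ball_verts"
    using rooted_isosD(2)[OF assms] bij_betw_inv_into by (simp add: verts_ball)
  show "set (emb_of f) = ball_verts" using b ts(2) by (simp add: emb_of_def bij_betw_def)
  show "distinct (emb_of f)" using b ts by (simp add: emb_of_def bij_betw_def distinct_map)
qed

lemma emb_of_embedding:
  assumes f: "f \<in> isos"
  shows "emb_of f \<in> embeddings"
proof -
  let ?xs = "emb_of f"
  have len: "length ?xs = length ts" by (simp add: emb_of_def)
  have b: "bij_betw f ball_verts W" using rooted_isosD(2)[OF f] by (simp add: verts_ball)
  have inj: "f a = f b \<longleftrightarrow> a = b" if "a \<in> ball_verts" "b \<in> ball_verts" for a b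
    using that b by (auto simp: bij_betw_def inj_on_eq_iff)
  have fx: "f x = \<rho>" using rooted_isosD(3)[OF f] .
  have nth: "?xs ! i \<in> ball_verts" "f (?xs ! i) = ts ! i" if "i < length ts" for i
    using emb_of_nth[OF f that] by auto
  have "?xs ! 0 = x" using inj[OF nth(1)[OF ts_pos] x_in_ball] nth(2)[OF ts_pos] fx ts(3) by simp
  moreover have "p (?xs ! i) = ?xs ! par i" if i: "1 \<le> i" "i < length ts" for i
  proof -
    have pi: "par i < length ts" using par[OF i] i by simp
    have "f (p (?xs ! i)) = ts ! par i" using iso_parent[OF f nth(1)[OF i(2)]] nth(2)[OF i(2)] par[OF i] by simp
    then show ?thesis using inj[OF parent_in_ball[OF nth(1)[OF i(2)]] nth(1)[OF pi]] nth(2)[OF pi] by simp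
  qed
  moreover have "p v \<notin> (!) ?xs ` interior" if v: "v \<in> V - ball_verts" for v
  proof
    assume "p v \<in> (!) ?xs ` interior"
    then obtain a where a: "a < length ts" "depth q \<rho> (ts ! a) < r" "p v = ?xs ! a" by (auto simp: interior_def)
    have "depth p x (p v) < r" using iso_parent[OF f nth(1)[OF a(1)]] nth(2)[OF a(1)] a by simp
    moreover have "v \<noteq> x" using v x_in_ball by auto
    ultimately show False using v P.depth_Suc[of v] by (auto simp: ball_verts_def)
  qed
  moreover have "ball_verts \<subseteq> V" by (auto simp: ball_verts_def)
  ultimately show ?thesis
    using set_emb_of[OF f] len by (auto simp: embeddings_def consistent_def)
qed

lemma inj_emb_of: "inj_on emb_of isos"
proof (rule inj_onI)
  fix f g assume f: "f \<in> isos" and g: "g \<in> isos" and eq: "emb_of f = emb_of g"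
  show "f = g"
  proof (rule extensionalityI[of _ ball_verts])
    show "f \<in> extensional ball_verts" "g \<in> extensional ball_verts"
      using rooted_isosD(1)[OF f] rooted_isosD(1)[OF g] by (simp_all add: verts_ball)
    fix v assume "v \<in> ball_verts"
    then have "v \<in> set (emb_of f)" using set_emb_of(1)[OF f] by simp
    then obtain i where "i < length (emb_of f)" "emb_of f ! i = v" unfolding in_set_conv_nth by blast
    then have i: "i < length ts" "v = emb_of f ! i" by (auto simp: emb_of_def)
    then show "f v = g v" using emb_of_nth(2)[OF f i(1)] emb_of_nth(2)[OF g i(1)] eq by simp
  qed
qed

text \<open>Matching parents gives equal depths, so \<open>xs\<close> stays inside the ball.
  Conversely \<open>xs\<close> exhausts the ball: if the parent of a ball vertex lies in
  \<open>xs\<close>, this parent has depth below \<open>r\<close>, and no vertex outside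
  \<open>xs\<close> may be its child.\<close>

lemma embedding_emb_of:
  assumes xs: "xs \<in> embeddings"
  shows "\<exists>f \<in> isos. emb_of f = xs"
proof -
  have len: "length xs = length ts" and xV: "set xs \<subseteq> V" and dist: "distinct xs" and x0: "xs ! 0 = x"
    and par_xs: "\<And>i. 1 \<le> i \<Longrightarrow> i < length ts \<Longrightarrow> p (xs ! i) = xs ! par i"
    and ex: "\<And>v. v \<in> V \<Longrightarrow> v \<notin> set xs \<Longrightarrow> p v \<notin> (!) xs ` interior"
    using xs by (auto simp: embeddings_def consistent_def)
  have xne: "xs ! i \<noteq> x" and tne: "ts ! i \<noteq> \<rho>" if "1 \<le> i" "i < length ts" for i
    using that nth_eq_iff_index_eq[OF dist, of i 0] nth_eq_iff_index_eq[OF ts(1), of i 0] len x0 ts(3) ts_pos by auto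
  have xsV: "xs ! i \<in> V" if "i < length ts" for i using xV len nth_mem[of i xs] that by auto
  have tsW: "ts ! i \<in> W" if "i < length ts" for i using that ts(2) nth_mem by blast
  have dep: "depth p x (xs ! i) = depth q \<rho> (ts ! i)" if "i < length ts" for i
    using that
  proof (induction i rule: less_induct)
    case (less i)
    show ?case
    proof (cases "i = 0")
      case False
      then have i: "1 \<le> i" "i < length ts" using less.prems by auto
      have "depth p x (xs ! par i) = depth q \<rho> (ts ! par i)" using less.IH[of "par i"] par[OF i] i by simp
      then show ?thesis
        using P.depth_Suc[OF xsV[OF i(2)] xne[OF i]] Q.depth_Suc[OF tsW[OF i(2)] tne[OF i]] par_xs[OF i] par[OF i]
        by simp
    qed (simp add: x0 ts(3))
  qed
  have "set xs \<subseteq> ball_verts"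
    using xsV dep height tsW len by (auto simp: ball_verts_def in_set_conv_nth)
  moreover have "v \<in> set xs" if v: "v \<in> ball_verts" for v
  proof -
    have "v \<in> V" using v by (simp add: ball_verts_def)
    then have "v \<in> ball_verts \<Longrightarrow> v \<in> set xs"
    proof (induction rule: P.depth_induct)
      case root
      show ?case using x0 ts_pos len nth_mem by metis
    next
      case (step v)
      have "p v \<in> set xs" using step parent_in_ball by blast
      then obtain a where a: "a < length ts" "p v = xs ! a" using len by (auto simp: in_set_conv_nth)
      have "depth q \<rho> (ts ! a) < r"
        using dep[OF a(1)] a(2) P.depth_Suc[OF step.hyps] step.prems by (simp add: ball_verts_def)
      then have "a \<in> interior" using a by (simp add: interior_def)
      then show ?case using ex[of v] step.hyps a by blast
    qed
    then show ?thesis using v by blast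
  qed
  ultimately have setxs: "set xs = ball_verts" by blast
  define idx where "idx v = (THE i. i < length xs \<and> xs ! i = v)" for v
  have idx: "idx (xs ! i) = i" if "i < length xs" for i
    unfolding idx_def using that nth_eq_iff_index_eq[OF dist] by (intro the_equality) auto
  define f where "f = (\<lambda>v\<in>ball_verts. ts ! idx v)"
  have f: "f (xs ! i) = ts ! i" if "i < length ts" for i
  proof -
    have "xs ! i \<in> ball_verts" using setxs len that nth_mem by metis
    then show ?thesis using idx[of i] that len by (simp add: f_def)
  qed
  have isoB: "\<exists>i < length ts. v = xs ! i" if "v \<in> ball_verts" for v
    using that setxs len by (metis in_set_conv_nth)
  have bij: "bij_betw f ball_verts W"
  proof (rule bij_betw_imageI)
    show "inj_on f ball_verts"
    proof (rule inj_onI)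
      fix a b assume ab: "a \<in> ball_verts" "b \<in> ball_verts" "f a = f b"
      obtain i where i: "i < length ts" "a = xs ! i" using isoB[OF ab(1)] by blast
      obtain j where j: "j < length ts" "b = xs ! j" using isoB[OF ab(2)] by blast
      have "ts ! i = ts ! j" using ab f i j by simp
      then show "a = b" using i j nth_eq_iff_index_eq[OF ts(1)] by simp
    qed
    show "f ` ball_verts = W"
    proof (intro equalityI subsetI)
      fix w assume "w \<in> f ` ball_verts"
      then obtain v where "v \<in> ball_verts" "w = f v" by blast
      then show "w \<in> W" using isoB[of v] f tsW by auto
    next
      fix w assume "w \<in> W"
      then obtain i where i: "i < length ts" "w = ts ! i" using ts(2) by (metis in_set_conv_nth)
      then have "w = f (xs ! i)" using f by simp
      moreover have "xs ! i \<in> ball_verts" using i setxs len nth_mem by metis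
      ultimately show "w \<in> f ` ball_verts" by blast
    qed
  qed
  have fpar: "p a = b \<longleftrightarrow> q (f a) = f b" if a: "a \<in> ball_verts" and b: "b \<in> ball_verts" and ne: "a \<noteq> b" for a b
  proof -
    obtain i where i: "i < length ts" "a = xs ! i" using isoB[OF a] by blast
    obtain j where j: "j < length ts" "b = xs ! j" using isoB[OF b] by blast
    show ?thesis
    proof (cases "i = 0")
      case True
      have "\<rho> \<noteq> ts ! j" using ne i j True nth_eq_iff_index_eq[OF ts(1) ts_pos j(1)] ts(3) by auto
      then show ?thesis using True i j f x0 ts(3) ne P.parent_root Q.parent_root by auto
    next
      case False
      then have i': "1 \<le> i" "i < length ts" using i by auto
      have "par i < length ts" using par[OF i'] i' by simp
      then show ?thesis
        using i j f par_xs[OF i'] par[OF i'] nth_eq_iff_index_eq[OF dist, of "par i" j]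
          nth_eq_iff_index_eq[OF ts(1), of "par i" j] len by simp
    qed
  qed
  have "f \<in> isos"
  proof (rule rooted_isosI, unfold verts_ball arcs_ball with_proj_simps tree_of_simps)
    show "f \<in> extensional ball_verts" by (simp add: f_def)
    show "bij_betw f ball_verts W" by (rule bij)
    show "f x = \<rho>" using f[OF ts_pos] x0 ts(3) by simp
    fix a b assume ab: "a \<in> ball_verts" "b \<in> ball_verts"
    have "f a \<in> W" "f b \<in> W" using bij ab by (auto simp: bij_betw_def)
    moreover have "a \<in> V" "b \<in> V" using ab by (auto simp: ball_verts_def)
    moreover have "f a = f b \<longleftrightarrow> a = b" using bij ab by (auto simp: bij_betw_def inj_on_eq_iff)
    ultimately show "((a \<in> V \<and> b \<in> V \<and> a \<noteq> b \<and> (p a = b \<or> p b = a)) \<and> a \<in> ball_verts \<and> b \<in> ball_verts) =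
      (f a \<in> W \<and> f b \<in> W \<and> f a \<noteq> f b \<and> (q (f a) = f b \<or> q (f b) = f a))"
      using fpar[OF ab] fpar[OF ab(2,1)] ab by auto
  qed
  moreover have "emb_of f = xs"
  proof (rule nth_equalityI)
    fix i assume "i < length (emb_of f)"
    then have i: "i < length ts" by (simp add: emb_of_def)
    have "xs ! i \<in> ball_verts" using i setxs len nth_mem by metis
    then have "inv_into ball_verts f (f (xs ! i)) = xs ! i" using bij by (simp add: bij_betw_def)
    then show "emb_of f ! i = xs ! i" using f[OF i] i by (simp add: emb_of_def)
  qed (simp add: emb_of_def len)
  ultimately show ?thesis by blast
qed

lemma card_isos: "card isos = card embeddings"
proof -
  have "bij_betw emb_of isos embeddings"
    unfolding bij_betw_def using inj_emb_of emb_of_embedding embedding_emb_of by blast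
  then show ?thesis by (rule bij_betw_same_card)
qed

text \<open>This dichotomy converts the mean number of exact embeddings into a probability, and it
  supplies the uniform bound \<open>s\<close> needed for the atypical copies.\<close>

lemma card_embeddings:
  "card embeddings = (if rooted_isomorphic (tree_ball (tree_of V p) x r) x (with_proj (tree_of W q)) \<rho>
     then card (Stab (tree_of W q) \<rho>) else 0)"
  using card_isos card_rooted_isos[of "tree_ball (tree_of V p) x r" x "with_proj (tree_of W q)" \<rho>] x_in_ball verts_ball
  by (auto simp: rooted_isomorphic_def Stab_def)

end

section \<open>The limit\<close>

text \<open>Sorting by depth places every parent before its children, and the root, the only vertex
  of depth 0, at the front.\<close>

lemma (in rooted_tree) ordered_enumeration:
  obtains ts :: "'a list" and par :: "nat \<Rightarrow> nat"
  where "distinct ts" "set ts = V" "ts ! 0 = x"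
    "\<And>i. 1 \<le> i \<Longrightarrow> i < length ts \<Longrightarrow> par i < i \<and> p (ts ! i) = ts ! par i"
proof -
  obtain ws where ws: "set ws = V" "distinct ws" using finite_distinct_list[OF finite_V] by auto
  define ts where "ts = sort_key dep ws"
  have ts: "distinct ts" "set ts = V" using ws by (simp_all add: ts_def)
  have sorted: "dep (ts ! i) \<le> dep (ts ! j)" if "i \<le> j" "j < length ts" for i j
  proof -
    have "sorted (map dep ts)" by (simp add: ts_def)
    then show ?thesis using that sorted_nth_mono[of "map dep ts" i j] by simp
  qed
  have ts0: "ts ! 0 = x"
  proof -
    obtain i where i: "i < length ts" "ts ! i = x" using root_in ts(2) by (metis in_set_conv_nth)
    then have "dep (ts ! 0) = 0" using sorted[of 0 i] by simp
    moreover have "ts ! 0 \<in> V" using ts(2) i nth_mem[of 0 ts] by (cases ts) auto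
    ultimately show ?thesis using depth_eq_0 by simp
  qed
  define par where "par i = (SOME j. j < length ts \<and> ts ! j = p (ts ! i))" for i
  have "par i < i \<and> p (ts ! i) = ts ! par i" if i: "1 \<le> i" "i < length ts" for i
  proof -
    have V: "ts ! i \<in> V" using ts(2) i nth_mem by blast
    then have "\<exists>j. j < length ts \<and> ts ! j = p (ts ! i)" using parent_in ts(2) by (metis in_set_conv_nth)
    then have "par i < length ts \<and> ts ! par i = p (ts ! i)" unfolding par_def by (rule someI_ex)
    then have j: "par i < length ts" "ts ! par i = p (ts ! i)" by auto
    have "ts ! i \<noteq> x" using nth_eq_iff_index_eq[OF ts(1) i(2), of 0] i ts0 by (metis One_nat_def Suc_le_eq less_imp_not_eq2 less_trans)
    then have "dep (ts ! par i) < dep (ts ! i)" using depth_Suc[OF V] j(2) by simp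
    then have "par i < i" using sorted[of i "par i"] j(1) by (cases "i \<le> par i") auto
    then show ?thesis using j(2) by simp
  qed
  then show ?thesis using that[OF ts ts0] by blast
qed

lemma reg_graph_nbrs:
  assumes G: "pair_graph G" and conn: "Digraph_Component.connected (with_proj G)"
    and reg: "regular_graph G d" and d: "d \<ge> 1"
  shows "reg_graph (pverts G) (nbrs G) d"
proof -
  interpret G: pair_graph G by (rule G)
  show ?thesis
  proof unfold_locales
    show "finite (pverts G)" by (rule G.pair_finite_verts)
    show "nbrs G v \<subseteq> pverts G" for v using G.in_arcsD2 by (auto simp: nbrs_def)
    show "v \<in> nbrs G w" if "w \<in> nbrs G v" for v w
      using that G.arcs_symmetric by (auto simp: nbrs_def)
    show "v \<notin> nbrs G v" for v using G.no_loops' by (auto simp: nbrs_def)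
    show "pverts G \<noteq> {}" using conn by (auto simp: connected_def strongly_connected_def)
    show "rooted_forests (pverts G) (nbrs G) {x} \<noteq> {}" if "x \<in> pverts G" for x
      using connected_parent_function[OF G conn that] by auto
    show "card (nbrs G v) = d" if "v \<in> pverts G" for v
    proof -
      have "out_arcs (with_proj G) v = Pair v ` nbrs G v" by (auto simp: out_arcs_def nbrs_def)
      then have "out_degree (with_proj G) v = card (nbrs G v)"
        by (simp add: out_degree_def card_image inj_on_def)
      then show ?thesis using reg that by (simp add: regular_graph_def)
    qed
    show "1 \<le> d" by (rule d)
  qed
qed

lemma pair_pmf_of_sets:
  fixes A :: "'a set" and B :: "'b set"
  assumes "finite A" "A \<noteq> {}" "finite B" "B \<noteq> {}"
  shows "pair_pmf (pmf_of_set A) (pmf_of_set B) = pmf_of_set (A \<times> B)"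
proof (rule pmf_eqI)
  fix z :: "'a \<times> 'b"
  obtain a b where z: "z = (a, b)" by (cases z)
  show "pmf (pair_pmf (pmf_of_set A) (pmf_of_set B)) z = pmf (pmf_of_set (A \<times> B)) z"
    using assms by (simp add: z pmf_pair pmf_of_set indicator_def card_cartesian_product)
qed

lemma (in reg_graph) card_exact_pairs:
  assumes k: "k \<ge> 1" "tree_order par k" "I \<subseteq> {..<k}"
  shows "card (exact_pairs par k I) = (\<Sum>x\<in>V. \<Sum>p\<in>F {x}.
    card {xs \<in> homs par k. distinct xs \<and> xs ! 0 = x \<and> consistent par p xs \<and> exact I p xs})"
proof -
  let ?E = "\<lambda>x p. {xs \<in> homs par k. distinct xs \<and> xs ! 0 = x \<and> consistent par p xs \<and> exact I p xs}"
  have fE: "finite (?E x p)" for x p by (rule finite_subset[OF _ finite_homs[of par k]]) auto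
  have "bij_betw (\<lambda>(xs, p). (xs ! 0, p, xs)) (exact_pairs par k I) (SIGMA x:V. SIGMA p:F {x}. ?E x p)"
  proof (rule bij_betw_byWitness[where f' = "\<lambda>(x, p, xs). (xs, p)"])
    show "(\<lambda>(xs, p). (xs ! 0, p, xs)) ` exact_pairs par k I \<subseteq> (SIGMA x:V. SIGMA p:F {x}. ?E x p)"
      using homs_nth[of _ par k 0] k by (auto simp: exact_pairs_def[OF k] matching_def[OF k])
    show "(\<lambda>(x, p, xs). (xs, p)) ` (SIGMA x:V. SIGMA p:F {x}. ?E x p) \<subseteq> exact_pairs par k I"
      by (auto simp: exact_pairs_def[OF k] matching_def[OF k])
  qed auto
  then have "card (exact_pairs par k I) = card (SIGMA x:V. SIGMA p:F {x}. ?E x p)"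
    by (rule bij_betw_same_card)
  also have "\<dots> = (\<Sum>x\<in>V. card (SIGMA p:F {x}. ?E x p))"
    using fE by (intro card_SigmaI finite_SigmaI ballI) auto
  also have "\<dots> = (\<Sum>x\<in>V. \<Sum>p\<in>F {x}. card (?E x p))"
    using fE by (intro sum.cong refl card_SigmaI ballI) auto
  finally show ?thesis .
qed

text \<open>The part with \<open>real j\<close> is the exponential series shifted by one index. At
  \<open>z = - m\<close> the sum is the limit \<open>(k - m) * exp (- m)\<close>; at
  \<open>z = m\<close> convergence shows that the Bonferroni remainder vanishes.\<close>

lemma exp_series_shifted: "(\<lambda>j. z ^ j * (real k + real j) / fact j) sums ((k + z) * exp z)"
proof -
  have e: "(\<lambda>j. z ^ j / fact j) sums exp z"
    using exp_converges[of z] by (simp add: scaleR_conv_of_real divide_inverse mult.commute)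
  have "(\<lambda>j. z ^ Suc j * real (Suc j) / fact (Suc j)) sums (z * exp z)"
  proof -
    have "z ^ Suc j * real (Suc j) / fact (Suc j) = z * (z ^ j / fact j)" for j
      by (simp add: field_simps del: of_nat_Suc)
    then show ?thesis using sums_mult[OF e, of z] by simp
  qed
  then have "(\<lambda>j. z ^ j * real j / fact j) sums (z * exp z)"
    by (subst (asm) sums_Suc_iff) simp
  then have "(\<lambda>j. k * (z ^ j / fact j) + z ^ j * real j / fact j) sums (k * exp z + z * exp z)"
    by (intro sums_add sums_mult e)
  then show ?thesis by (simp add: distrib_left distrib_right add_divide_distrib mult.commute)
qed

text \<open>Exact pairs are grouped by root and spanning tree: a group has \<open>s\<close> elements
  if the ball is isomorphic to the fixed tree, and none otherwise. Division by the number of pairs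
  of a spanning tree and a vertex gives \<open>s\<close> times the probability.\<close>

lemma ball_prob_approx:
  fixes G :: "'a pair_pre_digraph" and m :: real
  assumes G: "pair_graph G" and conn: "Digraph_Component.connected (with_proj G)"
    and reg: "regular_graph G d" and d: "d \<ge> 1"
    and T: "rooted_tree W \<rho> q"
    and ts: "distinct ts" "set ts = W" "ts ! 0 = \<rho>"
    and par: "\<And>i. 1 \<le> i \<Longrightarrow> i < length ts \<Longrightarrow> par i < i \<and> q (ts ! i) = ts ! par i"
    and height: "\<And>w. w \<in> W \<Longrightarrow> depth q \<rho> w \<le> r"
    and m: "m = real (card {i. i < length ts \<and> depth q \<rho> (ts ! i) < r})"
    and s: "s = card (Stab (tree_of W q) \<rho>)" and k: "k = length ts"
  shows "\<bar>s * measure_pmf.prob (pair_pmf (ust G) (pmf_of_set (pverts G)))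
        {(\<Gamma>, x). rooted_isomorphic (tree_ball \<Gamma> x r) x (with_proj (tree_of W q)) \<rho>}
      - (\<Sum>j\<le>J. (-1) ^ j * (m ^ j * (k + j) / fact j))\<bar>
    \<le> m ^ Suc J * (k + Suc J) / fact (Suc J)
      + ((\<Sum>j\<le>Suc J. m ^ j * mean_error (k + j) / fact j) + m * bad_step_bound k
         + s * (\<Sum>i = 1..<k. bad_step_bound i)) * (1 / sqrt d)"
proof -
  let ?V = "pverts G" and ?N = "nbrs G"
  let ?iso = "\<lambda>\<Gamma> x. rooted_isomorphic (tree_ball \<Gamma> x r) x (with_proj (tree_of W q)) \<rho>"
  interpret R: reg_graph ?V ?N d by (rule reg_graph_nbrs[OF G conn reg d])
  interpret T: rooted_tree W \<rho> q by (rule T)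
  define I where "I = {i. i < k \<and> depth q \<rho> (ts ! i) < r}"
  have k1: "k \<ge> 1" using ts T.root_in unfolding k by (cases ts) auto
  have t: "tree_order par k" using par by (auto simp: tree_order_def k)
  have I: "I \<subseteq> {..<k}" by (auto simp: I_def)
  note ctx = k1 t I
  let ?E = "\<lambda>x p. {xs \<in> R.homs par k. distinct xs \<and> xs ! 0 = x \<and> consistent par p xs \<and> R.exact I p xs}"
  have cardE: "card (?E x p) = (if ?iso (tree_of ?V p) x then s else 0)" if x: "x \<in> ?V" and p: "p \<in> R.F {x}" for x p
  proof -
    interpret TP: tree_pair ?V x p W \<rho> q r ts par
      using rooted_tree_forest[OF G x p] T ts par height
      by (intro tree_pair.intro tree_pair_axioms.intro) auto
    \<comment> \<open>\<open>TP.embeddings\<close> does not mention the edges of \<open>G\<close>;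
      they come from \<open>p\<close>, which maps every vertex other than \<open>x\<close> to one of
      its neighbours.\<close>
    have hom: "xs \<in> R.homs par k"
      if xs: "length xs = k" "set xs \<subseteq> ?V" "distinct xs" "xs ! 0 = x" "consistent par p xs" for xs
    proof -
      have "xs ! i \<in> ?N (xs ! par i)" if i: "1 \<le> i" "i < k" for i
      proof -
        have "xs ! i \<noteq> xs ! 0" using nth_eq_iff_index_eq[OF xs(3), of i 0] i xs(1) by auto
        moreover have "xs ! i \<in> ?V" using xs(1,2) i nth_mem by blast
        ultimately have "p (xs ! i) \<in> ?N (xs ! i)" using rooted_forestsD(2)[OF p] xs(4) by auto
        moreover have "p (xs ! i) = xs ! par i" using xs(1,5) i by (simp add: consistent_def)
        ultimately show ?thesis using R.N_sym[OF \<open>xs ! i \<in> ?V\<close>] by simp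
      qed
      then show ?thesis using xs by (auto simp: R.homs_def)
    qed
    have "TP.interior = I" by (auto simp: TP.interior_def I_def k)
    then have "?E x p = TP.embeddings"
      using hom by (auto simp: TP.embeddings_def R.exact_def[OF ctx] R.homs_def k)
    then show ?thesis using TP.card_embeddings by (simp add: s)
  qed
  have bij: "bij_betw (tree_of ?V) (R.F {x}) (spanning_trees G)" if "x \<in> ?V" for x
    by (rule bij_betw_spanning_trees[OF G that])
  obtain x0 where x0: "x0 \<in> ?V" using R.V_nonempty by auto
  have fin: "finite (spanning_trees G)" using bij_betw_finite[OF bij[OF x0]] R.finite_F by blast
  have card_ST: "real (card (spanning_trees G)) = R.num_trees"
    using bij_betw_same_card[OF bij[OF x0]] R.num_forests_singleton[OF x0] by (simp add: R.num_forests_def)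
  then have ne: "spanning_trees G \<noteq> {}" using R.num_trees_pos by auto
  have "real (card (R.exact_pairs par k I)) = (\<Sum>x\<in>?V. \<Sum>p\<in>R.F {x}. real (card (?E x p)))"
    unfolding R.card_exact_pairs[OF ctx] by simp
  also have "\<dots> = (\<Sum>x\<in>?V. real s * real (card {\<Gamma> \<in> spanning_trees G. ?iso \<Gamma> x}))"
  proof (rule sum.cong[OF refl])
    fix x assume x: "x \<in> ?V"
    have "(\<Sum>p\<in>R.F {x}. real (card (?E x p))) = (\<Sum>p\<in>R.F {x}. real s * of_bool (?iso (tree_of ?V p) x))"
      using cardE[OF x] by (intro sum.cong refl) auto
    also have "\<dots> = (\<Sum>\<Gamma>\<in>spanning_trees G. real s * of_bool (?iso \<Gamma> x))"
      by (rule sum.reindex_bij_betw[OF bij[OF x]])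
    also have "\<dots> = real s * real (card {\<Gamma> \<in> spanning_trees G. ?iso \<Gamma> x})"
      using fin by (simp add: sum_distrib_left[symmetric] Int_def)
    finally show "(\<Sum>p\<in>R.F {x}. real (card (?E x p))) = real s * real (card {\<Gamma> \<in> spanning_trees G. ?iso \<Gamma> x})" .
  qed
  also have "\<dots> = real s * real (card ((spanning_trees G \<times> ?V) \<inter> {(\<Gamma>, x). ?iso \<Gamma> x}))"
  proof -
    have "card ((spanning_trees G \<times> ?V) \<inter> {(\<Gamma>, x). ?iso \<Gamma> x})
      = card (SIGMA x:?V. {\<Gamma> \<in> spanning_trees G. ?iso \<Gamma> x})"
      by (rule bij_betw_same_card[of prod.swap], rule bij_betw_byWitness[where f' = prod.swap]) auto
    also have "\<dots> = (\<Sum>x\<in>?V. card {\<Gamma> \<in> spanning_trees G. ?iso \<Gamma> x})"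
      using fin by (intro card_SigmaI) auto
    finally show ?thesis by (simp add: sum_distrib_left)
  qed
  finally have count: "real (card (R.exact_pairs par k I))
    = real s * real (card ((spanning_trees G \<times> ?V) \<inter> {(\<Gamma>, x). ?iso \<Gamma> x}))" .
  have "measure_pmf.prob (pair_pmf (ust G) (pmf_of_set ?V)) {(\<Gamma>, x). ?iso \<Gamma> x}
    = real (card ((spanning_trees G \<times> ?V) \<inter> {(\<Gamma>, x). ?iso \<Gamma> x})) / real (card (spanning_trees G \<times> ?V))"
    unfolding ust_def pair_pmf_of_sets[OF fin ne R.finite_V R.V_nonempty]
    by (rule measure_pmf_of_set) (use fin ne R.V_nonempty in auto)
  then have prob: "s * measure_pmf.prob (pair_pmf (ust G) (pmf_of_set ?V)) {(\<Gamma>, x). ?iso \<Gamma> x}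
    = real (card (R.exact_pairs par k I)) / (R.num_trees * card ?V)"
    unfolding count by (simp add: card_cartesian_product card_ST)
  have bound: "card (?E x p) \<le> s" if "x \<in> ?V" "p \<in> R.F {x}" for x p
    using cardE[OF that] by simp
  have mI: "m = real (card I)" by (simp add: m I_def k)
  show ?thesis
    using R.exact_pairs_approx[OF ctx bound mI, of J] unfolding prob R.tol_def by simp
qed

theorem theorem1p2:
  fixes G :: "nat \<Rightarrow> 'a pair_pre_digraph" and d :: "nat \<Rightarrow> nat"
    and T :: "'b pair_pre_digraph" and \<rho> :: 'b and r :: nat
  assumes "\<And>n. n \<ge> 1 \<Longrightarrow> pair_graph (G n)"
    and "\<And>n. n \<ge> 1 \<Longrightarrow> Digraph_Component.connected (with_proj (G n))"
    and "\<And>n. n \<ge> 1 \<Longrightarrow> regular_graph (G n) (d n)"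
    and "filterlim d at_top sequentially"
    and "undirected_tree T" and "\<rho> \<in> pverts T"
    and "height T \<rho> = ereal (real r)" and "r \<ge> 1"
  shows "(\<lambda>n. measure_pmf.prob (pair_pmf (ust (G n)) (pmf_of_set (pverts (G n))))
            {(\<Gamma>, x). rooted_isomorphic (tree_ball \<Gamma> x r) x (with_proj T) \<rho>})
         \<longlonglongrightarrow>
         real (card (level T \<rho> r))
           * exp (- real (card (pverts T)) + real (card (level T \<rho> r)))
           / real (card (Stab T \<rho>))"
proof -
  let ?W = "pverts T"
  obtain q where q: "T = tree_of ?W q" "rooted_tree ?W \<rho> q"
    using undirected_treeE[OF assms(5,6)] by metis
  interpret T: rooted_tree ?W \<rho> q by (rule q(2))
  obtain ts par where ts: "distinct ts" "set ts = ?W" "ts ! 0 = \<rho>"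
    and par: "\<And>i. 1 \<le> i \<Longrightarrow> i < length ts \<Longrightarrow> par i < i \<and> q (ts ! i) = ts ! par i"
    using T.ordered_enumeration by metis
  have dist: "graph_dist T \<rho> w = ereal (real (depth q \<rho> w))" if "w \<in> ?W" for w
    using T.graph_dist_root[OF that] q(1) by simp
  have height: "depth q \<rho> w \<le> r" if w: "w \<in> ?W" for w
  proof -
    have "graph_dist T \<rho> w \<le> height T \<rho>"
      unfolding height_def using w T.finite_V by (intro Max_ge) auto
    then show ?thesis using dist[OF w] assms(7) by simp
  qed
  define k where "k = length ts"
  define m where "m = real (card {i. i < length ts \<and> depth q \<rho> (ts ! i) < r})"
  define s where "s = card (Stab T \<rho>)"
  define L where "L = real (card (level T \<rho> r))"
  have kV: "card ?W = k" using ts distinct_card k_def by metis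
  \<comment> \<open>Every vertex has depth at most \<open>r\<close>, so the vertices not counted by
    \<open>m\<close> form exactly the top level.\<close>
  have Lkm: "L = k - m"
  proof -
    let ?I = "{i. i < k \<and> depth q \<rho> (ts ! i) < r}" and ?L = "{i. i < k \<and> depth q \<rho> (ts ! i) = r}"
    have tsW: "ts ! i \<in> ?W" if "i < k" for i using that ts(2) nth_mem k_def by blast
    have "level T \<rho> r = (!) ts ` ?L"
    proof (intro equalityI subsetI)
      fix v assume "v \<in> level T \<rho> r"
      then have v: "v \<in> ?W" "depth q \<rho> v = r" using dist by (auto simp: level_def)
      then have "v \<in> set ts" using ts(2) by simp
      then obtain i where "i < k" "ts ! i = v" unfolding in_set_conv_nth k_def by blast
      then show "v \<in> (!) ts ` ?L" using v by auto
    next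
      fix v assume "v \<in> (!) ts ` ?L"
      then show "v \<in> level T \<rho> r" using tsW dist by (auto simp: level_def)
    qed
    moreover have "inj_on ((!) ts) ?L" using ts(1) k_def by (auto simp: inj_on_def nth_eq_iff_index_eq)
    ultimately have "card (level T \<rho> r) = card ?L" by (simp add: card_image)
    moreover have "card ?I + card ?L = k"
    proof -
      have "{..<k} = ?I \<union> ?L" using height tsW by (auto simp: le_less)
      moreover have "card (?I \<union> ?L) = card ?I + card ?L" by (intro card_Un_disjoint) auto
      ultimately show ?thesis by (metis card_lessThan)
    qed
    ultimately show ?thesis by (simp add: L_def m_def k_def)
  qed
  have s_pos: "s > 0"
  proof -
    have "restrict id ?W \<in> Stab T \<rho>"
      unfolding Stab_def by (rule rooted_isosI) (use assms(6) in \<open>auto simp: bij_betw_def inj_on_def\<close>)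
    moreover have "finite (Stab T \<rho>)"
      unfolding Stab_def rooted_isos_def using T.finite_V
      by (intro finite_subset[OF _ finite_PiE[of ?W "\<lambda>_. ?W"]]) auto
    ultimately show ?thesis by (auto simp: s_def card_gt_0_iff)
  qed
  let ?P = "\<lambda>n. measure_pmf.prob (pair_pmf (ust (G n)) (pmf_of_set (pverts (G n))))
            {(\<Gamma>, x). rooted_isomorphic (tree_ball \<Gamma> x r) x (with_proj T) \<rho>}"
  define S where "S J = (\<Sum>j\<le>J. (-1) ^ j * (m ^ j * (k + j) / fact j))" for J
  define tail where "tail J = m ^ Suc J * (k + Suc J) / fact (Suc J)" for J
  define C where "C J = (\<Sum>j\<le>Suc J. m ^ j * mean_error (k + j) / fact j) + m * bad_step_bound k
         + s * (\<Sum>i = 1..<k. bad_step_bound i)" for J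
  have approx: "\<bar>s * ?P n - S J\<bar> \<le> tail J + C J * (1 / sqrt (d n))" if n: "n \<ge> 1" "d n \<ge> 1" for n J
    using ball_prob_approx[OF assms(1,2,3)[OF n(1)] n(2) q(2) ts par height m_def, of s k J]
    unfolding q(1)[symmetric] by (simp add: s_def k_def S_def tail_def C_def)
  have S_lim: "S \<longlonglongrightarrow> L * exp (- m)"
  proof -
    have "(\<lambda>j. (-1) ^ j * (m ^ j * (k + j) / fact j)) sums (L * exp (- m))"
      using exp_series_shifted[of "- m" k] by (simp add: Lkm power_minus[of m] mult.assoc)
    then show ?thesis unfolding sums_def_le S_def[abs_def] .
  qed
  have tail_lim: "tail \<longlonglongrightarrow> 0"
  proof -
    have "summable (\<lambda>j. m ^ j * (real k + real j) / fact j)"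
      using exp_series_shifted[of m k] by (rule sums_summable)
    then have "(\<lambda>j. m ^ j * (real k + real j) / fact j) \<longlonglongrightarrow> 0" by (rule summable_LIMSEQ_zero)
    then have "(\<lambda>j. m ^ Suc j * (real k + real (Suc j)) / fact (Suc j)) \<longlonglongrightarrow> 0" by (rule LIMSEQ_Suc)
    then show ?thesis by (simp only: tail_def[abs_def] of_nat_add)
  qed
  have d_lim: "(\<lambda>n. C J * (1 / sqrt (d n))) \<longlonglongrightarrow> 0" for J
  proof -
    have "filterlim (\<lambda>n. real (d n)) at_top sequentially"
      by (rule filterlim_compose[OF filterlim_real_sequentially assms(4)])
    then have "filterlim (\<lambda>n. sqrt (real (d n))) at_top sequentially"
      by (rule filterlim_compose[OF sqrt_at_top])
    then have "(\<lambda>n. 1 / sqrt (d n)) \<longlonglongrightarrow> 0"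
      by (rule tendsto_divide_0[OF tendsto_const filterlim_at_top_imp_at_infinity])
    then show ?thesis by (rule tendsto_mult_right_zero)
  qed
  have "(\<lambda>n. s * ?P n) \<longlonglongrightarrow> L * exp (- m)"
  proof (rule tendstoI)
    \<comment> \<open>The order of the limits matters: \<open>C J\<close> depends on
      \<open>J\<close>, so the truncation is fixed before \<open>n\<close> tends to
      infinity.\<close>
    fix e :: real assume e: "e > 0"
    have "\<forall>\<^sub>F J in sequentially. dist (S J) (L * exp (- m)) < e / 3 \<and> dist (tail J) 0 < e / 3"
      using tendstoD[OF S_lim, of "e / 3"] tendstoD[OF tail_lim, of "e / 3"] e by (intro eventually_conj) auto
    then obtain J where J: "dist (S J) (L * exp (- m)) < e / 3" "dist (tail J) 0 < e / 3"
      using eventually_happens'[OF sequentially_bot] by blast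
    have "\<forall>\<^sub>F n in sequentially. dist (C J * (1 / sqrt (d n))) 0 < e / 3"
      using tendstoD[OF d_lim, of "e / 3"] e by simp
    moreover have "\<forall>\<^sub>F n in sequentially. d n \<ge> 1" using assms(4) by (simp add: filterlim_at_top)
    moreover have "\<forall>\<^sub>F n in sequentially. n \<ge> 1" by (rule eventually_ge_at_top)
    ultimately show "\<forall>\<^sub>F n in sequentially. dist (s * ?P n) (L * exp (- m)) < e"
    proof eventually_elim
      case (elim n)
      then show ?case using approx[of n J] J unfolding dist_real_def by linarith
    qed
  qed
  then have "(\<lambda>n. s * ?P n / s) \<longlonglongrightarrow> L * exp (- m) / s" by (intro tendsto_divide tendsto_const) (use s_pos in auto)
  moreover have "- m = - real (card ?W) + L" using Lkm kV by simp
  ultimately show ?thesis using s_pos by (simp add: s_def[symmetric] L_def)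
qed

end
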